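(* Let $\alpha\in(0,1)$, $H\in(0,\tfrac12)$, $T>0$, and let $\rho$ be a real number with $-\frac{\alpha}{4}-\frac{H\alpha}{2}<\rho<\frac{\alpha+1}{4}-\frac{H\alpha}{2}$ such that $\sum_{i=1}^\infty\|A^{\rho}Q^{1/2}\phi_i\|^2=\sum_i\lambda_i^{2\rho}q_i<\infty$. Set $\kappa=\frac{\alpha}{2}+H\alpha+2\rho$ and assume $0<\kappa<\alpha+\frac12$. Let $f:\mathbb{R}\to\mathbb{R}$ be Lipschitz continuous, and let $u_0,v_0$ satisfy $\|u_0\|_{L^2(\Omega,\mathbb{H}^\kappa)}<\infty$, $\|v_0\|_{L^2(\Omega,\mathbb{H}^{\kappa-\alpha})}<\infty$. Let $u$ be the mild solution of $\mathrm{d}\dot u=-A^\alpha u\,\mathrm{d}t+f(u)\,\mathrm{d}t+\mathrm{d}B^Q_H(t)$, $u(0)=u_0$, $\dot u(0)=v_0$, let $\tau=T/N$, $t_j=j\tau$, let $(u_j,\bar u_j)$ be given by the scheme below, and $e_n=u(t_n)-u_n$. Then there is a constant $C$ independent of $\tau$ and $n$ such that for all $0\le n\le N$, $$\|e_n\|_{L^2(\Omega,\mathbb{H}^0)}\le\begin{cases}C\tau^{\frac{\kappa}{\alpha}}\big(\|u_0\|_{L^2(\Omega,\mathbb{H}^\kappa)}+\|v_0\|_{L^2(\Omega,\mathbb{H}^{\kappa-\alpha})}+1\big), & 0<\kappa\le\frac{\alpha}{2}+H\alpha,\\ C\tau^{H+\frac12}\big(\|u_0\|_{L^2(\Omega,\mathbb{H}^\kappa)}+\|v_0\|_{L^2(\Omega,\mathbb{H}^{\kappa-\alpha})}+1\big),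 & \frac{\alpha}{2}+H\alpha<\kappa<\alpha+\frac12.\end{cases}$$
   Context: $D\subseteq\mathbb{R}^d$ ($d\in\{1,2,3\}$) is a bounded Lipschitz domain; $\|\cdot\|,\langle\cdot,\cdot\rangle$ are the $L^2(D)$ norm and inner product. $A=-\Delta$ with homogeneous Dirichlet boundary conditions, orthonormal eigenpairs $(\lambda_i,\phi_i)$; $A^{\nu/2}u=\sum_i\lambda_i^{\nu/2}\langle u,\phi_i\rangle\phi_i$; $\|u\|_{L^2(\Omega,\mathbb{H}^\nu)}=(\mathrm{E}\|A^{\nu/2}u\|^2)^{1/2}$ for random fields on a probability space $\Omega$. $\mathscr{C}(t)=\cos(A^{\alpha/2}t)$, $\mathscr{S}(t)=\sin(A^{\alpha/2}t)$ spectrally. $Q\phi_i=q_i\phi_i$, $q_i\ge0$ ($Q$ self-adjoint nonnegative); $B^Q_H(t)=\sum_i\sqrt{q_i}\xi^i_H(t)\phi_i$ with independent real fractional Brownian motions $\xi^i_H$ of Hurst index $H$ (covariance $\frac12(t^{2H}+s^{2H}-|t-s|^{2H})$). Stochastic integrals $\int_s^tg(r)\,\mathrm{d}\xi_H(r)$ are limits of Riemann sums $\sum_jg(t_j)(\xi_H(t_{j+1})-\xi_H(t_j))$ (equivalently $g(t)\xi_H(t)-g(s)\xi_H(s)-\int_s^tg'(r)\xi_H(r)\mathrm{d}r$), componentwise. $f$ acts pointwise. The mild solution satisfies $u(t)=\mathscr{C}(t)u_0+A^{-\alpha/2}\mathscr{S}(t)v_0+\int_0^tA^{-\alpha/2}\mathscr{S}(t-r)f(u(r))\mathrm{d}r+\int_0^tA^{-\alpha/2}\mathscr{S}(t-r)\mathrm{d}B^Q_H(r)$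 and $\dot u(t)=-A^{\alpha/2}\mathscr{S}(t)u_0+\mathscr{C}(t)v_0+\int_0^t\mathscr{C}(t-r)f(u(r))\mathrm{d}r+\int_0^t\mathscr{C}(t-r)\mathrm{d}B^Q_H(r)$. The scheme: $u_0$ and $\bar u_0=v_0$ are the initial data, and for $j\ge0$, $u_{j+1}=\mathscr{C}(\tau)u_j+A^{-\alpha/2}\mathscr{S}(\tau)\bar u_j+\tau A^{-\alpha/2}\mathscr{S}(\tau)f(u_j)-A^{-\alpha/2}\mathscr{S}(\tau)B^Q_H(t_j)+\int_{t_j}^{t_{j+1}}\mathscr{C}(t_{j+1}-r)B^Q_H(t_j)\,\mathrm{d}r$, $\bar u_{j+1}=-A^{\alpha/2}\mathscr{S}(\tau)u_j+\mathscr{C}(\tau)\bar u_j+\tau\mathscr{C}(\tau)f(u_j)+B^Q_H(t_{j+1})-\mathscr{C}(\tau)B^Q_H(t_j)-\int_{t_j}^{t_{j+1}}A^{\alpha/2}\mathscr{S}(t_{j+1}-r)B^Q_H(t_j)\,\mathrm{d}r$. *)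

theory Defs
  imports "HOL-Analysis.Analysis" "HOL-Probability.Probability"
begin

definition coef :: "(real^'d::finite) set \<Rightarrow> (nat \<Rightarrow> real^'d \<Rightarrow> real) \<Rightarrow> (real^'d \<Rightarrow> real) \<Rightarrow> nat \<Rightarrow> real"
  where "coef D \<phi> u i = (LINT x|lebesgue_on D. u x * \<phi> i x)"

definition sq_int :: "(real^'d::finite) set \<Rightarrow> (real^'d \<Rightarrow> real) \<Rightarrow> bool"
  where "sq_int D u \<longleftrightarrow> u \<in> borel_measurable (lebesgue_on D)
            \<and> integrable (lebesgue_on D) (\<lambda>x. (u x)\<^sup>2)"

text \<open>Bounded Lipschitz domain: nonempty bounded open connected set whose boundary is,
near every boundary point and after a rigid rotation, the strict subgraph of a Lipschitz
function of the remaining d-1 coordinates.\<close>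

definition lipschitz_domain :: "(real^'d::finite) set \<Rightarrow> bool" where
  "lipschitz_domain D \<longleftrightarrow> open D \<and> connected D \<and> bounded D \<and> D \<noteq> {} \<and>
     (\<forall>p\<in>frontier D. \<exists>r>0. \<exists>R k (h::real^'d \<Rightarrow> real) L.
        orthogonal_transformation R \<and>
        (\<forall>x y. (\<forall>j. j \<noteq> k \<longrightarrow> x$j = y$j) \<longrightarrow> h x = h y) \<and>
        (\<forall>x y. \<bar>h x - h y\<bar> \<le> L * norm (x - y)) \<and>
        D \<inter> ball p r = {x \<in> ball p r. (R x) $ k < h (R x)})"

definition dirichlet_eigenfunction :: "(real^'d::finite) set \<Rightarrow> real \<Rightarrow> (real^'d \<Rightarrow> real) \<Rightarrow> bool" where
  "dirichlet_eigenfunction D lam \<phi> \<longleftrightarrow>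
     (\<exists>g Dg. (\<forall>x\<in>D. (\<phi> has_derivative (\<lambda>h. g x \<bullet> h)) (at x)) \<and>
             (\<forall>x\<in>D. (g has_derivative Dg x) (at x)) \<and>
             continuous_on D g \<and>
             (\<forall>k. continuous_on D (\<lambda>x. Dg x (axis k 1))) \<and>
             (\<forall>x\<in>D. - (\<Sum>k\<in>UNIV. (Dg x (axis k 1)) $ k) = lam * \<phi> x)) \<and>
     continuous_on (closure D) \<phi> \<and> (\<forall>x\<in>frontier D. \<phi> x = 0)"

definition dirichlet_eigenbasis :: "(real^'d::finite) set \<Rightarrow> (nat \<Rightarrow> real) \<Rightarrow> (nat \<Rightarrow> real^'d \<Rightarrow> real) \<Rightarrow> bool" where
  "dirichlet_eigenbasis D lam \<phi> \<longleftrightarrow>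
     (\<forall>i. dirichlet_eigenfunction D (lam i) (\<phi> i) \<and> sq_int D (\<phi> i)) \<and>
     (\<forall>i j. coef D \<phi> (\<phi> j) i = (if i = j then 1 else 0)) \<and>
     (\<forall>u. sq_int D u \<longrightarrow> (\<forall>i. coef D \<phi> u i = 0) \<longrightarrow> (AE x in lebesgue_on D. u x = 0))"

text \<open>Squared L^2(Omega, H^nu) norm of a random (generalised) field given by its spectral
coefficients c omega i = <u(omega), phi_i>:  E sum_i lam_i^nu c_i^2  = E ||A^{nu/2} u||^2.\<close>

definition hnorm2 :: "'w measure \<Rightarrow> (nat \<Rightarrow> real) \<Rightarrow> real \<Rightarrow> ('w \<Rightarrow> nat \<Rightarrow> real) \<Rightarrow> ennreal" where
  "hnorm2 M lam \<nu> c = (\<integral>\<^sup>+ \<omega>. (\<Sum>i. ennreal (lam i powr \<nu> * (c \<omega> i)\<^sup>2)) \<partial>M)"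

definition fbm_cov :: "real \<Rightarrow> real \<Rightarrow> real \<Rightarrow> real" where
  "fbm_cov H t s = (t powr (2*H) + s powr (2*H) - \<bar>t - s\<bar> powr (2*H)) / 2"

text \<open>Real fractional Brownian motion on [0,inf) with continuous paths: a centred Gaussian
process with covariance fbm_cov H (every finite linear combination is centred Gaussian with
the corresponding variance, expressed by its characteristic function).\<close>

definition fbm :: "'w measure \<Rightarrow> real \<Rightarrow> ('w \<Rightarrow> real \<Rightarrow> real) \<Rightarrow> bool" where
  "fbm M H X \<longleftrightarrow>
     (\<forall>t. (\<lambda>\<omega>. X \<omega> t) \<in> borel_measurable M) \<and>
     (\<forall>\<omega>\<in>space M. continuous_on {0..} (X \<omega>)) \<and>
     (\<forall>(n::nat) (ts::nat \<Rightarrow> real) (cs::nat \<Rightarrow> real). (\<forall>k<n. 0 \<le> ts k) \<longrightarrow>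
        (\<forall>\<theta>. char (distr M borel (\<lambda>\<omega>. \<Sum>k<n. cs k * X \<omega> (ts k))) \<theta> =
              complex_of_real (exp (- (\<theta>\<^sup>2 * (\<Sum>k<n. \<Sum>l<n. cs k * cs l * fbm_cov H (ts k) (ts l))) / 2))))"

text \<open>Pathwise stochastic integral of a smooth deterministic integrand g against a continuous
path xi, defined by integration by parts (limit of Riemann sums).\<close>

definition stoch_int :: "(real \<Rightarrow> real) \<Rightarrow> real \<Rightarrow> real \<Rightarrow> (real \<Rightarrow> real) \<Rightarrow> real" where
  "stoch_int g s t xi = g t * xi t - g s * xi s - integral {s..t} (\<lambda>r. deriv g r * xi r)"

end

theory Submission
  imports Defs
begin

text \<open>With \<open>w = lam powr (\<alpha>/2)\<close> and \<open>p = min (\<kappa>/\<alpha>) (H + 1/2)\<close>, each spectral mode of the error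
  is the sum of a noise part and of the quadrature error of the nonlinear convolution. In a mode the
  noise part is \<open>sqrt q\<close> times \<open>\<Sum>\<^sub>j \<integral> cos (w (t\<^sub>n - r)) (\<xi>(r) - \<xi>(t\<^sub>j)) dr\<close>, integrated over the grid cells. As
  \<open>H < 1/2\<close>, disjoint increments of \<open>\<xi>\<close> are negatively correlated and
  \<open>E (\<Sum>\<^sub>j c\<^sub>j (\<xi>(t\<^sub>j + \<theta>) - \<xi>(t\<^sub>j)))\<^sup>2 \<le> 2 n \<theta> powr (2 H)\<close> whenever \<open>0 \<le> \<theta> \<le> \<tau>\<close> and all \<open>|c\<^sub>j| \<le> 1\<close>. This single inequality yields the
  noise error bound \<open>C \<tau> powr (1 + 2 H)\<close>; on a grid of mesh \<open>1/w\<close> it yields the size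
  \<open>C w powr (- 1 - 2 H)\<close> of the stochastic convolution itself, and from there its Hoelder continuity. In
  mean square, both the noise error and the increments of the stochastic convolution over time \<open>\<tau>\<close> are at
  most \<open>C w powr (- 1 - 2 H) (w \<tau>) powr (2 p)\<close>, which is summable against \<open>q\<close> by the assumption on \<open>Q\<close>. Since \<open>p < 1\<close>, Hoelder continuity of \<open>u\<close> of order \<open>p\<close> suffices for the
  nonlinear term. That part is done for a fixed sample point, in squared norms, which reduces the theorem
  to two Gronwall arguments; expectations are only taken of measurable majorants, since \<open>u\<close> is not assumed
  measurable in the sample point.\<close>

section \<open>Parseval's identity for an orthonormal basis\<close>

text \<open>The half order beyond the path regularity \<open>H\<close> comes from cancellation
  between cells. One cell contributes about \<open>\<tau> powr (1 + H)\<close> in root mean square;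
  adding \<open>T / \<tau>\<close> cells by the triangle inequality would leave
  \<open>\<tau> powr H\<close>, whereas sums with summable correlations grow like the square root of
  their length and give \<open>\<tau> powr (H + 1/2)\<close>. The other bound,
  \<open>p \<le> \<kappa>/\<alpha>\<close>, comes from noise and data: as
  \<open>2 \<kappa>/\<alpha> = 1 + 2 H + 4 \<rho>/\<alpha>\<close>, it makes
  \<open>w powr (2 p - 1 - 2 H)\<close> at most a constant times \<open>lam powr (2 \<rho>)\<close>,
  and \<open>w powr (2 p)\<close> at most a constant times \<open>lam powr \<kappa>\<close>. These
  comparisons need frequencies bounded away from 0, hence the lower bound for Dirichlet eigenvalues.
  The equation is diagonal in spectral coordinates but \<open>f\<close> acts pointwise; Parseval's
  identity carries its Lipschitz bound across. The kernel \<open>sin (w x) / w\<close> is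
  1-Lipschitz whatever \<open>w\<close> is, so the nonlinear estimates can be summed over all
  modes.\<close>

definition sq_integrable :: "'a measure \<Rightarrow> ('a \<Rightarrow> real) \<Rightarrow> bool" where
  "sq_integrable M u \<longleftrightarrow> u \<in> borel_measurable M \<and> integrable M (\<lambda>x. (u x)\<^sup>2)"

lemma sq_integrable_measurable[measurable_dest]: "sq_integrable M u \<Longrightarrow> u \<in> borel_measurable M"
  by (simp add: sq_integrable_def)

lemma sq_integrable_mult:
  assumes "sq_integrable M u" "sq_integrable M v"
  shows "integrable M (\<lambda>x. u x * v x)"
proof (rule Bochner_Integration.integrable_bound)
  show "integrable M (\<lambda>x. (u x)\<^sup>2 + (v x)\<^sup>2)"
    using assms by (auto simp: sq_integrable_def)
  show "(\<lambda>x. u x * v x) \<in> borel_measurable M"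
    using assms by (auto simp: sq_integrable_def)
  have "\<bar>a * b\<bar> \<le> a\<^sup>2 + b\<^sup>2" for a b :: real
  proof -
    have "2 * \<bar>a\<bar> * \<bar>b\<bar> \<le> a\<^sup>2 + b\<^sup>2" using sum_squares_bound[of "\<bar>a\<bar>" "\<bar>b\<bar>"] by simp
    moreover have "0 \<le> \<bar>a\<bar> * \<bar>b\<bar>" by simp
    ultimately show ?thesis by (simp only: abs_mult)
  qed
  then show "AE x in M. norm (u x * v x) \<le> norm ((u x)\<^sup>2 + (v x)\<^sup>2)"
    by simp
qed

lemma sq_integrable_scale: "sq_integrable M u \<Longrightarrow> sq_integrable M (\<lambda>x. c * u x)"
  by (auto simp: sq_integrable_def power_mult_distrib)

lemma sq_integrable_add:
  assumes "sq_integrable M u" "sq_integrable M v"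
  shows "sq_integrable M (\<lambda>x. u x + v x)"
  using sq_integrable_mult[OF assms] assms
  by (auto simp: sq_integrable_def power2_sum mult.assoc)

lemma sq_integrable_diff:
  assumes "sq_integrable M u" "sq_integrable M v"
  shows "sq_integrable M (\<lambda>x. u x - v x)"
  using sq_integrable_add[OF assms(1) sq_integrable_scale[OF assms(2), of "-1"]] by simp

lemma sq_integrable_sum:
  assumes "\<And>i. i \<in> A \<Longrightarrow> sq_integrable M (u i)"
  shows "sq_integrable M (\<lambda>x. \<Sum>i\<in>A. u i x)"
  using assms
proof (induction A rule: infinite_finite_induct)
  case (insert x F)
  then show ?case by (auto intro!: sq_integrable_add)
qed (auto simp: sq_integrable_def)

lemma sq_integrable_Cauchy_Schwarz:
  assumes "sq_integrable M u" "sq_integrable M v"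
  shows "(LINT x|M. \<bar>u x * v x\<bar>)\<^sup>2 \<le> (LINT x|M. (u x)\<^sup>2) * (LINT x|M. (v x)\<^sup>2)"
proof -
  have [measurable]: "u \<in> borel_measurable M" "v \<in> borel_measurable M"
    using assms by (auto simp: sq_integrable_def)
  have "(\<integral>\<^sup>+x. ennreal \<bar>u x\<bar> * ennreal \<bar>v x\<bar> \<partial>M)\<^sup>2
      \<le> (\<integral>\<^sup>+x. ennreal \<bar>u x\<bar> ^ 2 \<partial>M) * (\<integral>\<^sup>+x. ennreal \<bar>v x\<bar> ^ 2 \<partial>M)"
    by (rule Cauchy_Schwarz_nn_integral) auto
  moreover have "(\<integral>\<^sup>+x. ennreal \<bar>u x\<bar> * ennreal \<bar>v x\<bar> \<partial>M) = ennreal (LINT x|M. \<bar>u x * v x\<bar>)"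
    using integrable_abs[OF sq_integrable_mult[OF assms]]
    by (subst nn_integral_eq_integral[symmetric]) (auto simp: abs_mult ennreal_mult)
  moreover have "(\<integral>\<^sup>+x. ennreal \<bar>u x\<bar> ^ 2 \<partial>M) = ennreal (LINT x|M. (u x)\<^sup>2)"
    using assms(1) by (subst nn_integral_eq_integral[symmetric]) (auto simp: sq_integrable_def ennreal_power)
  moreover have "(\<integral>\<^sup>+x. ennreal \<bar>v x\<bar> ^ 2 \<partial>M) = ennreal (LINT x|M. (v x)\<^sup>2)"
    using assms(2) by (subst nn_integral_eq_integral[symmetric]) (auto simp: sq_integrable_def ennreal_power)
  ultimately show ?thesis
    by (simp add: ennreal_power ennreal_mult[symmetric])
qed

text \<open>The coefficients are left free: \<open>u = 0\<close> gives the norm of a block of an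
  orthonormal series, and the Fourier coefficients of \<open>u\<close> give Bessel's
  identity.\<close>

lemma Bessel_partial_sum:
  fixes e :: "nat \<Rightarrow> 'a \<Rightarrow> real"
  assumes e: "\<And>i. sq_integrable M (e i)"
    and orth: "\<And>i j. (LINT x|M. e j x * e i x) = (if i = j then 1 else 0)"
    and u: "sq_integrable M u"
    and A: "finite A"
  shows "(LINT x|M. (u x - (\<Sum>i\<in>A. c i * e i x))\<^sup>2)
        = (LINT x|M. (u x)\<^sup>2) - 2 * (\<Sum>i\<in>A. c i * (LINT x|M. u x * e i x)) + (\<Sum>i\<in>A. (c i)\<^sup>2)"
proof -
  let ?S = "\<lambda>x. \<Sum>i\<in>A. c i * e i x"
  have S: "sq_integrable M ?S" by (intro sq_integrable_sum sq_integrable_scale e)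
  have "(LINT x|M. (u x - ?S x)\<^sup>2) = (LINT x|M. (u x)\<^sup>2 - 2 * (u x * ?S x) + ?S x * ?S x)"
    by (intro Bochner_Integration.integral_cong) (auto simp: power2_eq_square algebra_simps)
  also have "\<dots> = (LINT x|M. (u x)\<^sup>2) - 2 * (LINT x|M. u x * ?S x) + (LINT x|M. ?S x * ?S x)"
    using sq_integrable_mult[OF u S] sq_integrable_mult[OF S S] u
    by (subst Bochner_Integration.integral_add Bochner_Integration.integral_diff;
        auto simp: sq_integrable_def)+
  also have "(LINT x|M. u x * ?S x) = (\<Sum>i\<in>A. c i * (LINT x|M. u x * e i x))"
    using sq_integrable_mult[OF u e] A
    by (simp add: sum_distrib_left mult.left_commute)
  also have "(LINT x|M. ?S x * ?S x) = (\<Sum>i\<in>A. c i * (LINT x|M. ?S x * e i x))"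
    using sq_integrable_mult[OF S e] A
    by (simp add: sum_distrib_left[of "?S _"] mult.left_commute[of "?S _"])
  also have "\<dots> = (\<Sum>i\<in>A. (c i)\<^sup>2)"
  proof (rule sum.cong[OF refl])
    fix i assume i: "i \<in> A"
    have "(LINT x|M. ?S x * e i x) = (\<Sum>j\<in>A. c j * (LINT x|M. e j x * e i x))"
      using sq_integrable_mult[OF e e] A by (simp add: sum_distrib_right mult.assoc)
    also have "\<dots> = c i"
      unfolding orth using i A by (simp add: if_distrib cong: if_cong)
    finally show "c i * (LINT x|M. ?S x * e i x) = (c i)\<^sup>2" by (simp add: power2_eq_square)
  qed
  finally show ?thesis .
qed

text \<open>Riesz-Fischer along a subsequence. Tails below \<open>(1/4)^k\<close> make the L1 norms
  of consecutive differences geometric, so the partial sums converge almost everywhere; Fatou's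
  lemma then shows that the pointwise limit is also the limit in mean square.\<close>

lemma limit_of_orthonormal_series:
  fixes e :: "nat \<Rightarrow> 'a \<Rightarrow> real"
  assumes fin: "finite_measure M"
    and e: "\<And>i. sq_integrable M (e i)"
    and orth: "\<And>i j. (LINT x|M. e j x * e i x) = (if i = j then 1 else 0)"
    and summ: "summable (\<lambda>i. (c i)\<^sup>2)"
  obtains v \<sigma> where "sq_integrable M v" "strict_mono (\<sigma> :: nat \<Rightarrow> nat)"
    "(\<lambda>k. LINT x|M. (v x - (\<Sum>i<\<sigma> k. c i * e i x))\<^sup>2) \<longlonglongrightarrow> 0"
proof -
  interpret finite_measure M by fact
  have em[measurable]: "e i \<in> borel_measurable M" for i using e by (simp add: sq_integrable_def)
  define r where "r m = (\<Sum>i. (c (i + m))\<^sup>2)" for m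
  have r0: "r \<longlonglongrightarrow> 0"
    unfolding r_def using suminf_exist_split2[OF summ] .
  have r_ge: "sum (\<lambda>i. (c i)\<^sup>2) {m..<n} \<le> r m" for m n
  proof -
    have "sum (\<lambda>i. (c i)\<^sup>2) {m..<n} = (\<Sum>i<n-m. (c (i + m))\<^sup>2)"
      by (rule sum.reindex_bij_witness[of _ "\<lambda>i. i + m" "\<lambda>i. i - m"]) auto
    also have "\<dots> \<le> r m" unfolding r_def
      by (rule sum_le_suminf) (auto intro: summ summable_ignore_initial_segment)
    finally show ?thesis .
  qed
  define S where "S m x = (\<Sum>i<m. c i * e i x)" for m x
  have S2: "sq_integrable M (S m)" for m
    unfolding S_def by (intro sq_integrable_sum sq_integrable_scale e)
  have Sm[measurable]: "S m \<in> borel_measurable M" for m using S2 by (simp add: sq_integrable_def)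
  have Sd: "(LINT x|M. (S n x - S m x)\<^sup>2) \<le> r m" if "m \<le> n" for m n
  proof -
    have "S n x - S m x = - (0 - (\<Sum>i\<in>{m..<n}. c i * e i x))" for x
      unfolding S_def using that
      by (simp add: sum_diff_nat_ivl[of 0 m n, symmetric] lessThan_atLeast0)
    then have "(S n x - S m x)\<^sup>2 = (0 - (\<Sum>i\<in>{m..<n}. c i * e i x))\<^sup>2" for x
      by (metis power2_minus)
    then have "(LINT x|M. (S n x - S m x)\<^sup>2) = (\<Sum>i\<in>{m..<n}. (c i)\<^sup>2)"
      using Bessel_partial_sum[OF e orth, of "\<lambda>_. 0" "{m..<n}" c] by (simp add: sq_integrable_def)
    then show ?thesis using r_ge by simp
  qed
  have "\<exists>n>N. r n \<le> (1/4)^k" for k N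
  proof -
    have "eventually (\<lambda>n. r n < (1/4)^k) sequentially"
      using r0 by (rule order_tendstoD) simp
    then obtain n0 where "\<And>n. n \<ge> n0 \<Longrightarrow> r n < (1/4)^k"
      by (auto simp: eventually_sequentially)
    then show ?thesis by (intro exI[of _ "max n0 (Suc N)"]) (auto simp: less_imp_le)
  qed
  note step = this
  have "\<exists>\<sigma>::nat\<Rightarrow>nat. \<forall>k. r (\<sigma> k) \<le> (1/4)^k \<and> \<sigma> k < \<sigma> (Suc k)"
    by (intro dependent_nat_choice) (use step in blast)+
  then obtain \<sigma> :: "nat \<Rightarrow> nat" where \<sigma>: "\<And>k. r (\<sigma> k) \<le> (1/4)^k" "\<And>k. \<sigma> k < \<sigma> (Suc k)"
    by blast
  have mono: "strict_mono \<sigma>" using \<sigma>(2) by (simp add: strict_mono_Suc_iff)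
  define d where "d k x = S (\<sigma> (Suc k)) x - S (\<sigma> k) x" for k x
  have d2: "sq_integrable M (d k)" for k unfolding d_def by (intro sq_integrable_diff S2)
  have [measurable]: "d k \<in> borel_measurable M" for k using d2 by (simp add: sq_integrable_def)
  let ?V = "measure M (space M)"
  \<comment> \<open>Cauchy-Schwarz against the constant 1 on a finite measure space turns the bound
    \<open>(1/4)^k\<close> for squares into \<open>(1/2)^k\<close> in L1.\<close>
  have d1: "(LINT x|M. \<bar>d k x\<bar>) \<le> sqrt ?V * (1/2)^k" for k
  proof -
    have "(LINT x|M. \<bar>d k x * 1\<bar>)\<^sup>2 \<le> (LINT x|M. (d k x)\<^sup>2) * (LINT x|M. 1\<^sup>2)"
      by (rule sq_integrable_Cauchy_Schwarz[OF d2]) (simp add: sq_integrable_def)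
    also have "\<dots> \<le> (1/4)^k * ?V"
      using order_trans[OF Sd[of "\<sigma> k" "\<sigma> (Suc k)"] \<sigma>(1)] \<sigma>(2)
      by (simp add: d_def mult_right_mono less_imp_le)
    also have "(1/4::real)^k = ((1/2)^k)\<^sup>2"
    proof -
      have "(1/4::real) = (1/2)\<^sup>2" by (simp add: power2_eq_square)
      then show ?thesis by (metis power_mult mult.commute)
    qed
    also have "((1/2)^k)\<^sup>2 * ?V = (sqrt ?V * (1/2)^k)\<^sup>2"
      by (simp add: power_mult_distrib)
    finally show ?thesis by (simp add: power2_le_iff_abs_le)
  qed
  have dint: "integrable M (d k)" for k
    using d2 by (auto simp: sq_integrable_def intro: square_integrable_imp_integrable)
  have "(\<integral>\<^sup>+x. (\<Sum>k. ennreal \<bar>d k x\<bar>) \<partial>M) = (\<Sum>k. ennreal (LINT x|M. \<bar>d k x\<bar>))"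
    by (simp add: nn_integral_suminf nn_integral_eq_integral dint)
  also have "\<dots> \<le> (\<Sum>k. ennreal (sqrt ?V * (1/2)^k))"
    by (intro suminf_le) (auto intro!: ennreal_leI d1)
  also have "\<dots> < \<infinity>"
  proof -
    have "summable (\<lambda>k. sqrt ?V * (1/2::real)^k)" by (intro summable_mult summable_geometric) simp
    then have "(\<Sum>k. ennreal (sqrt ?V * (1/2)^k)) \<noteq> top"
      by (rule ennreal_suminf_neq_top) simp
    then show ?thesis by (simp only: infinity_ennreal_def top.not_eq_extremum)
  qed
  finally have "AE x in M. (\<Sum>k. ennreal \<bar>d k x\<bar>) \<noteq> \<infinity>"
    by (intro nn_integral_PInf_AE) auto
  then have conv: "AE x in M. convergent (\<lambda>k. S (\<sigma> k) x)"
  proof eventually_elim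
    case (elim x)
    then have "summable (\<lambda>k. \<bar>d k x\<bar>)"
      by (intro summable_suminf_not_top) auto
    then have "summable (\<lambda>k. d k x)" by (rule summable_rabs_cancel)
    then have "convergent (\<lambda>n. \<Sum>k<n. d k x)" by (simp add: summable_iff_convergent)
    moreover have "(\<Sum>k<n. d k x) = S (\<sigma> n) x - S (\<sigma> 0) x" for n
      unfolding d_def by (rule sum_lessThan_telescope)
    ultimately show "convergent (\<lambda>k. S (\<sigma> k) x)"
      by (simp add: convergent_diff_const_right_iff)
  qed
  define v where "v x = lim (\<lambda>k. S (\<sigma> k) x)" for x
  have [measurable]: "v \<in> borel_measurable M" unfolding v_def by measurable
  have lim: "AE x in M. (\<lambda>k. S (\<sigma> k) x) \<longlonglongrightarrow> v x"
    using conv by eventually_elim (simp add: v_def convergent_LIMSEQ_iff)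
  \<comment> \<open>Fatou's lemma in the index \<open>l\<close> of the further partial sum, with
    \<open>k\<close> fixed.\<close>
  have bound: "(\<integral>\<^sup>+x. ennreal ((v x - S (\<sigma> k) x)\<^sup>2) \<partial>M) \<le> ennreal (r (\<sigma> k))" for k
  proof -
    have "(\<integral>\<^sup>+x. ennreal ((v x - S (\<sigma> k) x)\<^sup>2) \<partial>M)
        = (\<integral>\<^sup>+x. liminf (\<lambda>l. ennreal ((S (\<sigma> l) x - S (\<sigma> k) x)\<^sup>2)) \<partial>M)"
    proof (rule nn_integral_cong_AE, use lim in eventually_elim)
      case (elim x)
      then have "(\<lambda>l. ennreal ((S (\<sigma> l) x - S (\<sigma> k) x)\<^sup>2)) \<longlonglongrightarrow> ennreal ((v x - S (\<sigma> k) x)\<^sup>2)"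
        by (intro tendsto_intros)
      then show ?case by (intro lim_imp_Liminf[symmetric]) auto
    qed
    also have "\<dots> \<le> liminf (\<lambda>l. \<integral>\<^sup>+x. ennreal ((S (\<sigma> l) x - S (\<sigma> k) x)\<^sup>2) \<partial>M)"
      by (rule nn_integral_liminf) simp
    also have "\<dots> \<le> ennreal (r (\<sigma> k))"
    proof -
      have "\<forall>\<^sub>F l in sequentially. (\<integral>\<^sup>+x. ennreal ((S (\<sigma> l) x - S (\<sigma> k) x)\<^sup>2) \<partial>M) \<le> ennreal (r (\<sigma> k))"
        using eventually_ge_at_top[of k]
      proof eventually_elim
        case (elim l)
        then have "\<sigma> k \<le> \<sigma> l" using mono by (simp add: strict_mono_less_eq)
        then show ?case
          using Sd[of "\<sigma> k" "\<sigma> l"] sq_integrable_diff[OF S2 S2, of "\<sigma> l" "\<sigma> k"]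
          by (subst nn_integral_eq_integral) (auto simp: sq_integrable_def ennreal_leI)
      qed
      then have "liminf (\<lambda>l. \<integral>\<^sup>+x. ennreal ((S (\<sigma> l) x - S (\<sigma> k) x)\<^sup>2) \<partial>M)
        \<le> liminf (\<lambda>l::nat. ennreal (r (\<sigma> k)))"
        by (rule Liminf_mono)
      then show ?thesis by (simp add: Liminf_const)
    qed
    finally show ?thesis .
  qed
  have vS: "sq_integrable M (\<lambda>x. v x - S (\<sigma> k) x)" for k
    unfolding sq_integrable_def
  proof
    show "integrable M (\<lambda>x. (v x - S (\<sigma> k) x)\<^sup>2)"
      using le_less_trans[OF bound[of k] ennreal_less_top]
      by (intro integrableI_bounded) auto
  qed simp
  have v2: "sq_integrable M v"
    using sq_integrable_add[OF vS[of 0] S2[of "\<sigma> 0"]] by simp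
  have r_nn: "0 \<le> r m" for m using r_ge[of m m] by simp
  have le: "(LINT x|M. (v x - S (\<sigma> k) x)\<^sup>2) \<le> r (\<sigma> k)" for k
  proof -
    have "ennreal (LINT x|M. (v x - S (\<sigma> k) x)\<^sup>2) \<le> ennreal (r (\<sigma> k))"
      using bound[of k] vS[of k] by (subst nn_integral_eq_integral[symmetric]) (auto simp: sq_integrable_def)
    then show ?thesis using r_nn by simp
  qed
  have "(\<lambda>k. LINT x|M. (v x - S (\<sigma> k) x)\<^sup>2) \<longlonglongrightarrow> 0"
  proof (rule tendsto_sandwich[OF _ _ tendsto_const LIMSEQ_subseq_LIMSEQ[OF r0 mono]])
    show "\<forall>\<^sub>F k in sequentially. 0 \<le> (LINT x|M. (v x - S (\<sigma> k) x)\<^sup>2)"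
      by simp
    show "\<forall>\<^sub>F k in sequentially. (LINT x|M. (v x - S (\<sigma> k) x)\<^sup>2) \<le> (r \<circ> \<sigma>) k"
      using le by simp
  qed
  from that[OF v2 mono this[unfolded S_def]] show thesis .
qed

text \<open>The limit \<open>v\<close> of the Fourier series has the same coefficients as
  \<open>u\<close>, so completeness gives \<open>u = v\<close> almost everywhere, and Bessel's
  identity for partial sums passes to the limit along \<open>\<sigma>\<close>.\<close>

theorem Parseval_orthonormal_basis:
  fixes e :: "nat \<Rightarrow> 'a \<Rightarrow> real"
  assumes fin: "finite_measure M"
    and e: "\<And>i. sq_integrable M (e i)"
    and orth: "\<And>i j. (LINT x|M. e j x * e i x) = (if i = j then 1 else 0)"
    and complete: "\<And>u. sq_integrable M u \<Longrightarrow> (\<And>i. (LINT x|M. u x * e i x) = 0) \<Longrightarrow> AE x in M. u x = 0"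
    and u: "sq_integrable M u"
  shows "(\<lambda>i. (LINT x|M. u x * e i x)\<^sup>2) sums (LINT x|M. (u x)\<^sup>2)"
proof -
  define c where "c i = (LINT x|M. u x * e i x)" for i
  have B: "(LINT x|M. (u x - (\<Sum>i<m. c i * e i x))\<^sup>2) = (LINT x|M. (u x)\<^sup>2) - (\<Sum>i<m. (c i)\<^sup>2)" for m
    using Bessel_partial_sum[OF e orth u, of "{..<m}" c]
    by (simp add: c_def[symmetric] flip: power2_eq_square)
  have "(\<Sum>i<m. (c i)\<^sup>2) \<le> (LINT x|M. (u x)\<^sup>2)" for m
  proof -
    have "0 \<le> (LINT x|M. (u x - (\<Sum>i<m. c i * e i x))\<^sup>2)" by simp
    then show ?thesis using B[of m] by simp
  qed
  then have summ: "summable (\<lambda>i. (c i)\<^sup>2)"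
    by (intro summableI_nonneg_bounded[where x="LINT x|M. (u x)\<^sup>2"]) auto
  obtain v \<sigma> where v: "sq_integrable M v" and \<sigma>: "strict_mono (\<sigma> :: nat \<Rightarrow> nat)"
    and lim: "(\<lambda>k. LINT x|M. (v x - (\<Sum>i<\<sigma> k. c i * e i x))\<^sup>2) \<longlonglongrightarrow> 0"
    using limit_of_orthonormal_series[OF fin e orth summ] by blast
  have cv: "(LINT x|M. v x * e i x) = c i" for i
  proof -
    let ?D = "\<lambda>k x. v x - (\<Sum>j<\<sigma> k. c j * e j x)"
    have D2: "sq_integrable M (?D k)" for k
      by (intro sq_integrable_diff v sq_integrable_sum sq_integrable_scale e)
    have "\<forall>\<^sub>F k in sequentially. ((LINT x|M. v x * e i x) - c i)\<^sup>2 \<le> (LINT x|M. (?D k x)\<^sup>2)"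
      using eventually_gt_at_top[of i]
    proof eventually_elim
      case (elim k)
      then have "i < \<sigma> k" using seq_suble[OF \<sigma>, of k] by simp
      then have "(LINT x|M. (\<Sum>j<\<sigma> k. c j * e j x) * e i x) = c i"
        using sq_integrable_mult[OF e e]
        by (simp add: sum_distrib_right mult.assoc orth if_distrib cong: if_cong)
      then have "(LINT x|M. v x * e i x) - c i = (LINT x|M. ?D k x * e i x)"
        using sq_integrable_mult[OF v e, of i]
          sq_integrable_mult[OF sq_integrable_sum[where A="{..<\<sigma> k}" and u="\<lambda>j x. c j * e j x"] e, of i]
        by (simp add: left_diff_distrib sq_integrable_scale e)
      then have "((LINT x|M. v x * e i x) - c i)\<^sup>2 \<le> (LINT x|M. \<bar>?D k x * e i x\<bar>)\<^sup>2"
        by (simp add: abs_le_square_iff[symmetric] integral_abs_bound)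
      also have "\<dots> \<le> (LINT x|M. (?D k x)\<^sup>2) * (LINT x|M. (e i x)\<^sup>2)"
        by (rule sq_integrable_Cauchy_Schwarz[OF D2 e])
      also have "(LINT x|M. (e i x)\<^sup>2) = 1" using orth[of i i] by (simp add: power2_eq_square)
      finally show ?case by simp
    qed
    then have "((LINT x|M. v x * e i x) - c i)\<^sup>2 \<le> 0"
      by (intro tendsto_lowerbound[OF lim]) auto
    then show ?thesis by simp
  qed
  have "AE x in M. u x - v x = 0"
  proof (rule complete[OF sq_integrable_diff[OF u v]])
    fix i show "(LINT x|M. (u x - v x) * e i x) = 0"
      using sq_integrable_mult[OF v e, of i] sq_integrable_mult[OF u e, of i]
      by (simp add: left_diff_distrib cv c_def)
  qed
  then have "(LINT x|M. (v x - (\<Sum>i<m. c i * e i x))\<^sup>2) = (LINT x|M. (u x - (\<Sum>i<m. c i * e i x))\<^sup>2)" for m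
    using sq_integrable_measurable[OF u] sq_integrable_measurable[OF v] sq_integrable_measurable[OF e]
    by (intro integral_cong_AE) auto
  then have "(\<lambda>k. (LINT x|M. (u x)\<^sup>2) - (\<Sum>i<\<sigma> k. (c i)\<^sup>2)) \<longlonglongrightarrow> 0"
    using lim B by simp
  then have "(\<lambda>k. (\<Sum>i<\<sigma> k. (c i)\<^sup>2)) \<longlonglongrightarrow> (LINT x|M. (u x)\<^sup>2)"
    using tendsto_diff[OF tendsto_const[of "LINT x|M. (u x)\<^sup>2"]] by fastforce
  moreover have "(\<lambda>k. (\<Sum>i<\<sigma> k. (c i)\<^sup>2)) \<longlonglongrightarrow> (\<Sum>i. (c i)\<^sup>2)"
    using LIMSEQ_subseq_LIMSEQ[OF summable_LIMSEQ[OF summ] \<sigma>] by (simp add: comp_def)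
  ultimately have "(\<Sum>i. (c i)\<^sup>2) = (LINT x|M. (u x)\<^sup>2)"
    by (rule LIMSEQ_unique[rotated])
  then show ?thesis using summ by (simp add: c_def[symmetric] sums_iff)
qed

section \<open>A lower bound for Dirichlet eigenvalues\<close>

text \<open>If \<open>l\<close> were positive, then \<open>F'\<close>, which vanishes at the
  maximum, would be positive just to the right of 0, and the mean value theorem would produce a
  value above \<open>F 0\<close>.\<close>

lemma second_derivative_nonpos_at_max:
  fixes F F' :: "real \<Rightarrow> real"
  assumes d: "0 < d" and F: "\<And>t. \<bar>t\<bar> < d \<Longrightarrow> (F has_real_derivative F' t) (at t)"
    and F': "(F' has_real_derivative l) (at 0)"
    and max: "\<And>t. \<bar>t\<bar> < d \<Longrightarrow> F t \<le> F 0"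
  shows "l \<le> 0"
proof (rule ccontr)
  assume "\<not> l \<le> 0"
  then have "0 < l" by simp
  have F0: "F' 0 = 0"
    using DERIV_local_max[OF F[of 0] d] max d by auto
  obtain e where e: "0 < e" "\<And>h. 0 < h \<Longrightarrow> h < e \<Longrightarrow> F' 0 < F' (0 + h)"
    using DERIV_pos_inc_right[OF F' \<open>0 < l\<close>] by blast
  define h where "h = min d e / 2"
  have h: "0 < h" "h < d" "h < e" using d e by (auto simp: h_def min_def)
  obtain z where z: "0 < z" "z < h" "F h - F 0 = (h - 0) * F' z"
    using MVT2[of 0 h F F'] F h by auto
  have "0 < F' z" using e(2)[of z] z h F0 by simp
  then have "0 < F h - F 0" using z h by simp
  then show False using max[of h] h by simp
qed

text \<open>At a maximum point of \<open>\<phi> / (K - |x|\<^sup>2)\<close>, with value \<open>m\<close>, the function \<open>\<phi> - m (K - |x|\<^sup>2)\<close>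
  has a maximum too, hence a nonpositive Laplacian.\<close>

lemma dirichlet_eigenvalue_lower_bound_pos:
  fixes D :: "(real^'d::finite) set"
  assumes D: "open D" "bounded D" and eig: "dirichlet_eigenfunction D l \<phi>"
    and K: "\<And>x. x \<in> closure D \<Longrightarrow> x \<bullet> x < K"
    and x1: "x1 \<in> D" "0 < \<phi> x1"
  shows "2 * CARD('d) / K \<le> l"
proof -
  obtain g Dg where g: "\<And>x. x \<in> D \<Longrightarrow> (\<phi> has_derivative (\<lambda>h. g x \<bullet> h)) (at x)"
    and Dg: "\<And>x. x \<in> D \<Longrightarrow> (g has_derivative Dg x) (at x)"
    and eqn: "\<And>x. x \<in> D \<Longrightarrow> - (\<Sum>k\<in>UNIV. (Dg x (axis k 1)) $ k) = l * \<phi> x"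
    and cont: "continuous_on (closure D) \<phi>" and bd: "\<And>x. x \<in> frontier D \<Longrightarrow> \<phi> x = 0"
    using eig unfolding dirichlet_eigenfunction_def by blast
  \<comment> \<open>A comparison function: positive on the closure of \<open>D\<close>, with
    constant Laplacian \<open>- 2 * CARD('d)\<close>.\<close>
  define \<psi> where "\<psi> x = K - x \<bullet> x" for x :: "real^'d"
  have \<psi>: "0 < \<psi> x" if "x \<in> closure D" for x using K[OF that] by (simp add: \<psi>_def)
  have x1c: "x1 \<in> closure D" using x1 closure_subset by blast
  have "compact (closure D)" using D by simp
  moreover have "continuous_on (closure D) (\<lambda>x. \<phi> x / \<psi> x)"
    using cont \<psi> by (intro continuous_intros) (auto simp: \<psi>_def intro!: continuous_intros)
  ultimately have "\<exists>x\<in>closure D. \<forall>y\<in>closure D. \<phi> y / \<psi> y \<le> \<phi> x / \<psi> x"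
    using x1c by (intro continuous_attains_sup) auto
  then obtain x0 where x0c: "x0 \<in> closure D"
    and x0: "\<And>y. y \<in> closure D \<Longrightarrow> \<phi> y / \<psi> y \<le> \<phi> x0 / \<psi> x0"
    by (elim bexE) simp
  define m where "m = \<phi> x0 / \<psi> x0"
  have "0 < \<phi> x1 / \<psi> x1" using x1 \<psi>[OF x1c] by simp
  then have m: "0 < m" using x0[OF x1c] by (simp add: m_def)
  have x0D: "x0 \<in> D"
  proof (rule ccontr)
    assume "x0 \<notin> D"
    then have "x0 \<in> frontier D" using x0c D by (simp add: frontier_def interior_open)
    then show False using bd m by (simp add: m_def)
  qed
  have second: "(Dg x0 (axis k 1)) $ k + 2 * m \<le> 0" for k
  proof -
    define a :: "real^'d" where "a = axis k 1"
    have aa: "a \<bullet> a = 1" unfolding a_def inner_axis_axis by simp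
    obtain r where r: "0 < r" "ball x0 r \<subseteq> D" using x0D D(1) openE by blast
    have inD: "x0 + t *\<^sub>R a \<in> D" if "\<bar>t\<bar> < r" for t
    proof -
      have "norm a = 1" by (simp add: a_def)
      then have "x0 + t *\<^sub>R a \<in> ball x0 r" using that by (simp add: dist_norm)
      then show ?thesis using r by blast
    qed
    define F where "F t = \<phi> (x0 + t *\<^sub>R a) - m * (K - (x0 + t *\<^sub>R a) \<bullet> (x0 + t *\<^sub>R a))" for t
    define F' where "F' t = g (x0 + t *\<^sub>R a) \<bullet> a + m * (2 * ((x0 + t *\<^sub>R a) \<bullet> a))" for t
    have "Dg x0 a \<bullet> a + m * 2 \<le> 0"
    proof (rule second_derivative_nonpos_at_max[OF r(1)])
      fix t assume t: "\<bar>t\<bar> < r"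
      have "((\<lambda>t. \<phi> (x0 + t *\<^sub>R a)) has_derivative (\<lambda>s. g (x0 + t *\<^sub>R a) \<bullet> (s *\<^sub>R a))) (at t)"
        by (rule has_derivative_compose[of "\<lambda>t. x0 + t *\<^sub>R a" "\<lambda>s. s *\<^sub>R a" t UNIV \<phi>
              "\<lambda>h. g (x0 + t *\<^sub>R a) \<bullet> h"])
          (auto intro!: derivative_eq_intros g[OF inD[OF t]])
      then have "((\<lambda>t. \<phi> (x0 + t *\<^sub>R a)) has_real_derivative g (x0 + t *\<^sub>R a) \<bullet> a) (at t)"
        by (simp add: has_field_derivative_def mult.commute[of _ "_ \<bullet> a"])
      moreover have "((\<lambda>t. (x0 + t *\<^sub>R a) \<bullet> (x0 + t *\<^sub>R a)) has_real_derivative 2 * ((x0 + t *\<^sub>R a) \<bullet> a)) (at t)"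
        unfolding inner_add_left inner_add_right inner_scaleR_left inner_scaleR_right
        by (auto intro!: derivative_eq_intros simp: aa algebra_simps inner_commute)
      ultimately show "(F has_real_derivative F' t) (at t)"
        unfolding F_def F'_def by (auto intro!: derivative_eq_intros)
    next
      have "((\<lambda>t. g (x0 + t *\<^sub>R a)) has_derivative (\<lambda>s. Dg x0 (s *\<^sub>R a))) (at 0)"
        by (rule has_derivative_compose[of "\<lambda>t. x0 + t *\<^sub>R a" "\<lambda>s. s *\<^sub>R a" 0 UNIV g "Dg x0", simplified])
          (auto intro!: derivative_eq_intros Dg x0D)
      moreover have "Dg x0 (s *\<^sub>R a) = s *\<^sub>R Dg x0 a" for s
        using has_derivative_linear[OF Dg[OF x0D]] by (simp add: linear_cmul)
      ultimately have "((\<lambda>t. g (x0 + t *\<^sub>R a) \<bullet> a) has_derivative (\<lambda>s. (s *\<^sub>R Dg x0 a) \<bullet> a)) (at 0)"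
        by (auto intro!: derivative_eq_intros)
      then have "((\<lambda>t. g (x0 + t *\<^sub>R a) \<bullet> a) has_real_derivative Dg x0 a \<bullet> a) (at 0)"
        by (simp add: has_field_derivative_def mult.commute[of _ "_ \<bullet> a"])
      moreover have "((\<lambda>t. (x0 + t *\<^sub>R a) \<bullet> a) has_real_derivative 1) (at 0)"
        unfolding inner_add_left inner_scaleR_left
        by (auto intro!: derivative_eq_intros simp: aa)
      ultimately show "(F' has_real_derivative Dg x0 a \<bullet> a + m * 2) (at 0)"
        unfolding F'_def by (auto intro!: derivative_eq_intros)
    next
      fix t assume t: "\<bar>t\<bar> < r"
      have c: "x0 + t *\<^sub>R a \<in> closure D" using inD[OF t] closure_subset by blast
      have "\<phi> (x0 + t *\<^sub>R a) \<le> m * \<psi> (x0 + t *\<^sub>R a)"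
        using x0[OF c] \<psi>[OF c] by (simp add: m_def[symmetric] pos_divide_le_eq)
      moreover have "\<phi> x0 = m * \<psi> x0" using \<psi>[OF x0c] by (simp add: m_def)
      ultimately show "F t \<le> F 0" by (simp add: F_def \<psi>_def)
    qed
    then show ?thesis unfolding a_def inner_axis by (simp add: mult.commute)
  qed
  \<comment> \<open>Summed over the axes, the Laplacian of \<open>\<phi>\<close> at
    \<open>x0\<close> is at most \<open>- 2 * CARD('d) * m\<close>. It also equals
    \<open>- l * \<phi> x0\<close> with \<open>\<phi> x0 = m * \<psi> x0\<close>, so the factor
    \<open>m\<close> cancels.\<close>
  have "(\<Sum>k\<in>UNIV. (Dg x0 (axis k 1)) $ k + 2 * m) \<le> 0"
    by (rule sum_nonpos) (rule second)
  then have "2 * CARD('d) * m \<le> l * \<phi> x0"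
    using eqn[OF x0D] by (simp add: sum.distrib)
  also have "\<phi> x0 = m * \<psi> x0" using \<psi>[OF x0c] by (simp add: m_def)
  finally have *: "2 * CARD('d) \<le> l * \<psi> x0" using m by (simp add: mult.assoc mult.left_commute[of l])
  have \<psi>K: "\<psi> x0 \<le> K" by (simp add: \<psi>_def)
  have "0 < l * \<psi> x0" using * by (rule less_le_trans[rotated]) simp
  then have "0 < l" using \<psi>[OF x0c] by (simp add: zero_less_mult_iff)
  then have "l * \<psi> x0 \<le> l * K" using \<psi>K by (simp add: mult_left_mono)
  with * have "2 * CARD('d) \<le> l * K" by simp
  then show ?thesis using \<psi>[OF x0c] \<psi>K by (simp add: pos_divide_le_eq)
qed

lemma dirichlet_eigenfunction_uminus:
  assumes "dirichlet_eigenfunction D l \<phi>"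
  shows "dirichlet_eigenfunction D l (\<lambda>x. - \<phi> x)"
proof -
  obtain g Dg where g: "\<forall>x\<in>D. (\<phi> has_derivative (\<lambda>h. g x \<bullet> h)) (at x)"
    and Dg: "\<forall>x\<in>D. (g has_derivative Dg x) (at x)"
    and c: "continuous_on D g" "\<forall>k. continuous_on D (\<lambda>x. Dg x (axis k 1))"
    and eqn: "\<forall>x\<in>D. - (\<Sum>k\<in>UNIV. (Dg x (axis k 1)) $ k) = l * \<phi> x"
    and cont: "continuous_on (closure D) \<phi>" and bd: "\<forall>x\<in>frontier D. \<phi> x = 0"
    using assms unfolding dirichlet_eigenfunction_def by blast
  show ?thesis
    unfolding dirichlet_eigenfunction_def
  proof (intro conjI exI[of _ "\<lambda>x. - g x"] exI[of _ "\<lambda>x h. - Dg x h"])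
    show "\<forall>x\<in>D. ((\<lambda>x. - \<phi> x) has_derivative (\<bullet>) (- g x)) (at x)"
      using g by (auto intro!: derivative_eq_intros)
    show "\<forall>x\<in>D. ((\<lambda>x. - g x) has_derivative (\<lambda>h. - Dg x h)) (at x)"
      using Dg by (auto intro!: derivative_eq_intros)
  qed (use c eqn cont bd in \<open>auto intro!: continuous_intros simp: sum_negf\<close>)
qed

text \<open>Normalisation makes every eigenfunction nonzero somewhere, so it or its negative is
  positive at a point of \<open>D\<close>. The bound depends only on the dimension and on the radius
  \<open>B\<close> of a ball containing \<open>D\<close>, hence is uniform in
  \<open>i\<close>.\<close>

lemma dirichlet_eigenbasis_lower_bound:
  fixes D :: "(real^'d::finite) set"
  assumes D: "open D" "bounded D" and eig: "dirichlet_eigenbasis D lam \<phi>"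
  obtains l where "0 < l" "\<And>i. l \<le> lam i"
proof -
  have "bounded (closure D)" using D by (simp add: bounded_closure)
  then obtain B where B: "\<And>x. x \<in> closure D \<Longrightarrow> norm x \<le> B" "0 < B"
    using bounded_pos by blast
  have K: "x \<bullet> x < B\<^sup>2 + 1" if "x \<in> closure D" for x
    using B(1)[OF that] power_mono[OF B(1)[OF that], of 2] by (simp add: power2_norm_eq_inner)
  have "2 * CARD('d) / (B\<^sup>2 + 1) \<le> lam i" for i
  proof -
    have e: "dirichlet_eigenfunction D (lam i) (\<phi> i)" "coef D \<phi> (\<phi> i) i = 1"
      using eig by (auto simp: dirichlet_eigenbasis_def)
    have "\<exists>x\<in>D. \<phi> i x \<noteq> 0"
    proof (rule ccontr)
      assume "\<not> ?thesis"
      then have "coef D \<phi> (\<phi> i) i = (LINT x|lebesgue_on D. 0)"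
        unfolding coef_def by (intro Bochner_Integration.integral_cong) (auto simp: space_restrict_space)
      then show False using e by simp
    qed
    then obtain x where x: "x \<in> D" "0 < \<phi> i x \<or> 0 < - \<phi> i x" by force
    then show ?thesis
      using dirichlet_eigenvalue_lower_bound_pos[OF D e(1) K x(1)]
        dirichlet_eigenvalue_lower_bound_pos[OF D dirichlet_eigenfunction_uminus[OF e(1)] K x(1)]
      by blast
  qed
  moreover have "0 < 2 * CARD('d) / (B\<^sup>2 + 1)"
    using zero_le_power2[of B] by (intro divide_pos_pos) (auto simp: add_nonneg_pos)
  ultimately show thesis using that by blast
qed

section \<open>Weighted increments of fractional Brownian motion\<close>

text \<open>Only this inequality is needed, so Fatou's lemma for
  \<open>2 (1 - cos (\<theta> Y)) / \<theta>\<^sup>2 \<longrightarrow> Y\<^sup>2\<close> as \<open>\<theta> \<longrightarrow> 0\<close> replaces the uniqueness theorem for characteristic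
  functions.\<close>

lemma second_moment_le_of_char:
  assumes "prob_space M" and Y[measurable]: "Y \<in> borel_measurable M"
    and char: "\<And>\<theta>. char (distr M borel Y) \<theta> = complex_of_real (exp (- (\<theta>\<^sup>2 * v) / 2))"
  shows "(\<integral>\<^sup>+\<omega>. ennreal ((Y \<omega>)\<^sup>2) \<partial>M) \<le> ennreal v"
proof -
  interpret prob_space M by fact
  have cos_int: "(LINT \<omega>|M. cos (\<theta> * Y \<omega>)) = exp (- (\<theta>\<^sup>2 * v) / 2)" for \<theta>
  proof -
    have "char (distr M borel Y) \<theta> = (CLINT \<omega>|M. iexp (\<theta> * Y \<omega>))"
      unfolding char_def by (subst integral_distr) auto
    moreover have "complex_integrable M (\<lambda>\<omega>. iexp (\<theta> * Y \<omega>))"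
      by (rule integrable_iexp) auto
    ultimately have "Re (char (distr M borel Y) \<theta>) = (LINT \<omega>|M. Re (iexp (\<theta> * Y \<omega>)))"
      by (simp only: integral_Re)
    then show ?thesis by (simp only: char Re_exp) simp
  qed
  have cos_integrable: "integrable M (\<lambda>\<omega>. cos (\<theta> * Y \<omega>))" for \<theta>
    by (rule integrable_const_bound[where B=1]) auto
  define \<theta> where "\<theta> m = inverse (real (Suc m))" for m
  have \<theta>: "0 < \<theta> m" for m by (simp add: \<theta>_def)
  have \<theta>0: "filterlim \<theta> (at 0) sequentially"
    unfolding \<theta>_def
    by (rule filterlim_atI[OF LIMSEQ_inverse_real_of_nat]) simp
  \<comment> \<open>By the half-angle formula this quotient is a square, hence nonnegative as
    Fatou's lemma requires.\<close>
  define h where "h m y = 2 * (1 - cos (\<theta> m * y)) / (\<theta> m)\<^sup>2" for m and y :: real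
  have h_eq: "h m y = (2 * (sin ((y / 2) * \<theta> m) / \<theta> m))\<^sup>2" for m y
  proof -
    have "cos (\<theta> m * y) = 1 - 2 * (sin (y / 2 * \<theta> m))\<^sup>2"
      using cos_double_sin[of "y / 2 * \<theta> m"] by (simp add: mult.commute)
    then show ?thesis unfolding h_def by (simp only: power_mult_distrib power_divide) simp
  qed
  have lim: "(\<lambda>m. h m y) \<longlonglongrightarrow> y\<^sup>2" for y
  proof -
    have "((\<lambda>t. sin ((y / 2) * t)) has_real_derivative y / 2) (at 0)"
      by (auto intro!: derivative_eq_intros)
    then have "((\<lambda>t. sin ((y / 2) * t) / t) \<longlongrightarrow> y / 2) (at 0)"
      by (simp add: has_field_derivative_iff)
    then have "(\<lambda>m. sin ((y / 2) * \<theta> m) / \<theta> m) \<longlonglongrightarrow> y / 2"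
      by (rule filterlim_compose[OF _ \<theta>0])
    then have "(\<lambda>m. (2 * (sin ((y / 2) * \<theta> m) / \<theta> m))\<^sup>2) \<longlonglongrightarrow> (2 * (y / 2))\<^sup>2"
      by (intro tendsto_power tendsto_mult tendsto_const)
    then show ?thesis by (simp add: h_eq)
  qed
  have hm: "(\<integral>\<^sup>+\<omega>. ennreal (h m (Y \<omega>)) \<partial>M) \<le> ennreal v" for m
  proof -
    have hi: "integrable M (\<lambda>\<omega>. h m (Y \<omega>))"
      unfolding h_def using cos_integrable by auto
    have "(\<integral>\<^sup>+\<omega>. ennreal (h m (Y \<omega>)) \<partial>M) = ennreal (LINT \<omega>|M. h m (Y \<omega>))"
      by (rule nn_integral_eq_integral[OF hi]) (simp add: h_eq)
    also have "(LINT \<omega>|M. h m (Y \<omega>)) = 2 * (1 - exp (- ((\<theta> m)\<^sup>2 * v) / 2)) / (\<theta> m)\<^sup>2"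
      unfolding h_def using cos_integrable by (simp add: cos_int prob_space)
    \<comment> \<open>Since \<open>exp s \<ge> 1 + s\<close>, the bound \<open>v\<close> holds for
      every \<open>m\<close>, before any limit is taken.\<close>
    also have "\<dots> \<le> v"
    proof -
      have "1 - (\<theta> m)\<^sup>2 * v / 2 \<le> exp (- ((\<theta> m)\<^sup>2 * v) / 2)"
        using exp_ge_add_one_self[of "- ((\<theta> m)\<^sup>2 * v) / 2"] by simp
      then have "2 * (1 - exp (- ((\<theta> m)\<^sup>2 * v) / 2)) \<le> v * (\<theta> m)\<^sup>2" by (simp add: mult.commute)
      then show ?thesis using \<theta>[of m] by (simp add: pos_divide_le_eq)
    qed
    finally show ?thesis by (simp add: ennreal_leI)
  qed
  have "(\<integral>\<^sup>+\<omega>. ennreal ((Y \<omega>)\<^sup>2) \<partial>M) = (\<integral>\<^sup>+\<omega>. liminf (\<lambda>m. ennreal (h m (Y \<omega>))) \<partial>M)"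
    by (intro nn_integral_cong lim_imp_Liminf[symmetric] tendsto_ennrealI lim) simp
  also have "\<dots> \<le> liminf (\<lambda>m. \<integral>\<^sup>+\<omega>. ennreal (h m (Y \<omega>)) \<partial>M)"
    by (rule nn_integral_liminf) (simp add: h_def)
  also have "\<dots> \<le> liminf (\<lambda>m::nat. ennreal v)"
    by (intro Liminf_mono always_eventually allI hm)
  finally show ?thesis by (simp add: Liminf_const)
qed

text \<open>Concavity of \<open>x powr a\<close>. The derivative is only taken in the open interval,
  because \<open>x = 0\<close> is allowed and \<open>x powr a\<close> is not differentiable
  there.\<close>

lemma powr_increment_antimono:
  fixes a x y \<theta> :: real
  assumes a: "0 < a" "a < 1" and x: "0 \<le> x" "x \<le> y" "0 \<le> \<theta>"
  shows "(y + \<theta>) powr a - y powr a \<le> (x + \<theta>) powr a - x powr a"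
proof (rule DERIV_nonpos_imp_decreasing_open[OF x(2)])
  fix z assume z: "x < z" "z < y"
  have "((\<lambda>s. (s + \<theta>) powr a - s powr a) has_real_derivative
      a * (z + \<theta>) powr (a - 1) - a * z powr (a - 1)) (at z)"
    using z x by (auto intro!: derivative_eq_intros)
  moreover have "(z + \<theta>) powr (a - 1) \<le> z powr (a - 1)"
    using z x a by (intro powr_mono2') auto
  ultimately show "\<exists>D. ((\<lambda>s. (s + \<theta>) powr a - s powr a) has_real_derivative D) (at z) \<and> D \<le> 0"
    using a by (intro exI conjI) auto
next
  show "continuous_on {x..y} (\<lambda>s. (s + \<theta>) powr a - s powr a)"
    using x a by (intro continuous_intros continuous_on_powr') auto
qed

text \<open>Minus the covariance of the increments over \<open>[s, s + \<theta>]\<close> and \<open>[s + k h, s + k h + \<theta>]\<close>.\<close>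

definition incr_cov :: "real \<Rightarrow> real \<Rightarrow> real \<Rightarrow> nat \<Rightarrow> real" where
  "incr_cov H h \<theta> k = (2 * (k * h) powr (2*H) - (k * h + \<theta>) powr (2*H) - \<bar>k * h - \<theta>\<bar> powr (2*H)) / 2"

text \<open>For \<open>H < 1/2\<close> disjoint increments are negatively correlated, and concavity of \<open>x powr (2 H)\<close>
  makes the sum of the covariances telescope.\<close>

lemma sum_incr_cov_le:
  assumes H: "0 < H" "H < 1/2" and \<theta>: "0 \<le> \<theta>" "\<theta> \<le> h"
  shows "(\<Sum>k<m. \<bar>incr_cov H h \<theta> (Suc k)\<bar>) \<le> \<theta> powr (2*H) / 2"
proof -
  define D where "D k = (real k * h + \<theta>) powr (2*H) - (real k * h) powr (2*H)" for k
  have a: "0 < 2 * H" "2 * H < 1" using H by auto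
  \<comment> \<open>The covariance is half the difference of the increments of
    \<open>x powr (2 * H)\<close> of length \<open>\<theta>\<close> starting at
    \<open>s - \<theta>\<close> and at \<open>s\<close>. Concavity makes it nonnegative; as
    \<open>\<theta> \<le> h\<close>, the first increment starts to the right of \<open>k * h\<close>
    and is at most \<open>D k\<close>, while the second is \<open>D (Suc k)\<close>.\<close>
  have le: "\<bar>incr_cov H h \<theta> (Suc k)\<bar> \<le> (D k - D (Suc k)) / 2" for k
  proof -
    define s where "s = real (Suc k) * h"
    have kh: "0 \<le> real k * h" using \<theta> by simp
    have s_eq: "s = real k * h + h" by (simp add: s_def distrib_right)
    then have s: "0 \<le> s - \<theta>" "real k * h \<le> s - \<theta>" using \<theta> kh by linarith+
    have "(s + \<theta>) powr (2*H) - s powr (2*H) \<le> (s - \<theta> + \<theta>) powr (2*H) - (s - \<theta>) powr (2*H)"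
      by (rule powr_increment_antimono[OF a]) (use s kh \<theta> in linarith)+
    moreover have "(s - \<theta> + \<theta>) powr (2*H) - (s - \<theta>) powr (2*H) \<le> D k"
      unfolding D_def by (rule powr_increment_antimono[OF a]) (use s kh \<theta> in linarith)+
    moreover have "D (Suc k) = (s + \<theta>) powr (2*H) - s powr (2*H)" by (simp add: D_def s_def)
    moreover have "incr_cov H h \<theta> (Suc k) = (2 * s powr (2*H) - (s + \<theta>) powr (2*H) - (s - \<theta>) powr (2*H)) / 2"
      using s by (simp add: incr_cov_def s_def)
    ultimately show ?thesis by (simp add: field_simps)
  qed
  have "(\<Sum>k<m. \<bar>incr_cov H h \<theta> (Suc k)\<bar>) \<le> (\<Sum>k<m. (D k - D (Suc k)) / 2)"
    by (rule sum_mono) (rule le)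
  also have "\<dots> = (D 0 - D m) / 2"
    by (simp add: sum_lessThan_telescope' flip: sum_divide_distrib)
  also have "\<dots> \<le> D 0 / 2"
  proof -
    have "(real m * h) powr (2*H) \<le> (real m * h + \<theta>) powr (2*H)"
      using \<theta> a by (intro powr_mono2) auto
    then show ?thesis by (simp add: D_def)
  qed
  also have "\<dots> = \<theta> powr (2*H) / 2" by (simp add: D_def)
  finally show ?thesis .
qed

text \<open>A row sum of a symmetric Toeplitz matrix, cut at the diagonal: each side is an initial
  sum of \<open>g (Suc k)\<close>.\<close>

lemma sum_dist_le:
  fixes g :: "nat \<Rightarrow> real"
  assumes g: "\<And>k. 0 \<le> g k" and b: "\<And>m. (\<Sum>k<m. g (Suc k)) \<le> b" and j: "j < n"
  shows "(\<Sum>l<n. g (if l \<le> j then j - l else l - j)) \<le> g 0 + 2 * b"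
proof -
  let ?G = "\<lambda>l. g (if l \<le> j then j - l else l - j)"
  have "sum ?G {..<n} = sum ?G {..<j} + (?G j + sum ?G {Suc j..<n})"
    using sum.atLeastLessThan_concat[of 0 j n ?G] sum.atLeast_Suc_lessThan[OF j, of ?G] j
    by (simp only: lessThan_atLeast0)
  moreover have "sum ?G {..<j} = (\<Sum>k<j. g (Suc k))"
    by (rule sum.reindex_bij_witness[of _ "\<lambda>k. j - Suc k" "\<lambda>l. j - Suc l"])
      (auto intro!: arg_cong[where f=g])
  moreover have "sum ?G {Suc j..<n} = (\<Sum>k<n - Suc j. g (Suc k))"
    by (rule sum.reindex_bij_witness[of _ "\<lambda>k. k + Suc j" "\<lambda>l. l - Suc j"])
      (auto intro!: arg_cong[where f=g])
  ultimately show ?thesis using b[of j] b[of "n - Suc j"] by simp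
qed

lemma sum_double: "(\<Sum>k<2*n. F k) = (\<Sum>j<n. F (2*j) + F (2*j+1))" for F :: "nat \<Rightarrow> real"
  by (induction n) (auto simp: algebra_simps)

text \<open>The sum is a linear combination of values of \<open>X\<close>, so \<open>fbm\<close>
  supplies its characteristic function and thereby its variance. Each row of the covariance matrix
  of the increments sums to at most \<open>\<theta> powr (2 * H)\<close> on the diagonal plus half
  of it twice off the diagonal, and there are \<open>n\<close> rows. The variance thus grows
  linearly, not quadratically, in \<open>n\<close>.\<close>

lemma fbm_weighted_increments:
  fixes n :: nat and a h \<theta> :: real
  assumes M: "prob_space M" and X: "fbm M H X" and H: "0 < H" "H < 1/2"
    and \<theta>: "0 \<le> \<theta>" "\<theta> \<le> h" and a: "0 \<le> a" and c: "\<And>j. j < n \<Longrightarrow> \<bar>c j\<bar> \<le> 1"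
  shows "(\<integral>\<^sup>+\<omega>. ennreal ((\<Sum>j<n. c j * (X \<omega> (a + j * h + \<theta>) - X \<omega> (a + j * h)))\<^sup>2) \<partial>M)
     \<le> ennreal (2 * n * \<theta> powr (2*H))"
proof -
  \<comment> \<open>The \<open>2 n\<close> endpoints are interleaved: even indices are left
    endpoints with weight \<open>- c\<close>, odd ones right endpoints with weight
    \<open>c\<close>.\<close>
  define ts where "ts k = a + real (k div 2) * h + (if odd k then \<theta> else 0)" for k :: nat
  define cs where "cs k = (if odd k then c (k div 2) else - c (k div 2))" for k :: nat
  define s where "s j = a + real j * h" for j :: nat
  have ts: "ts (2*j) = s j" "ts (2*j+1) = s j + \<theta>" "ts (Suc (2*j)) = s j + \<theta>"
    "cs (2*j) = - c j" "cs (2*j+1) = c j" "cs (Suc (2*j)) = c j" for j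
    by (auto simp: ts_def cs_def s_def)
  have meas[measurable]: "(\<lambda>\<omega>. X \<omega> t) \<in> borel_measurable M" for t using X by (simp add: fbm_def)
  define Y where "Y \<omega> = (\<Sum>k<2*n. cs k * X \<omega> (ts k))" for \<omega>
  define v where "v = (\<Sum>k<2*n. \<Sum>l<2*n. cs k * cs l * fbm_cov H (ts k) (ts l))"
  have "0 \<le> ts k" for k using a \<theta> by (auto simp: ts_def)
  then have "(\<integral>\<^sup>+\<omega>. ennreal ((Y \<omega>)\<^sup>2) \<partial>M) \<le> ennreal v"
    using X unfolding fbm_def Y_def v_def
    by (intro second_moment_le_of_char[OF M]) auto
  moreover have "Y \<omega> = (\<Sum>j<n. c j * (X \<omega> (a + j * h + \<theta>) - X \<omega> (a + j * h)))" for \<omega>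
    unfolding Y_def sum_double ts by (simp add: s_def algebra_simps)
  moreover have "v \<le> 2 * n * \<theta> powr (2*H)"
  proof -
    \<comment> \<open>The covariance of the increments number \<open>j\<close> and \<open>l\<close>.
      The powers of single times in \<open>fbm_cov\<close> cancel, so only the distance of the
      indices remains.\<close>
    define K where "K j l = fbm_cov H (s j + \<theta>) (s l + \<theta>) - fbm_cov H (s j + \<theta>) (s l)
        - fbm_cov H (s j) (s l + \<theta>) + fbm_cov H (s j) (s l)" for j l
    have v: "v = (\<Sum>j<n. \<Sum>l<n. c j * c l * K j l)"
      unfolding v_def sum_double ts K_def by (simp add: sum.distrib[symmetric] algebra_simps)
    have K: "K j l = - incr_cov H h \<theta> (if l \<le> j then j - l else l - j)" for j l
    proof (cases "l \<le> j")
      case True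
      define d where "d = real (j - l) * h"
      have d: "0 \<le> d" using \<theta> by (auto simp: d_def)
      have "s j = s l + d" using True by (simp add: s_def d_def of_nat_diff algebra_simps)
      then have "K j l = (\<bar>d + \<theta>\<bar> powr (2*H) + \<bar>d - \<theta>\<bar> powr (2*H) - 2 * \<bar>d\<bar> powr (2*H)) / 2"
        unfolding K_def fbm_cov_def by (simp add: field_simps)
      moreover have "incr_cov H h \<theta> (j - l)
          = (2 * d powr (2*H) - (d + \<theta>) powr (2*H) - \<bar>d - \<theta>\<bar> powr (2*H)) / 2"
        by (simp only: incr_cov_def d_def)
      ultimately show ?thesis using True d \<theta> by simp
    next
      case False
      define d where "d = real (l - j) * h"
      have d: "0 \<le> d" using \<theta> by (auto simp: d_def)
      have "s l = s j + d" using False by (simp add: s_def d_def of_nat_diff algebra_simps)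
      then have e: "\<bar>s j + \<theta> - (s l + \<theta>)\<bar> = d" "\<bar>s j + \<theta> - s l\<bar> = \<bar>d - \<theta>\<bar>"
        "\<bar>s j - (s l + \<theta>)\<bar> = d + \<theta>" "\<bar>s j - s l\<bar> = d"
        using d \<theta> by linarith+
      have "K j l = (\<bar>d - \<theta>\<bar> powr (2*H) + (d + \<theta>) powr (2*H) - 2 * d powr (2*H)) / 2"
        unfolding K_def fbm_cov_def e by (simp add: field_simps)
      moreover have "incr_cov H h \<theta> (l - j)
          = (2 * d powr (2*H) - (d + \<theta>) powr (2*H) - \<bar>d - \<theta>\<bar> powr (2*H)) / 2"
        by (simp only: incr_cov_def d_def)
      ultimately show ?thesis using False by simp
    qed
    have "v \<le> (\<Sum>j<n. \<Sum>l<n. \<bar>incr_cov H h \<theta> (if l \<le> j then j - l else l - j)\<bar>)"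
      unfolding v
    proof (intro sum_mono)
      fix j l assume "j \<in> {..<n}" "l \<in> {..<n}"
      then have "\<bar>c j * c l\<bar> \<le> 1" using c by (simp add: abs_mult mult_le_one)
      then have "\<bar>c j * c l\<bar> * \<bar>K j l\<bar> \<le> 1 * \<bar>K j l\<bar>" by (intro mult_right_mono) auto
      moreover have "c j * c l * K j l \<le> \<bar>c j * c l\<bar> * \<bar>K j l\<bar>" by (simp only: abs_mult[symmetric] abs_ge_self)
      ultimately have "c j * c l * K j l \<le> \<bar>K j l\<bar>" by simp
      then show "c j * c l * K j l \<le> \<bar>incr_cov H h \<theta> (if l \<le> j then j - l else l - j)\<bar>"
        by (simp add: K)
    qed
    also have "\<dots> \<le> (\<Sum>j<n. \<bar>incr_cov H h \<theta> 0\<bar> + 2 * (\<theta> powr (2*H) / 2))"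
      by (intro sum_mono sum_dist_le[of "\<lambda>k. \<bar>incr_cov H h \<theta> k\<bar>"] sum_incr_cov_le H \<theta>) auto
    also have "\<bar>incr_cov H h \<theta> 0\<bar> = \<theta> powr (2*H)"
      using \<theta> by (simp add: incr_cov_def)
    finally show ?thesis by simp
  qed
  ultimately show ?thesis by (simp add: order_trans[OF _ ennreal_leI])
qed

text \<open>Time is rounded down to a grid of mesh \<open>1 / Suc m\<close>. The rounded process
  takes its times from a countable set and is jointly measurable; path continuity gives the
  limit.\<close>

lemma measurable_continuous_process:
  fixes g :: "'w \<Rightarrow> real \<Rightarrow> real"
  assumes m[measurable]: "\<And>r. (\<lambda>\<omega>. g \<omega> r) \<in> borel_measurable M"
    and c: "\<And>\<omega>. \<omega> \<in> space M \<Longrightarrow> continuous_on UNIV (g \<omega>)"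
  shows "(\<lambda>p. g (fst p) (snd p)) \<in> borel_measurable (M \<Otimes>\<^sub>M borel)"
proof (rule borel_measurable_LIMSEQ_real)
  fix p assume "p \<in> space (M \<Otimes>\<^sub>M (borel :: real measure))"
  then have p: "fst p \<in> space M" by (auto simp: space_pair_measure)
  have "(\<lambda>m. of_int \<lfloor>snd p * real (Suc m)\<rfloor> / real (Suc m)) \<longlonglongrightarrow> snd p"
  proof (rule tendsto_sandwich[OF _ _ _ tendsto_const])
    show "(\<lambda>m. snd p - inverse (real (Suc m))) \<longlonglongrightarrow> snd p"
      using tendsto_diff[OF tendsto_const LIMSEQ_inverse_real_of_nat, of "snd p"] by simp
    show "\<forall>\<^sub>F m in sequentially. snd p - inverse (real (Suc m)) \<le> of_int \<lfloor>snd p * real (Suc m)\<rfloor> / real (Suc m)"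
    proof (rule always_eventually, rule allI)
      fix m
      have "snd p * real (Suc m) - 1 \<le> of_int \<lfloor>snd p * real (Suc m)\<rfloor>" by linarith
      then have "(snd p * real (Suc m) - 1) / real (Suc m) \<le> of_int \<lfloor>snd p * real (Suc m)\<rfloor> / real (Suc m)"
        by (rule divide_right_mono) simp
      then show "snd p - inverse (real (Suc m)) \<le> of_int \<lfloor>snd p * real (Suc m)\<rfloor> / real (Suc m)"
        by (simp add: diff_divide_distrib inverse_eq_divide del: of_nat_Suc)
    qed
    show "\<forall>\<^sub>F m in sequentially. of_int \<lfloor>snd p * real (Suc m)\<rfloor> / real (Suc m) \<le> snd p"
    proof (rule always_eventually, rule allI)
      fix m
      have "of_int \<lfloor>snd p * real (Suc m)\<rfloor> \<le> snd p * real (Suc m)" by linarith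
      then show "of_int \<lfloor>snd p * real (Suc m)\<rfloor> / real (Suc m) \<le> snd p"
        by (simp add: pos_divide_le_eq del: of_nat_Suc)
    qed
  qed
  then show "(\<lambda>m. g (fst p) (of_int \<lfloor>snd p * real (Suc m)\<rfloor> / real (Suc m))) \<longlonglongrightarrow> g (fst p) (snd p)"
    by (rule continuous_on_tendsto_compose[OF c[OF p]]) auto
next
  fix m :: nat
  show "(\<lambda>p. g (fst p) (of_int \<lfloor>snd p * real (Suc m)\<rfloor> / real (Suc m))) \<in> borel_measurable (M \<Otimes>\<^sub>M borel)"
  proof (rule measurable_compose_countable[where f="\<lambda>i p. g (fst p) (of_int i / real (Suc m))"
        and g="\<lambda>p. \<lfloor>snd p * real (Suc m)\<rfloor>"])
    show "(\<lambda>p. g (fst p) (of_int i / real (Suc m))) \<in> borel_measurable (M \<Otimes>\<^sub>M borel)" for i :: int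
      by measurable
    show "(\<lambda>p. \<lfloor>snd p * real (Suc m)\<rfloor>) \<in> M \<Otimes>\<^sub>M borel \<rightarrow>\<^sub>M count_space UNIV"
      by measurable
  qed
qed

text \<open>Cauchy-Schwarz against the constant 1, stated as a bridge from the gauge integral of the
  scheme and the mild formula to the nonnegative integral, where Tonelli's theorem applies.\<close>

lemma integral_square_le:
  fixes f :: "real \<Rightarrow> real"
  assumes f: "integrable (lebesgue_on {a..b}) f" and ab: "a \<le> b"
  shows "ennreal ((integral {a..b} f)\<^sup>2) \<le> ennreal (b - a) * (\<integral>\<^sup>+r\<in>{a..b}. ennreal ((f r)\<^sup>2) \<partial>lborel)"
proof -
  let ?L = "lebesgue_on {a..b}"
  have [measurable]: "f \<in> borel_measurable ?L" using f by auto
  have "integral {a..b} f = (LINT r|?L. f r)"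
    using lebesgue_integral_eq_integral[OF f] by simp
  also have "\<bar>\<dots>\<bar> \<le> (LINT r|?L. \<bar>f r\<bar>)" by (rule integral_abs_bound)
  finally have "\<bar>integral {a..b} f\<bar> \<le> (LINT r|?L. \<bar>f r\<bar>)" .
  then have "(integral {a..b} f)\<^sup>2 \<le> (LINT r|?L. \<bar>f r\<bar>)\<^sup>2"
    by (simp add: abs_le_square_iff[symmetric])
  then have "ennreal ((integral {a..b} f)\<^sup>2) \<le> ennreal (LINT r|?L. \<bar>f r\<bar>) ^ 2"
    by (simp add: ennreal_power ennreal_leI)
  also have "ennreal (LINT r|?L. \<bar>f r\<bar>) = (\<integral>\<^sup>+r. ennreal \<bar>f r\<bar> * 1 \<partial>?L)"
    using f by (simp add: nn_integral_eq_integral)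
  also have "\<dots>\<^sup>2 \<le> (\<integral>\<^sup>+r. (ennreal \<bar>f r\<bar>)\<^sup>2 \<partial>?L) * (\<integral>\<^sup>+r. 1\<^sup>2 \<partial>?L)"
    by (rule Cauchy_Schwarz_nn_integral) auto
  also have "(\<integral>\<^sup>+r. (1::ennreal)\<^sup>2 \<partial>?L) = ennreal (b - a)"
    using ab by (simp add: emeasure_restrict_space space_restrict_space)
  also have "(\<integral>\<^sup>+r. (ennreal \<bar>f r\<bar>)\<^sup>2 \<partial>?L) = (\<integral>\<^sup>+r\<in>{a..b}. ennreal ((f r)\<^sup>2) \<partial>lborel)"
    by (subst nn_integral_restrict_space) (auto simp: nn_integral_completion ennreal_power)
  finally show ?thesis by (simp add: mult.commute)
qed

lemma nn_integral_square_add_le: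
  assumes [measurable]: "f \<in> borel_measurable M" "g \<in> borel_measurable M"
    and f: "(\<integral>\<^sup>+\<omega>. ennreal ((f \<omega>)\<^sup>2) \<partial>M) \<le> ennreal a" and g: "(\<integral>\<^sup>+\<omega>. ennreal ((g \<omega>)\<^sup>2) \<partial>M) \<le> ennreal b"
    and ab: "0 \<le> a" "0 \<le> b"
  shows "(\<integral>\<^sup>+\<omega>. ennreal ((f \<omega> + g \<omega>)\<^sup>2) \<partial>M) \<le> ennreal (2 * a + 2 * b)"
proof -
  have "(x + y)\<^sup>2 \<le> 2 * x\<^sup>2 + 2 * y\<^sup>2" for x y :: real
    using sum_squares_bound[of x y] by (simp add: power2_sum)
  then have "(\<integral>\<^sup>+\<omega>. ennreal ((f \<omega> + g \<omega>)\<^sup>2) \<partial>M) \<le> (\<integral>\<^sup>+\<omega>. 2 * ennreal ((f \<omega>)\<^sup>2) + 2 * ennreal ((g \<omega>)\<^sup>2) \<partial>M)"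
    by (intro nn_integral_mono) (simp flip: ennreal_plus ennreal_mult' ennreal_numeral)
  also have "\<dots> = 2 * (\<integral>\<^sup>+\<omega>. ennreal ((f \<omega>)\<^sup>2) \<partial>M) + 2 * (\<integral>\<^sup>+\<omega>. ennreal ((g \<omega>)\<^sup>2) \<partial>M)"
    by (simp add: nn_integral_add nn_integral_cmult)
  also have "\<dots> \<le> 2 * ennreal a + 2 * ennreal b"
    using f g by (intro add_mono mult_left_mono) auto
  also have "\<dots> = ennreal (2 * a + 2 * b)"
    using ab by (simp add: ennreal_mult)
  finally show ?thesis .
qed

text \<open>The slack in \<open>c'\<close> lets a trigonometric factor be replaced by its bound in
  the same step.\<close>

lemma nn_integral_square_scale_le:
  assumes [measurable]: "f \<in> borel_measurable M"
    and f: "(\<integral>\<^sup>+\<omega>. ennreal ((f \<omega>)\<^sup>2) \<partial>M) \<le> ennreal a" and a: "0 \<le> a" and c: "c\<^sup>2 \<le> c'"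
  shows "(\<integral>\<^sup>+\<omega>. ennreal ((c * f \<omega>)\<^sup>2) \<partial>M) \<le> ennreal (c' * a)"
proof -
  have "(\<integral>\<^sup>+\<omega>. ennreal ((c * f \<omega>)\<^sup>2) \<partial>M) = ennreal (c\<^sup>2) * (\<integral>\<^sup>+\<omega>. ennreal ((f \<omega>)\<^sup>2) \<partial>M)"
    by (simp add: power_mult_distrib ennreal_mult nn_integral_cmult)
  also have "\<dots> \<le> ennreal c' * ennreal a"
    using f c by (intro mult_mono ennreal_leI) auto
  also have "\<dots> = ennreal (c' * a)" using a order_trans[OF zero_le_power2 c] by (simp add: ennreal_mult)
  finally show ?thesis .
qed

lemma integral_grid_sum:
  fixes f :: "real \<Rightarrow> real"
  assumes "continuous_on {a..} f" "0 \<le> h"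
  shows "integral {a..a + real n * h} f = (\<Sum>j<n. integral {a + real j * h..a + real (Suc j) * h} f)"
proof (induction n)
  case (Suc n)
  have le: "a + real n * h \<le> a + real (Suc n) * h" "a \<le> a + real n * h"
    using assms(2) by (auto intro!: mult_right_mono)
  have "f integrable_on {a..a + real (Suc n) * h}"
    by (intro integrable_continuous_interval continuous_on_subset[OF assms(1)]) auto
  from Henstock_Kurzweil_Integration.integral_combine[OF le(2,1) this] show ?case using Suc by simp
qed simp

section \<open>Riemann sums along one fractional Brownian motion\<close>

locale fbm_process = prob_space M for M :: "'w measure" +
  fixes H :: real and X :: "'w \<Rightarrow> real \<Rightarrow> real"
  assumes fbm: "fbm M H X" and H: "0 < H" "H < 1/2"
begin

lemma meas[measurable]: "(\<lambda>\<omega>. X \<omega> t) \<in> borel_measurable M"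
  using fbm by (simp add: fbm_def)

lemma cont: "\<omega> \<in> space M \<Longrightarrow> continuous_on {0..} (X \<omega>)"
  using fbm by (simp add: fbm_def)

text \<open>Paths are only known to be continuous from time 0 on. Freezing them at negative times
  gives continuity on the whole line, as needed for joint measurability.\<close>

lemma cont_max: "\<omega> \<in> space M \<Longrightarrow> continuous_on UNIV (\<lambda>r. X \<omega> (max 0 r))"
  by (rule continuous_on_compose2[OF cont]) (auto intro!: continuous_intros)

lemma joint_meas:
  assumes [measurable]: "f \<in> N \<rightarrow>\<^sub>M M" "g \<in> borel_measurable N"
  shows "(\<lambda>x. X (f x) (max 0 (g x))) \<in> borel_measurable N"
proof -
  have "(\<lambda>x. (f x, g x)) \<in> N \<rightarrow>\<^sub>M M \<Otimes>\<^sub>M borel" by measurable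
  from measurable_compose[OF this measurable_continuous_process[of "\<lambda>\<omega> r. X \<omega> (max 0 r)"]]
  show ?thesis using cont_max by simp
qed

text \<open>Joint measurability makes the Lebesgue integral in time measurable in the sample point;
  on a continuous path it equals the gauge integral.\<close>

lemma meas_integral[measurable]:
  assumes s: "0 \<le> s" and g: "continuous_on UNIV g"
  shows "(\<lambda>\<omega>. integral {s..t} (\<lambda>r. g r * X \<omega> r)) \<in> borel_measurable M"
proof -
  have [measurable]: "g \<in> borel_measurable borel" using g by (rule borel_measurable_continuous_onI)
  have [measurable]: "(\<lambda>p. X (fst p) (max 0 (snd p))) \<in> borel_measurable (M \<Otimes>\<^sub>M lborel)"
    by (rule joint_meas) auto
  have "(\<lambda>\<omega>. LINT r|lborel. indicator {s..t} r *\<^sub>R (g r * X \<omega> (max 0 r))) \<in> borel_measurable M"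
    by (rule lborel.borel_measurable_lebesgue_integral) (auto simp: case_prod_beta)
  moreover have "(LINT r|lborel. indicator {s..t} r *\<^sub>R (g r * X \<omega> (max 0 r)))
      = integral {s..t} (\<lambda>r. g r * X \<omega> r)" if "\<omega> \<in> space M" for \<omega>
  proof -
    have "(LINT r|lborel. indicator {s..t} r *\<^sub>R (g r * X \<omega> (max 0 r)))
      = (LINT r:{s..t}|lborel. g r * X \<omega> r)"
      unfolding set_lebesgue_integral_def using s
      by (intro Bochner_Integration.integral_cong) (auto simp: indicator_def)
    also have "\<dots> = integral {s..t} (\<lambda>r. g r * X \<omega> r)"
      using s by (intro set_borel_integral_eq_integral borel_integrable_atLeastAtMost' continuous_intros
          continuous_on_subset[OF g] continuous_on_subset[OF cont[OF that]]) auto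
    finally show ?thesis .
  qed
  ultimately show ?thesis by (rule measurable_cong[THEN iffD1, rotated])
qed

lemma cont_on: "0 \<le> a \<Longrightarrow> \<omega> \<in> space M \<Longrightarrow> continuous_on {a..b} (X \<omega>)"
  by (rule continuous_on_subset[OF cont]) auto

lemma integral_centred:
  assumes "\<omega> \<in> space M" "0 \<le> s" "continuous_on UNIV g"
  shows "integral {s..t} (\<lambda>r. g r * (X \<omega> r - c))
      = integral {s..t} (\<lambda>r. g r * X \<omega> r) - integral {s..t} g * c"
proof -
  have "integral {s..t} (\<lambda>r. g r * X \<omega> r - g r * c) = integral {s..t} (\<lambda>r. g r * X \<omega> r) - integral {s..t} (\<lambda>r. g r * c)"
    by (intro Henstock_Kurzweil_Integration.integral_diff integrable_continuous_interval continuous_intros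
        cont_on assms continuous_on_subset[OF assms(3)]) auto
  then show ?thesis by (simp add: right_diff_distrib)
qed

lemma meas_integral_centred[measurable]:
  assumes s: "0 \<le> s" and g: "continuous_on UNIV g"
  shows "(\<lambda>\<omega>. integral {s..t} (\<lambda>r. g r * (X \<omega> r - X \<omega> c))) \<in> borel_measurable M"
proof -
  have [measurable]: "(\<lambda>\<omega>. integral {s..t} (\<lambda>r. g r * X \<omega> r)) \<in> borel_measurable M"
    by (rule meas_integral[OF s g])
  have "(\<lambda>\<omega>. integral {s..t} (\<lambda>r. g r * X \<omega> r) - integral {s..t} g * X \<omega> c) \<in> borel_measurable M"
    by measurable
  then show ?thesis
    by (rule measurable_cong[THEN iffD1, rotated]) (simp add: integral_centred s g)
qed

text \<open>Shifting all cells to \<open>{0..h}\<close> exchanges sum and integral: for each offset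
  \<open>\<theta>\<close> the integrand is a weighted sum of increments of length
  \<open>\<theta>\<close>, with second moment at most \<open>2 * n * h powr (2 * H)\<close>.
  Cauchy-Schwarz in \<open>\<theta>\<close> contributes one factor \<open>h\<close> and the length
  of the interval another.\<close>

lemma riemann_error:
  fixes n :: nat
  assumes a: "0 \<le> a" and h: "0 \<le> h" and g: "continuous_on UNIV g" "\<And>r. \<bar>g r\<bar> \<le> 1"
  shows "(\<integral>\<^sup>+\<omega>. ennreal ((\<Sum>j<n. integral {a + real j * h..a + real (Suc j) * h}
              (\<lambda>r. g r * (X \<omega> r - X \<omega> (a + real j * h))))\<^sup>2) \<partial>M)
       \<le> ennreal (2 * n * h powr (2 + 2*H))" (is "(\<integral>\<^sup>+\<omega>. ennreal ((?R \<omega>)\<^sup>2) \<partial>M) \<le> _")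
proof -
  have gm[measurable]: "g \<in> borel_measurable borel" using g(1) by (rule borel_measurable_continuous_onI)
  define s where "s j = a + real j * h" for j
  have s: "0 \<le> s j" for j using a h by (simp add: s_def)
  define Y where "Y \<omega> \<theta> = (\<Sum>j<n. g (s j + \<theta>) * (X \<omega> (s j + \<theta>) - X \<omega> (s j)))" for \<omega> \<theta>
  \<comment> \<open>A version of \<open>Y\<close> that is jointly measurable on the whole time line
    and agrees with \<open>Y\<close> for nonnegative offsets.\<close>
  define Ye where "Ye \<omega> \<theta> = (\<Sum>j<n. g (s j + \<theta>) * (X \<omega> (max 0 (s j + \<theta>)) - X \<omega> (s j)))" for \<omega> \<theta>
  have Ye: "Ye \<omega> \<theta> = Y \<omega> \<theta>" if "0 \<le> \<theta>" for \<omega> \<theta>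
    unfolding Ye_def Y_def using s that by (simp add: max_absorb2)
  have [measurable]: "(\<lambda>p. Ye (fst p) (snd p)) \<in> borel_measurable (M \<Otimes>\<^sub>M lborel)"
    unfolding Ye_def
    by (intro borel_measurable_sum borel_measurable_times borel_measurable_diff joint_meas) measurable
  have R: "?R \<omega> = integral {0..h} (Y \<omega>)" and Yc: "continuous_on {0..h} (Y \<omega>)" if \<omega>: "\<omega> \<in> space M" for \<omega>
  proof -
    have c: "continuous_on {0..h} (\<lambda>\<theta>. g (s j + \<theta>) * (X \<omega> (s j + \<theta>) - X \<omega> (s j)))" for j
      using s[of j] by (intro continuous_intros continuous_on_compose2[OF g(1)] continuous_on_compose2[OF cont[OF \<omega>]]) auto
    show "continuous_on {0..h} (Y \<omega>)" unfolding Y_def by (intro continuous_on_sum c)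
    have "integral {s j..s j + h} (\<lambda>r. g r * (X \<omega> r - X \<omega> (s j)))
        = integral {0..h} (\<lambda>\<theta>. g (s j + \<theta>) * (X \<omega> (s j + \<theta>) - X \<omega> (s j)))" for j
      using integral_shift_Icc_real[of 0 h "\<lambda>r. g r * (X \<omega> r - X \<omega> (s j))" "s j"]
      by (simp add: comp_def add.commute)
    moreover have "a + real (Suc j) * h = s j + h" for j by (simp add: s_def algebra_simps)
    ultimately have "?R \<omega> = (\<Sum>j<n. integral {0..h} (\<lambda>\<theta>. g (s j + \<theta>) * (X \<omega> (s j + \<theta>) - X \<omega> (s j))))"
      by (simp add: s_def[symmetric])
    also have "\<dots> = integral {0..h} (Y \<omega>)"
      unfolding Y_def
      by (rule Henstock_Kurzweil_Integration.integral_sum[symmetric]) (auto intro: integrable_continuous_interval c)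
    finally show "?R \<omega> = integral {0..h} (Y \<omega>)" .
  qed
  have "(\<integral>\<^sup>+\<omega>. ennreal ((?R \<omega>)\<^sup>2) \<partial>M)
      \<le> (\<integral>\<^sup>+\<omega>. ennreal h * (\<integral>\<^sup>+\<theta>\<in>{0..h}. ennreal ((Ye \<omega> \<theta>)\<^sup>2) \<partial>lborel) \<partial>M)"
  proof (rule nn_integral_mono)
    fix \<omega> assume \<omega>: "\<omega> \<in> space M"
    have "ennreal ((?R \<omega>)\<^sup>2) \<le> ennreal (h - 0) * (\<integral>\<^sup>+\<theta>\<in>{0..h}. ennreal ((Y \<omega> \<theta>)\<^sup>2) \<partial>lborel)"
      unfolding R[OF \<omega>] by (intro integral_square_le continuous_imp_integrable_real Yc \<omega> h)
    also have "(\<integral>\<^sup>+\<theta>\<in>{0..h}. ennreal ((Y \<omega> \<theta>)\<^sup>2) \<partial>lborel) = (\<integral>\<^sup>+\<theta>\<in>{0..h}. ennreal ((Ye \<omega> \<theta>)\<^sup>2) \<partial>lborel)"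
      by (intro nn_integral_cong) (auto simp: indicator_def Ye)
    finally show "ennreal ((?R \<omega>)\<^sup>2) \<le> ennreal h * (\<integral>\<^sup>+\<theta>\<in>{0..h}. ennreal ((Ye \<omega> \<theta>)\<^sup>2) \<partial>lborel)" by simp
  qed
  also have "\<dots> = ennreal h * (\<integral>\<^sup>+\<omega>. \<integral>\<^sup>+\<theta>. ennreal ((Ye \<omega> \<theta>)\<^sup>2) * indicator {0..h} \<theta> \<partial>lborel \<partial>M)"
    by (rule nn_integral_cmult) (auto intro!: lborel.borel_measurable_nn_integral simp: case_prod_beta)
  also have "(\<integral>\<^sup>+\<omega>. \<integral>\<^sup>+\<theta>. ennreal ((Ye \<omega> \<theta>)\<^sup>2) * indicator {0..h} \<theta> \<partial>lborel \<partial>M)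
      = (\<integral>\<^sup>+\<theta>. \<integral>\<^sup>+\<omega>. ennreal ((Ye \<omega> \<theta>)\<^sup>2) * indicator {0..h} \<theta> \<partial>M \<partial>lborel)"
    by (rule pair_sigma_finite.Fubini'[symmetric])
      (auto simp: case_prod_beta pair_sigma_finite_def sigma_finite_measure_axioms lborel.sigma_finite_measure_axioms)
  also have "\<dots> \<le> (\<integral>\<^sup>+\<theta>. ennreal (2 * n * h powr (2*H)) * indicator {0..h} \<theta> \<partial>lborel)"
  proof (rule nn_integral_mono)
    fix \<theta> :: real
    show "(\<integral>\<^sup>+\<omega>. ennreal ((Ye \<omega> \<theta>)\<^sup>2) * indicator {0..h} \<theta> \<partial>M) \<le> ennreal (2 * n * h powr (2*H)) * indicator {0..h} \<theta>"
    proof (cases "\<theta> \<in> {0..h}")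
      case True
      then have \<theta>: "0 \<le> \<theta>" "\<theta> \<le> h" by auto
      have "(\<integral>\<^sup>+\<omega>. ennreal ((Ye \<omega> \<theta>)\<^sup>2) \<partial>M) \<le> ennreal (2 * n * \<theta> powr (2*H))"
        unfolding Ye[OF \<theta>(1)] Y_def s_def
        by (rule fbm_weighted_increments[OF prob_space_axioms fbm H \<theta> a g(2)])
      also have "\<dots> \<le> ennreal (2 * n * h powr (2*H))"
        using \<theta> H by (intro ennreal_leI mult_left_mono powr_mono2) auto
      finally show ?thesis using True by simp
    qed simp
  qed
  also have "\<dots> = ennreal (2 * n * h powr (2*H)) * ennreal h"
    using h by (simp add: nn_integral_cmult)
  also have "ennreal h * \<dots> = ennreal (2 * n * h powr (2 + 2*H))"
    using h by (cases "h = 0") (simp_all add: ennreal_mult[symmetric] powr_add powr_numeral power2_eq_square mult_ac)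
  finally show ?thesis by (simp add: mult_left_mono)
qed

end

section \<open>Moments of stochastic convolutions\<close>

abbreviation cell :: "real \<Rightarrow> nat \<Rightarrow> real set" where
  "cell h j \<equiv> {real j * h..real (Suc j) * h}"

lemma integral_cos_phase:
  fixes w :: real
  assumes "s \<le> t" "w \<noteq> 0"
  shows "integral {s..t} (\<lambda>r. cos (w * (b - r) + \<theta>)) = (sin (w * (b - s) + \<theta>) - sin (w * (b - t) + \<theta>)) / w"
proof -
  have "((\<lambda>r. cos (w * (b - r) + \<theta>)) has_integral
      (- sin (w * (b - t) + \<theta>) / w) - (- sin (w * (b - s) + \<theta>) / w)) {s..t}"
    using assms(2)
    by (intro fundamental_theorem_of_calculus assms(1))
      (auto intro!: derivative_eq_intros simp flip: has_real_derivative_iff_has_vector_derivative)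
  then show ?thesis by (simp add: integral_unique diff_divide_distrib)
qed

lemma powr_le_powr_of_le_one:
  fixes x :: real
  assumes "0 < x" "x \<le> 1" "a \<le> b"
  shows "x powr b \<le> x powr a"
  using assms by (simp add: powr_mono')

context fbm_process
begin

text \<open>\<open>\<integral>\<^sub>0\<^sup>t sin (w (t - r) + \<theta>) dX(r)\<close>, integrated by parts: \<open>\<theta> = 0\<close> gives \<open>w\<close> times a mode
  of the stochastic convolution in \<open>u\<close>, and \<open>\<theta> = pi/2\<close> its counterpart in the velocity.\<close>

definition W :: "real \<Rightarrow> real \<Rightarrow> 'w \<Rightarrow> real \<Rightarrow> real" where
  "W w \<theta> \<omega> t = sin \<theta> * X \<omega> t - sin (w * t + \<theta>) * X \<omega> 0
      + w * integral {0..t} (\<lambda>r. cos (w * (t - r) + \<theta>) * X \<omega> r)"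

text \<open>The error made when \<open>X\<close> is frozen at the left end of each cell inside the
  integral occurring in \<open>W\<close>.\<close>

definition grid_error :: "real \<Rightarrow> real \<Rightarrow> real \<Rightarrow> nat \<Rightarrow> 'w \<Rightarrow> real" where
  "grid_error w \<theta> h n \<omega> = (\<Sum>j<n. integral (cell h j)
      (\<lambda>r. cos (w * (real n * h - r) + \<theta>) * (X \<omega> r - X \<omega> (real j * h))))"

text \<open>For \<open>\<theta> = 0\<close> this is \<open>w\<close> times the noise that the scheme
  accumulates in a mode of unit intensity. The kernel sits at the right end of each cell because the
  increment enters at the end of a step.\<close>

definition grid_sum :: "real \<Rightarrow> real \<Rightarrow> real \<Rightarrow> nat \<Rightarrow> 'w \<Rightarrow> real" where
  "grid_sum w \<theta> h n \<omega> = (\<Sum>j<n. sin (w * (real n * h - real (Suc j) * h) + \<theta>)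
      * (X \<omega> (real (Suc j) * h) - X \<omega> (real j * h)))"

lemma cont_cos: "continuous_on UNIV (\<lambda>r. cos (w * (b - r) + \<theta> :: real))"
  by (intro continuous_intros)

lemma W_meas[measurable]: "(\<lambda>\<omega>. W w \<theta> \<omega> t) \<in> borel_measurable M"
proof -
  have [measurable]: "(\<lambda>\<omega>. integral {0..t} (\<lambda>r. cos (w * (t - r) + \<theta>) * X \<omega> r)) \<in> borel_measurable M"
    by (rule meas_integral[OF _ cont_cos]) simp
  show ?thesis unfolding W_def by measurable
qed

lemma grid_sum_meas[measurable]: "grid_sum w \<theta> h n \<in> borel_measurable M"
  unfolding grid_sum_def by measurable

lemma grid_error_meas:
  assumes "0 \<le> h" shows "grid_error w \<theta> h n \<in> borel_measurable M"
  unfolding grid_error_def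
  by (intro borel_measurable_sum meas_integral_centred cont_cos) (use assms in auto)

lemma W_grid:
  assumes \<omega>: "\<omega> \<in> space M" and h: "0 \<le> h" and w: "w \<noteq> 0"
  shows "W w \<theta> \<omega> (real n * h) = grid_sum w \<theta> h n \<omega> + w * grid_error w \<theta> h n \<omega>"
proof -
  define t where "t = real n * h"
  define s where "s j = sin (w * (t - real j * h) + \<theta>)" for j
  define x where "x j = X \<omega> (real j * h)" for j
  have c: "continuous_on {0..} (\<lambda>r. cos (w * (t - r) + \<theta>) * X \<omega> r)"
    by (intro continuous_intros cont \<omega>)
  have "grid_error w \<theta> h n \<omega> = (\<Sum>j<n. integral (cell h j) (\<lambda>r. cos (w * (t - r) + \<theta>) * X \<omega> r)
      - (s j - s (Suc j)) / w * x j)"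
    unfolding grid_error_def t_def[symmetric]
  proof (rule sum.cong[OF refl])
    fix j
    have j: "real j * h \<le> real (Suc j) * h" using h by (intro mult_right_mono) auto
    show "integral (cell h j) (\<lambda>r. cos (w * (t - r) + \<theta>) * (X \<omega> r - X \<omega> (real j * h)))
      = integral (cell h j) (\<lambda>r. cos (w * (t - r) + \<theta>) * X \<omega> r) - (s j - s (Suc j)) / w * x j"
      using h by (subst integral_centred[OF \<omega> _ cont_cos])
        (simp_all only: integral_cos_phase[OF j w] s_def x_def mult_nonneg_nonneg of_nat_0_le_iff)
  qed
  also have "\<dots> = integral {0..t} (\<lambda>r. cos (w * (t - r) + \<theta>) * X \<omega> r) - (\<Sum>j<n. (s j - s (Suc j)) / w * x j)"
    using integral_grid_sum[OF c h, of n] by (simp add: sum_subtractf t_def)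
  finally have "w * grid_error w \<theta> h n \<omega> = w * integral {0..t} (\<lambda>r. cos (w * (t - r) + \<theta>) * X \<omega> r)
      - (\<Sum>j<n. (s j - s (Suc j)) * x j)"
    using w by (simp add: right_diff_distrib sum_distrib_left)
  moreover have "grid_sum w \<theta> h n \<omega> - (\<Sum>j<n. (s j - s (Suc j)) * x j) = (\<Sum>j<n. s (Suc j) * x (Suc j) - s j * x j)"
    unfolding grid_sum_def t_def[symmetric] s_def[symmetric] x_def[symmetric] sum_subtractf[symmetric]
    by (rule sum.cong) (auto simp: algebra_simps)
  moreover have "(\<Sum>j<n. s (Suc j) * x (Suc j) - s j * x j) = s n * x n - s 0 * x 0"
    by (rule sum_lessThan_telescope)
  ultimately show ?thesis
    unfolding W_def t_def[symmetric] by (simp add: s_def x_def t_def)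
qed

lemma grid_error_moment:
  assumes "0 \<le> h"
  shows "(\<integral>\<^sup>+\<omega>. ennreal ((grid_error w \<theta> h n \<omega>)\<^sup>2) \<partial>M) \<le> ennreal (2 * real n * h powr (2 + 2*H))"
  using riemann_error[OF order_refl assms cont_cos, of w "real n * h" \<theta> n]
  by (simp add: grid_error_def)

lemma grid_sum_moment:
  assumes "0 \<le> h"
  shows "(\<integral>\<^sup>+\<omega>. ennreal ((grid_sum w \<theta> h n \<omega>)\<^sup>2) \<partial>M) \<le> ennreal (2 * real n * h powr (2*H))"
proof -
  have "real (Suc j) * h = 0 + real j * h + h" "real j * h = 0 + real j * h" for j
    by (auto simp: algebra_simps)
  then have "grid_sum w \<theta> h n \<omega> = (\<Sum>j<n. sin (w * (real n * h - real (Suc j) * h) + \<theta>)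
      * (X \<omega> (0 + real j * h + h) - X \<omega> (0 + real j * h)))" for \<omega>
    unfolding grid_sum_def by metis
  then show ?thesis
    using fbm_weighted_increments[OF prob_space_axioms fbm H assms order_refl order_refl,
        of n "\<lambda>j. sin (w * (real n * h - real (Suc j) * h) + \<theta>)"] by simp
qed

text \<open>The bound is obtained on the grid of mesh \<open>t / \<lceil>w t\<rceil> \<approx> 1 / w\<close>, where both terms of
  \<open>W_grid\<close> have the right size.\<close>

lemma W_moment:
  assumes w: "0 < w0" "w0 \<le> w" and t: "0 \<le> t" "t \<le> T"
  shows "(\<integral>\<^sup>+\<omega>. ennreal ((W w \<theta> \<omega> t)\<^sup>2) \<partial>M) \<le> ennreal (8 * (T + 1 / w0) * w powr (1 - 2*H))"
proof (cases "t = 0")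
  case True
  then show ?thesis by (simp add: W_def)
next
  case False
  have w0: "0 < w" using w by simp
  define n where "n = nat \<lceil>w * t\<rceil>"
  define h where "h = t / n"
  have wt: "0 < w * t" using False t w0 by simp
  have n: "0 < n" "w * t \<le> n" "n \<le> w * t + 1" using wt unfolding n_def by linarith+
  have h: "0 < h" "real n * h = t" using n False t by (auto simp: h_def)
  have wh: "w * h \<le> 1" using n by (simp add: h_def)
  have h_le: "h \<le> 1 / w" using wh w0 by (simp add: field_simps)
  define b where "b = 2 * real n * h powr (2*H)"
  have b: "0 \<le> b" by (simp add: b_def)
  have g: "(\<integral>\<^sup>+\<omega>. ennreal ((w * grid_error w \<theta> h n \<omega>)\<^sup>2) \<partial>M) \<le> ennreal (w\<^sup>2 * (2 * real n * h powr (2 + 2*H)))"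
    by (rule nn_integral_square_scale_le[OF grid_error_meas grid_error_moment]) (use h in auto)
  \<comment> \<open>Because \<open>w * h \<le> 1\<close>, the weighted grid error obeys the same
    bound \<open>b\<close> as the grid sum. Adding the two doubles twice, and \<open>b\<close>
    itself carries a factor 2, whence the constant 8.\<close>
  have "w\<^sup>2 * (2 * real n * h powr (2 + 2*H)) = (w * h)\<^sup>2 * b"
    using h by (simp add: b_def powr_add powr_numeral power_mult_distrib)
  also have "\<dots> \<le> 1 * b"
    using wh w0 h b by (intro mult_right_mono power_le_one) auto
  finally have "(\<integral>\<^sup>+\<omega>. ennreal ((w * grid_error w \<theta> h n \<omega>)\<^sup>2) \<partial>M) \<le> ennreal b"
    using g by (metis ennreal_leI mult_1 order_trans)
  then have "(\<integral>\<^sup>+\<omega>. ennreal ((grid_sum w \<theta> h n \<omega> + w * grid_error w \<theta> h n \<omega>)\<^sup>2) \<partial>M) \<le> ennreal (2 * b + 2 * b)"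
    using h b grid_sum_moment[of h w \<theta> n] grid_error_meas[of h w \<theta> n]
    by (intro nn_integral_square_add_le) (auto simp: b_def)
  then have "(\<integral>\<^sup>+\<omega>. ennreal ((W w \<theta> \<omega> t)\<^sup>2) \<partial>M) \<le> ennreal (2 * b + 2 * b)"
    using W_grid[of _ h w \<theta> n] h w0 by (simp cong: nn_integral_cong)
  also have "\<dots> \<le> ennreal (8 * (T + 1 / w0) * w powr (1 - 2*H))"
  proof (rule ennreal_leI)
    have "h powr (2*H) \<le> (1 / w) powr (2*H)" using h h_le H by (intro powr_mono2) auto
    also have "\<dots> = w powr (- (2*H))" using w0 by (simp add: powr_divide powr_minus_divide)
    finally have "n * h powr (2*H) \<le> (w * t + 1) * w powr (- (2*H))"
      using n by (intro mult_mono) auto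
    also have "(w * t + 1) = (t + 1 / w) * w" using w0 by (simp add: field_simps)
    also have "(t + 1 / w) * w * w powr (- (2*H)) = (t + 1 / w) * w powr (1 - 2*H)"
      using w0 powr_add[of w 1 "- (2*H)"] by simp
    also have "\<dots> \<le> (T + 1 / w0) * w powr (1 - 2*H)"
      using t w by (intro mult_right_mono add_mono divide_left_mono) auto
    finally have "8 * (real n * h powr (2*H)) \<le> 8 * ((T + 1 / w0) * w powr (1 - 2*H))"
      by (intro mult_left_mono) auto
    moreover have "2 * b + 2 * b = 8 * (real n * h powr (2*H))" by (simp add: b_def)
    ultimately show "2 * b + 2 * b \<le> 8 * (T + 1 / w0) * w powr (1 - 2*H)" by (simp only: mult.assoc)
  qed
  finally show ?thesis .
qed

text \<open>Two regimes. If \<open>w * \<tau> \<le> 1\<close>, the Riemann bound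
  \<open>\<tau> powr (1 + 2 * H)\<close> is rewritten with \<open>w\<close> and its exponent lowered
  to \<open>2 * p\<close>. If \<open>w * \<tau> > 1\<close>, the grid does not resolve the
  oscillation: convolution and grid sum are estimated separately, each of squared size
  \<open>w powr (1 - 2 * H)\<close>, and \<open>(w * \<tau>) powr (2 * p) \<ge> 1\<close> comes for
  free.\<close>

lemma scheme_noise_moment:
  assumes w: "0 < w0" "w0 \<le> w" and \<tau>: "0 < \<tau>" "real n * \<tau> \<le> T" and p: "0 \<le> p" "2 * p \<le> 1 + 2 * H"
  shows "(\<integral>\<^sup>+\<omega>. ennreal ((grid_error w 0 \<tau> n \<omega>)\<^sup>2) \<partial>M)
      \<le> ennreal (20 * (T + 1 / w0) * w powr (- 1 - 2*H) * (w * \<tau>) powr (2 * p))"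
proof -
  have w0: "0 < w" using w by simp
  have T: "0 \<le> T" using \<tau> by (meson mult_nonneg_nonneg of_nat_0_le_iff less_imp_le order_trans)
  define C where "C = T + 1 / w0"
  have C: "0 \<le> C" "T \<le> C" using T w by (auto simp: C_def)
  show ?thesis
  proof (cases "w * \<tau> \<le> 1")
    case True
    have pw: "(w * \<tau>) powr (1 + 2*H) \<le> (w * \<tau>) powr (2 * p)"
      using True w0 \<tau> p by (intro powr_le_powr_of_le_one) auto
    have "2 * real n * \<tau> powr (2 + 2*H) = 2 * (n * \<tau>) * \<tau> powr (1 + 2*H)"
      using \<tau> powr_add[of \<tau> 1 "1 + 2*H"] by simp
    also have "\<dots> \<le> 2 * C * \<tau> powr (1 + 2*H)"
      using \<tau> C by (intro mult_right_mono) auto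
    also have "\<tau> powr (1 + 2*H) = w powr (- 1 - 2*H) * (w * \<tau>) powr (1 + 2*H)"
      using w0 \<tau> powr_add[of w "- 1 - 2*H" "1 + 2*H"] by (simp add: powr_mult)
    also have "2 * C * (w powr (- 1 - 2*H) * (w * \<tau>) powr (1 + 2*H))
        \<le> 20 * C * (w powr (- 1 - 2*H) * (w * \<tau>) powr (2 * p))"
      using C by (intro mult_mono[OF _ mult_left_mono[OF pw]]) auto
    finally show ?thesis
      using order_trans[OF grid_error_moment ennreal_leI] \<tau> by (simp add: C_def mult.assoc)
  next
    case False
    have "grid_error w 0 \<tau> n \<omega> = (1 / w) * (W w 0 \<omega> (real n * \<tau>) + (- 1) * grid_sum w 0 \<tau> n \<omega>)" if "\<omega> \<in> space M" for \<omega>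
      using W_grid[OF that, of \<tau> w 0 n] \<tau> w0 by simp
    then have "(\<integral>\<^sup>+\<omega>. ennreal ((grid_error w 0 \<tau> n \<omega>)\<^sup>2) \<partial>M)
       = (\<integral>\<^sup>+\<omega>. ennreal (((1 / w) * (W w 0 \<omega> (real n * \<tau>) + (- 1) * grid_sum w 0 \<tau> n \<omega>))\<^sup>2) \<partial>M)"
      by (simp cong: nn_integral_cong)
    also have "\<dots> \<le> ennreal ((1 / w)\<^sup>2 * (2 * (8 * C * w powr (1 - 2*H)) + 2 * (1 * (2 * C * w powr (1 - 2*H)))))"
    proof (intro nn_integral_square_scale_le nn_integral_square_add_le)
      show "(\<integral>\<^sup>+\<omega>. ennreal ((W w 0 \<omega> (real n * \<tau>))\<^sup>2) \<partial>M) \<le> ennreal (8 * C * w powr (1 - 2*H))"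
        unfolding C_def using \<tau> by (intro W_moment[OF w]) auto
      \<comment> \<open>As \<open>2 * H - 1\<close> is negative and \<open>\<tau> > 1 / w\<close>,
        the coarse grid sum is no larger than one of mesh \<open>1 / w\<close>.\<close>
      have "2 * real n * \<tau> powr (2*H) = 2 * (n * \<tau>) * \<tau> powr (2*H - 1)"
        using \<tau> powr_add[of \<tau> 1 "2*H - 1"] by simp
      also have "\<dots> \<le> 2 * C * (1 / w) powr (2*H - 1)"
        using \<tau> C H False w0 by (intro mult_mono powr_mono2') (auto simp: field_simps)
      also have "(1 / w) powr (2*H - 1) = w powr (1 - 2*H)"
        using w0 by (simp add: powr_divide powr_minus_divide[of w "2*H - 1", symmetric])
      finally show "(\<integral>\<^sup>+\<omega>. ennreal ((grid_sum w 0 \<tau> n \<omega>)\<^sup>2) \<partial>M) \<le> ennreal (2 * C * w powr (1 - 2*H))"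
        using order_trans[OF grid_sum_moment ennreal_leI] \<tau> by simp
    qed (use C in auto)
    also have "\<dots> \<le> ennreal (20 * C * (w powr (- 1 - 2*H) * (w * \<tau>) powr (2 * p)))"
    proof (rule ennreal_leI)
      have "(1 / w)\<^sup>2 * w powr (1 - 2*H) = w powr (- 1 - 2*H)"
      proof -
        have "(1 / w)\<^sup>2 = w powr (- 2)" using w0 by (simp add: powr_minus_divide powr_numeral power_one_over)
        then show ?thesis using powr_add[of w "- 2" "1 - 2*H"] by simp
      qed
      moreover have "1 \<le> (w * \<tau>) powr (2 * p)" using False p by (intro ge_one_powr_ge_zero) auto
      then have "20 * C * (w powr (- 1 - 2*H) * 1) \<le> 20 * C * (w powr (- 1 - 2*H) * (w * \<tau>) powr (2 * p))"
        using C by (intro mult_left_mono) auto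
      ultimately show "(1 / w)\<^sup>2 * (2 * (8 * C * w powr (1 - 2*H)) + 2 * (1 * (2 * C * w powr (1 - 2*H))))
          \<le> 20 * C * (w powr (- 1 - 2*H) * (w * \<tau>) powr (2 * p))"
        by (simp add: algebra_simps)
    qed
    finally show ?thesis by (simp add: C_def mult.assoc)
  qed
qed

text \<open>The past up to \<open>s\<close> is rotated by the angle \<open>w * (t - s)\<close>,
  which mixes \<open>W\<close> with its conjugate component at phase \<open>pi/2\<close>. Centring
  the new integral at \<open>X \<omega> s\<close> absorbs the boundary term.\<close>

lemma W_increment_eq:
  assumes \<omega>: "\<omega> \<in> space M" and st: "0 \<le> s" "s \<le> t" and w: "w \<noteq> 0"
  shows "W w 0 \<omega> t - W w 0 \<omega> s = (cos (w * (t - s)) - 1) * W w 0 \<omega> s + sin (w * (t - s)) * W w (pi/2) \<omega> s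
     + w * integral {s..t} (\<lambda>r. cos (w * (t - r)) * (X \<omega> r - X \<omega> s))"
proof -
  let ?c = "\<lambda>r. cos (w * (s - r)) * X \<omega> r" and ?s = "\<lambda>r. sin (w * (s - r)) * X \<omega> r"
  let ?ct = "\<lambda>r. cos (w * (t - r)) * X \<omega> r"
  have ci: "?c integrable_on {0..s}" "?s integrable_on {0..s}" "?ct integrable_on {0..t}" "?ct integrable_on {0..s}"
    by (intro integrable_continuous_interval continuous_intros cont_on \<omega> order_refl)+
  have split: "integral {0..t} ?ct = integral {0..s} ?ct + integral {s..t} ?ct"
    using Henstock_Kurzweil_Integration.integral_combine[OF st ci(3)] by simp
  have "?ct r = cos (w * (t - s)) * ?c r - sin (w * (t - s)) * ?s r" for r
  proof -
    have "w * (t - r) = w * (t - s) + w * (s - r)" by (simp add: algebra_simps)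
    then show ?thesis by (simp add: cos_add left_diff_distrib mult.assoc)
  qed
  then have "integral {0..s} ?ct = integral {0..s} (\<lambda>r. cos (w * (t - s)) * ?c r - sin (w * (t - s)) * ?s r)"
    by simp
  also have "\<dots> = cos (w * (t - s)) * integral {0..s} ?c - sin (w * (t - s)) * integral {0..s} ?s"
    using ci by (subst Henstock_Kurzweil_Integration.integral_diff) (auto intro!: integrable_cmul[where 'b=real, simplified])
  finally have rot: "integral {0..s} ?ct = \<dots>" .
  have cen: "w * integral {s..t} (\<lambda>r. cos (w * (t - r)) * (X \<omega> r - X \<omega> s)) = w * integral {s..t} ?ct - sin (w * (t - s)) * X \<omega> s"
    using integral_centred[OF \<omega> st(1) cont_cos[of w t 0], of t "X \<omega> s"] integral_cos_phase[OF st(2) w, of t 0] w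
    by (simp add: right_diff_distrib)
  have W2: "W w (pi/2) \<omega> s = X \<omega> s - cos (w * s) * X \<omega> 0 - w * integral {0..s} ?s"
    unfolding W_def by (simp add: sin_add cos_add)
  have "w * t = w * (t - s) + w * s" by (simp add: algebra_simps)
  then have "sin (w * t) = sin (w * (t - s)) * cos (w * s) + cos (w * (t - s)) * sin (w * s)"
    by (metis sin_add)
  then have "sin (w * t) * X \<omega> 0 = (sin (w * (t - s)) * cos (w * s) + cos (w * (t - s)) * sin (w * s)) * X \<omega> 0"
    by simp
  moreover have "W w 0 \<omega> t = - (sin (w * t) * X \<omega> 0) + w * integral {0..t} (\<lambda>r. cos (w * (t - r)) * X \<omega> r)" for t
    unfolding W_def by simp
  ultimately show ?thesis
    unfolding cen W2 by (simp only: split rot) (simp add: algebra_simps)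
qed

text \<open>For \<open>w * (t - s) > 1\<close> the sizes at the two times suffice. Otherwise
  \<open>cos - 1\<close>, \<open>sin\<close> and the new noise all carry a factor
  \<open>w * (t - s)\<close>, whose square is at most its power \<open>2 * p\<close> since
  \<open>p \<le> 1\<close>. The constant is 16 times the 8 of \<open>W_moment\<close>.\<close>

lemma W_increment_moment:
  assumes w: "0 < w0" "w0 \<le> w" and st: "0 \<le> s" "s \<le> t" "t \<le> T" and p: "0 \<le> p" "p \<le> 1"
  shows "(\<integral>\<^sup>+\<omega>. ennreal ((W w 0 \<omega> t - W w 0 \<omega> s)\<^sup>2) \<partial>M)
      \<le> ennreal (128 * (T + 1 / w0) * w powr (1 - 2*H) * (w * (t - s)) powr (2 * p))"
proof (cases "t = s")
  case False
  have w0: "0 < w" using w by simp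
  define h where "h = t - s"
  have h: "0 < h" using False st by (simp add: h_def)
  define B where "B = 8 * (T + 1 / w0) * w powr (1 - 2*H)"
  have B: "0 \<le> B" using st w by (simp add: B_def)
  have WB: "(\<integral>\<^sup>+\<omega>. ennreal ((W w \<theta> \<omega> r)\<^sup>2) \<partial>M) \<le> ennreal B" if "0 \<le> r" "r \<le> T" for \<theta> r
    unfolding B_def by (rule W_moment[OF w that])
  have "(\<integral>\<^sup>+\<omega>. ennreal ((W w 0 \<omega> t - W w 0 \<omega> s)\<^sup>2) \<partial>M) \<le> ennreal (16 * B * (w * h) powr (2 * p))"
  proof (cases "w * h \<le> 1")
    case False
    have "(\<integral>\<^sup>+\<omega>. ennreal ((W w 0 \<omega> t + (- 1) * W w 0 \<omega> s)\<^sup>2) \<partial>M) \<le> ennreal (2 * B + 2 * (1 * B))"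
      using st B by (intro nn_integral_square_add_le nn_integral_square_scale_le WB) auto
    also have "\<dots> \<le> ennreal (16 * B * (w * h) powr (2 * p))"
    proof (rule ennreal_leI)
      have "1 \<le> (w * h) powr (2 * p)" using False p by (intro ge_one_powr_ge_zero) auto
      then have "16 * B * 1 \<le> 16 * B * (w * h) powr (2 * p)" using B by (intro mult_left_mono) auto
      then show "2 * B + 2 * (1 * B) \<le> 16 * B * (w * h) powr (2 * p)" using B by simp
    qed
    finally show ?thesis by simp
  next
    case True
    define R where "R \<omega> = integral {s..t} (\<lambda>r. cos (w * (t - r)) * (X \<omega> r - X \<omega> s))" for \<omega>
    have Rm[measurable]: "R \<in> borel_measurable M"
      unfolding R_def using meas_integral_centred[OF st(1) cont_cos[of w t 0]] by simp
    \<comment> \<open>The Riemann error with a single cell.\<close>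
    have R: "(\<integral>\<^sup>+\<omega>. ennreal ((R \<omega>)\<^sup>2) \<partial>M) \<le> ennreal (2 * h powr (2 + 2*H))"
      using riemann_error[OF st(1) less_imp_le[OF h] cont_cos[of w t 0], of 1] by (simp add: R_def h_def)
    have wh: "0 \<le> w * h" using w0 h by simp
    have "\<bar>cos (w * h) - 1\<bar> \<le> w * h"
    proof -
      have "cos (w * h) = 1 - 2 * (sin (w * h / 2))\<^sup>2" using cos_double_sin[of "w * h / 2"] by simp
      moreover have "(sin (w * h / 2))\<^sup>2 \<le> \<bar>sin (w * h / 2)\<bar> * 1"
        by (subst power2_abs[symmetric], subst power2_eq_square) (intro mult_left_mono, auto)
      moreover have "\<bar>sin (w * h / 2)\<bar> \<le> w * h / 2" using abs_sin_x_le_abs_x[of "w * h / 2"] wh by simp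
      ultimately show ?thesis using zero_le_power2[of "sin (w * h / 2)"] by linarith
    qed
    then have c: "(cos (w * h) - 1)\<^sup>2 \<le> (w * h)\<^sup>2" using wh by (simp add: abs_le_square_iff[symmetric])
    have s: "(sin (w * h))\<^sup>2 \<le> (w * h)\<^sup>2"
      using abs_sin_x_le_abs_x[of "w * h"] by (simp add: abs_le_square_iff[symmetric])
    have "(\<integral>\<^sup>+\<omega>. ennreal (((cos (w * h) - 1) * W w 0 \<omega> s + sin (w * h) * W w (pi/2) \<omega> s + w * R \<omega>)\<^sup>2) \<partial>M)
       \<le> ennreal (2 * (2 * ((w * h)\<^sup>2 * B) + 2 * ((w * h)\<^sup>2 * B)) + 2 * (w\<^sup>2 * (2 * h powr (2 + 2*H))))"
      using st B c s by (intro nn_integral_square_add_le nn_integral_square_scale_le WB R) auto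
    then have "(\<integral>\<^sup>+\<omega>. ennreal ((W w 0 \<omega> t - W w 0 \<omega> s)\<^sup>2) \<partial>M)
       \<le> ennreal (2 * (2 * ((w * h)\<^sup>2 * B) + 2 * ((w * h)\<^sup>2 * B)) + 2 * (w\<^sup>2 * (2 * h powr (2 + 2*H))))"
      using W_increment_eq[OF _ st(1,2), of _ w] w0 by (simp add: R_def h_def cong: nn_integral_cong)
    also have "\<dots> \<le> ennreal (16 * B * (w * h) powr (2 * p))"
    proof (rule ennreal_leI)
      \<comment> \<open>Here \<open>h \<le> 1 / w\<close> makes the fresh noise no larger than the
        bound \<open>B\<close> for the convolution itself.\<close>
      have "h powr (2*H) \<le> (1 / w) powr (2*H)" using h H True w0 by (intro powr_mono2) (auto simp: field_simps)
      also have "\<dots> = (1 / w) * w powr (1 - 2*H)"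
        using w0 powr_add[of w "- 1" "1 - 2*H"] by (simp add: powr_divide powr_minus_divide)
      also have "\<dots> \<le> (T + 1 / w0) * w powr (1 - 2*H)"
        using w st by (intro mult_right_mono) (auto intro!: divide_left_mono add_increasing)
      finally have "8 * h powr (2*H) \<le> 8 * ((T + 1 / w0) * w powr (1 - 2*H))" by (intro mult_left_mono) auto
      then have "8 * h powr (2*H) \<le> B" by (simp only: B_def mult.assoc)
      then have 1: "(w * h)\<^sup>2 * (8 * h powr (2*H)) \<le> (w * h)\<^sup>2 * B" by (intro mult_left_mono) auto
      have 2: "w\<^sup>2 * (2 * h powr (2 + 2*H)) = (w * h)\<^sup>2 * (2 * h powr (2*H))"
        using h by (simp add: powr_add powr_numeral power_mult_distrib)
      have 3: "0 \<le> (w * h)\<^sup>2 * B" using B by simp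
      have "2 * (2 * ((w * h)\<^sup>2 * B) + 2 * ((w * h)\<^sup>2 * B)) + 2 * (w\<^sup>2 * (2 * h powr (2 + 2*H)))
          = 8 * ((w * h)\<^sup>2 * B) + ((w * h)\<^sup>2 * (8 * h powr (2*H))) / 2"
        unfolding 2 by simp
      also have "\<dots> \<le> 16 * ((w * h)\<^sup>2 * B)" using 1 3 by linarith
      also have "\<dots> = 16 * B * (w * h)\<^sup>2" by simp
      finally have "2 * (2 * ((w * h)\<^sup>2 * B) + 2 * ((w * h)\<^sup>2 * B)) + 2 * (w\<^sup>2 * (2 * h powr (2 + 2*H)))
          \<le> 16 * B * (w * h)\<^sup>2" .
      also have "16 * B * (w * h)\<^sup>2 \<le> 16 * B * (w * h) powr (2 * p)"
      proof (intro mult_left_mono)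
        have "(w * h)\<^sup>2 = (w * h) powr 2" using w0 h by (simp add: powr_numeral)
        also have "\<dots> \<le> (w * h) powr (2 * p)"
          using True w0 h p by (intro powr_le_powr_of_le_one) auto
        finally show "(w * h)\<^sup>2 \<le> (w * h) powr (2 * p)" .
      qed (use B in auto)
      finally show "2 * (2 * ((w * h)\<^sup>2 * B) + 2 * ((w * h)\<^sup>2 * B)) + 2 * (w\<^sup>2 * (2 * h powr (2 + 2*H)))
          \<le> 16 * B * (w * h) powr (2 * p)" .
    qed
    finally show ?thesis .
  qed
  moreover have "16 * B * (w * h) powr (2 * p) = 128 * (T + 1 / w0) * w powr (1 - 2*H) * (w * (t - s)) powr (2 * p)"
    unfolding B_def h_def by simp
  ultimately show ?thesis by (simp only:)
qed simp

lemma continuous_on_integral_max: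
  fixes f :: "real \<Rightarrow> real"
  assumes "continuous_on {0..} f"
  shows "continuous_on UNIV (\<lambda>t. integral {0..max 0 t} f)"
proof (rule continuous_at_imp_continuous_on, rule ballI)
  fix t :: real
  define b where "b = \<bar>t\<bar> + 1"
  have "continuous_on {0..b} (\<lambda>t. integral {0..t} f)"
    by (intro indefinite_integral_continuous_1 integrable_continuous_interval continuous_on_subset[OF assms]) auto
  then have "continuous_on {-b..b} (\<lambda>t. integral {0..max 0 t} f)"
    by (rule continuous_on_compose2) (auto intro!: continuous_intros simp: b_def)
  then show "isCont (\<lambda>t. integral {0..max 0 t} f) t"
    by (rule continuous_on_interior) (auto simp: b_def interior_atLeastAtMost_real)
qed

text \<open>The kernel depends on the upper limit \<open>t\<close>. The addition formula moves
  \<open>t\<close> out of the integral and leaves two indefinite integrals, so \<open>W\<close> is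
  continuous in time.\<close>

lemma W_joint_meas:
  assumes [measurable]: "f \<in> N \<rightarrow>\<^sub>M M" "g \<in> borel_measurable N"
  shows "(\<lambda>x. W w \<theta> (f x) (max 0 (g x))) \<in> borel_measurable N"
proof -
  have "continuous_on UNIV (\<lambda>t. W w \<theta> \<omega> (max 0 t))" if \<omega>: "\<omega> \<in> space M" for \<omega>
  proof -
    have i: "integral {0..t} (\<lambda>r. cos (w * (t - r) + \<theta>) * X \<omega> r)
      = cos (w * t + \<theta>) * integral {0..t} (\<lambda>r. cos (w * r) * X \<omega> r)
        + sin (w * t + \<theta>) * integral {0..t} (\<lambda>r. sin (w * r) * X \<omega> r)" for t
    proof -
      have "cos (w * (t - r) + \<theta>) * X \<omega> r = cos (w * t + \<theta>) * (cos (w * r) * X \<omega> r) + sin (w * t + \<theta>) * (sin (w * r) * X \<omega> r)" for r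
      proof -
        have "w * (t - r) + \<theta> = (w * t + \<theta>) - w * r" by (simp add: algebra_simps)
        then show ?thesis by (simp add: cos_diff algebra_simps)
      qed
      moreover have "(\<lambda>r. cos (w * r) * X \<omega> r) integrable_on {0..t}" "(\<lambda>r. sin (w * r) * X \<omega> r) integrable_on {0..t}"
        by (intro integrable_continuous_interval continuous_intros cont_on \<omega> order_refl)+
      ultimately show ?thesis
        by (simp add: Henstock_Kurzweil_Integration.integral_add integrable_cmul[where 'b=real, simplified])
    qed
    have "continuous_on {0..} (\<lambda>r. cos (w * r) * X \<omega> r)" "continuous_on {0..} (\<lambda>r. sin (w * r) * X \<omega> r)"
      by (intro continuous_intros cont \<omega>)+
    note this[THEN continuous_on_integral_max]
    then show ?thesis
      unfolding W_def i by (intro continuous_intros cont_max[OF \<omega>])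
  qed
  then have J: "(\<lambda>p. W w \<theta> (fst p) (max 0 (snd p))) \<in> borel_measurable (M \<Otimes>\<^sub>M borel)"
    by (intro measurable_continuous_process[of "\<lambda>\<omega> r. W w \<theta> \<omega> (max 0 r)"]) auto
  have "(\<lambda>x. (f x, g x)) \<in> N \<rightarrow>\<^sub>M M \<Otimes>\<^sub>M borel" by measurable
  from measurable_compose[OF this J] show ?thesis by simp
qed

end

section \<open>The error recursion for a fixed path\<close>

lemma id_borel_measurable_lebesgue[measurable]: "(\<lambda>x::real. x) \<in> borel_measurable lebesgue"
  by (rule measurable_completion) simp

text \<open>The coefficients of the nonlinearity are only known to be measurable and bounded in
  time, so integrability has to come from these two properties rather than from continuity.\<close>

lemma
  fixes f :: "real \<Rightarrow> real"
  assumes f: "f \<in> borel_measurable lebesgue" and K: "\<And>r. r \<in> {a..b} \<Longrightarrow> \<bar>f r\<bar> \<le> K"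
  shows integrable_lebesgue_on_bounded: "integrable (lebesgue_on {a..b}) f"
    and integrable_on_bounded: "f integrable_on {a..b}"
proof -
  interpret finite_measure "lebesgue_on {a..b}"
    by (rule finite_measure_lebesgue_on) simp
  show i: "integrable (lebesgue_on {a..b}) f"
    using f K by (intro integrable_const_bound[where B=K] AE_I2 measurable_restrict_space1)
      (auto simp: space_restrict_space)
  show "f integrable_on {a..b}"
    using has_integral_integral_lebesgue_on[OF i] by auto
qed

lemma nn_integral_grid_sum:
  assumes f[measurable]: "f \<in> borel_measurable lebesgue" and h: "(0::real) \<le> h"
  shows "(\<Sum>j<n. \<integral>\<^sup>+r\<in>cell h j. f r \<partial>lebesgue) = (\<integral>\<^sup>+r\<in>{0..real n * h}. f r \<partial>lebesgue)"
proof (induction n)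
  case 0
  have "AE x in lebesgue. x \<noteq> (0::real)" by (intro AE_completion AE_lborel_singleton)
  then have "(\<integral>\<^sup>+r\<in>{0..0}. f r \<partial>lebesgue) = (\<integral>\<^sup>+r. 0 \<partial>(lebesgue :: real measure))"
    by (intro nn_integral_cong_AE) (auto elim!: eventually_mono simp: indicator_def)
  then show ?case by simp
next
  case (Suc n)
  let ?I = "\<lambda>s t. indicator {s..t} :: real \<Rightarrow> ennreal"
  have le: "real n * h \<le> real (Suc n) * h" "0 \<le> real n * h"
    using h by (auto intro!: mult_right_mono)
  have "AE x in lebesgue. x \<noteq> real n * h" by (intro AE_completion AE_lborel_singleton)
  then have "(\<integral>\<^sup>+r\<in>{0..real (Suc n) * h}. f r \<partial>lebesgue)
      = (\<integral>\<^sup>+r. f r * ?I 0 (real n * h) r + f r * ?I (real n * h) (real (Suc n) * h) r \<partial>lebesgue)"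
    using le by (intro nn_integral_cong_AE) (auto elim!: eventually_mono simp: indicator_def)
  also have "\<dots> = (\<integral>\<^sup>+r\<in>{0..real n * h}. f r \<partial>lebesgue) + (\<integral>\<^sup>+r\<in>cell h n. f r \<partial>lebesgue)"
    by (intro nn_integral_add) measurable
  finally show ?case using Suc by simp
qed

lemma abs_sin_diff_le: "\<bar>sin x - sin y\<bar> \<le> \<bar>x - y\<bar>" for x y :: real
proof -
  have "\<bar>sin x - sin y\<bar> = 2 * (\<bar>sin ((x - y) / 2)\<bar> * \<bar>cos ((x + y) / 2)\<bar>)"
    by (simp add: sin_diff_sin abs_mult)
  also have "\<dots> \<le> 2 * (\<bar>(x - y) / 2\<bar> * 1)"
    by (intro mult_left_mono mult_mono abs_sin_x_le_abs_x) auto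
  finally show ?thesis by simp
qed

lemma abs_cos_diff_le: "\<bar>cos x - cos y\<bar> \<le> \<bar>x - y\<bar>" for x y :: real
  using abs_sin_diff_le[of "x + pi/2" "y + pi/2"] by (simp add: sin_add)

text \<open>Interpolation between \<open>\<bar>d\<bar> \<le> x\<close>, which is sharp for small
  \<open>x\<close>, and \<open>\<bar>d\<bar> \<le> 2\<close>. It turns powers of smoothness of the
  data into powers of the time step.\<close>

lemma square_le_4_powr:
  fixes d x p :: real
  assumes d: "\<bar>d\<bar> \<le> 2" "\<bar>d\<bar> \<le> x" and p: "0 \<le> p" "p \<le> 1"
  shows "d\<^sup>2 \<le> 4 * x powr (2 * p)"
proof (cases "x \<le> 1")
  case True
  show ?thesis
  \<comment> \<open>\<open>0 powr (2 * p)\<close> is 0 even for \<open>p = 0\<close>; then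
    \<open>d\<close> vanishes too.\<close>
  proof (cases "x = 0")
    case False
    then have x: "0 < x" using d by linarith
    have "d\<^sup>2 \<le> x\<^sup>2" using d by (simp add: abs_le_square_iff[symmetric])
    also have "\<dots> = x powr 2" using x by (simp add: powr_numeral)
    also have "\<dots> \<le> x powr (2 * p)" using x True p by (intro powr_le_powr_of_le_one) auto
    finally show ?thesis using powr_ge_zero[of x "2 * p"] by linarith
  qed (use d in auto)
next
  case False
  have "d\<^sup>2 \<le> 2\<^sup>2" by (intro abs_le_square_iff[THEN iffD1]) (use d in auto)
  moreover have "1 \<le> x powr (2 * p)" using False p by (intro ge_one_powr_ge_zero) auto
  ultimately show ?thesis by simp
qed

text \<open>The derivative of \<open>\<Psi>\<close> has the sign of
  \<open>\<Phi> - (A + B * \<integral> \<Phi>)\<close>, hence is nonpositive.\<close>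

lemma gronwall_continuous:
  fixes \<Phi> :: "real \<Rightarrow> real"
  assumes c: "continuous_on {0..T} \<Phi>" and B: "0 \<le> B"
    and le: "\<And>t. t \<in> {0..T} \<Longrightarrow> \<Phi> t \<le> A + B * integral {0..t} \<Phi>" and t: "t \<in> {0..T}"
  shows "\<Phi> t \<le> A * exp (B * t)"
proof -
  define \<Psi> where "\<Psi> s = (A + B * integral {0..s} \<Phi>) * exp (- B * s)" for s
  have "\<Psi> t \<le> \<Psi> 0"
  proof (rule DERIV_nonpos_imp_decreasing_open[of 0 t \<Psi>])
    show "0 \<le> t" using t by simp
    show "continuous_on {0..t} \<Psi>" unfolding \<Psi>_def
      using t by (intro continuous_intros indefinite_integral_continuous_1 integrable_continuous_interval
          continuous_on_subset[OF c]) auto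
    fix s assume s: "0 < s" "s < t"
    have "((\<lambda>s. integral {0..s} \<Phi>) has_real_derivative \<Phi> s) (at s within {0..T})"
      using s t by (intro integral_has_real_derivative c) auto
    then have "((\<lambda>s. integral {0..s} \<Phi>) has_real_derivative \<Phi> s) (at s)"
      using s t at_within_Icc_at[of 0 s T] by simp
    then have "(\<Psi> has_real_derivative B * \<Phi> s * exp (- B * s) + (A + B * integral {0..s} \<Phi>) * (- B * exp (- B * s))) (at s)"
      unfolding \<Psi>_def by (auto intro!: derivative_eq_intros)
    moreover have "B * \<Phi> s * exp (- B * s) + (A + B * integral {0..s} \<Phi>) * (- B * exp (- B * s))
        = B * exp (- B * s) * (\<Phi> s - (A + B * integral {0..s} \<Phi>))" by (simp add: algebra_simps)
    moreover have "\<dots> \<le> 0"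
      using le[of s] s t B by (intro mult_nonneg_nonpos) auto
    ultimately show "\<exists>y. (\<Psi> has_real_derivative y) (at s) \<and> y \<le> 0" by auto
  qed
  then have "A + B * integral {0..t} \<Phi> \<le> A * exp (B * t)"
    by (simp add: \<Psi>_def exp_minus field_simps)
  then show ?thesis using le[OF t] by linarith
qed

text \<open>The inequality is integrated once before applying the continuous version, since
  \<open>\<phi>\<close> itself is merely measurable.\<close>

lemma gronwall_nn_integral:
  fixes \<phi> \<alpha> :: "real \<Rightarrow> ennreal"
  assumes [measurable]: "\<phi> \<in> borel_measurable lebesgue" "\<alpha> \<in> borel_measurable lebesgue"
    and K: "\<And>r. r \<in> {0..T} \<Longrightarrow> \<phi> r \<le> ennreal K" and B: "0 \<le> B" and T: "0 \<le> T"
    and le: "\<And>r. r \<in> {0..T} \<Longrightarrow> \<phi> r \<le> \<alpha> r + ennreal B * (\<integral>\<^sup>+s\<in>{0..r}. \<phi> s \<partial>lebesgue)"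
  shows "(\<integral>\<^sup>+r\<in>{0..T}. \<phi> r \<partial>lebesgue) \<le> ennreal (exp (B * T)) * (\<integral>\<^sup>+r\<in>{0..T}. \<alpha> r \<partial>lebesgue)"
proof (cases "(\<integral>\<^sup>+r\<in>{0..T}. \<alpha> r \<partial>lebesgue) = \<infinity>")
  case True
  then show ?thesis by (simp add: ennreal_mult_top)
next
  case False
  define A where "A = enn2real (\<integral>\<^sup>+r\<in>{0..T}. \<alpha> r \<partial>lebesgue)"
  have A: "ennreal A = (\<integral>\<^sup>+r\<in>{0..T}. \<alpha> r \<partial>lebesgue)" using False by (simp add: A_def less_top)
  define f where "f r = enn2real (\<phi> r)" for r
  have f: "ennreal (f r) = \<phi> r" if "r \<in> {0..T}" for r
    using le_less_trans[OF K[OF that] ennreal_less_top] by (simp add: f_def)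
  have fK: "\<bar>f r\<bar> \<le> max 0 K" if "r \<in> {0..T}" for r
    using enn2real_mono[OF K[OF that]] by (auto simp: f_def enn2real_ennreal max_def enn2real_nonneg not_le ennreal_neg)
  have [measurable]: "f \<in> borel_measurable lebesgue" unfolding f_def by measurable
  define \<Phi> where "\<Phi> t = integral {0..t} f" for t
  have \<Phi>: "ennreal (\<Phi> t) = (\<integral>\<^sup>+r\<in>{0..t}. \<phi> r \<partial>lebesgue)" if "t \<in> {0..T}" for t
  proof -
    have i: "integrable (lebesgue_on {0..t}) f"
      using fK that by (intro integrable_lebesgue_on_bounded[where K="max 0 K"]) auto
    have "ennreal (\<Phi> t) = (\<integral>\<^sup>+r. ennreal (f r) \<partial>lebesgue_on {0..t})"
      unfolding \<Phi>_def lebesgue_integral_eq_integral[OF i, symmetric, simplified]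
      by (rule nn_integral_eq_integral[OF i, symmetric]) (simp add: f_def)
    also have "\<dots> = (\<integral>\<^sup>+r\<in>{0..t}. ennreal (f r) \<partial>lebesgue)"
      by (rule nn_integral_restrict_space) simp
    also have "\<dots> = (\<integral>\<^sup>+r\<in>{0..t}. \<phi> r \<partial>lebesgue)"
      using that f by (intro nn_integral_cong) (auto simp: indicator_def)
    finally show ?thesis .
  qed
  have c: "continuous_on {0..T} \<Phi>" unfolding \<Phi>_def
    by (intro indefinite_integral_continuous_1 integrable_on_bounded[where K="max 0 K"] fK) auto
  have \<Phi>0: "0 \<le> \<Phi> t" for t
    unfolding \<Phi>_def by (cases "f integrable_on {0..t}")
      (auto intro!: integral_nonneg simp: f_def enn2real_nonneg not_integrable_integral)
  have "\<Phi> t \<le> A + B * integral {0..t} \<Phi>" if t: "t \<in> {0..T}" for t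
  proof -
    have ct: "continuous_on {0..t} \<Phi>" using t by (intro continuous_on_subset[OF c]) auto
    have i: "integrable (lebesgue_on {0..t}) \<Phi>" by (rule continuous_imp_integrable_real[OF ct])
    have "ennreal (\<Phi> t) \<le> (\<integral>\<^sup>+r. \<alpha> r * indicator {0..t} r + ennreal B * (ennreal (\<Phi> r) * indicator {0..t} r) \<partial>lebesgue)"
      unfolding \<Phi>[OF t]
    proof (rule nn_integral_mono)
      fix r :: real
      show "\<phi> r * indicator {0..t} r \<le> \<alpha> r * indicator {0..t} r + ennreal B * (ennreal (\<Phi> r) * indicator {0..t} r)"
        using le[of r] \<Phi>[of r] t by (auto simp: indicator_def)
    qed
    also have "\<dots> = (\<integral>\<^sup>+r\<in>{0..t}. \<alpha> r \<partial>lebesgue) + ennreal B * (\<integral>\<^sup>+r\<in>{0..t}. ennreal (\<Phi> r) \<partial>lebesgue)"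
    proof -
      have "(\<lambda>r. \<Phi> r * indicator {0..t} r) \<in> borel_measurable lebesgue"
        using borel_measurable_integrable[OF i] by (simp add: borel_measurable_restrict_space_iff mult.commute)
      then have "(\<lambda>r. ennreal (\<Phi> r * indicator {0..t} r)) \<in> borel_measurable lebesgue" by measurable
      moreover have "ennreal (\<Phi> r * indicator {0..t} r) = ennreal (\<Phi> r) * indicator {0..t} r" for r
        by (simp add: indicator_def)
      ultimately have [measurable]: "(\<lambda>r. ennreal (\<Phi> r) * indicator {0..t} r) \<in> borel_measurable lebesgue" by simp
      show ?thesis by (simp add: nn_integral_add nn_integral_cmult)
    qed
    also have "(\<integral>\<^sup>+r\<in>{0..t}. ennreal (\<Phi> r) \<partial>lebesgue) = ennreal (integral {0..t} \<Phi>)"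
      unfolding lebesgue_integral_eq_integral[OF i, symmetric, simplified]
      by (subst nn_integral_restrict_space[symmetric], simp)
        (rule nn_integral_eq_integral[OF i], simp add: \<Phi>0)
    also have "(\<integral>\<^sup>+r\<in>{0..t}. \<alpha> r \<partial>lebesgue) \<le> ennreal A"
      unfolding A using t by (intro nn_integral_mono) (auto simp: indicator_def)
    finally have "ennreal (\<Phi> t) \<le> ennreal A + ennreal B * ennreal (integral {0..t} \<Phi>)"
      by (simp add: add_right_mono)
    moreover have "0 \<le> integral {0..t} \<Phi>" by (intro integral_nonneg integrable_continuous_interval ct \<Phi>0)
    ultimately show ?thesis
      using B by (simp add: A_def ennreal_mult[symmetric] ennreal_plus[symmetric] del: ennreal_plus)
  qed
  then have "\<Phi> T \<le> A * exp (B * T)" using T by (intro gronwall_continuous[OF c B]) auto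
  then have "ennreal (\<Phi> T) \<le> ennreal (A * exp (B * T))" by (rule ennreal_leI)
  then show ?thesis
    using T ennreal_mult'[of "exp (B * T)" A] by (simp add: \<Phi> A mult.commute)
qed

text \<open>Three sources of error: the kernel moves by at most \<open>\<tau>\<close> in a cell,
  \<open>F\<close> oscillates in a cell, and the scheme evaluates \<open>Fd j\<close> instead of
  \<open>F\<close> at the grid point. The kernel is 1-Lipschitz and bounded by \<open>T\<close>
  independently of \<open>w\<close>, so the estimate may later be summed over all modes.\<close>

lemma convolution_quadrature_error:
  fixes w T \<tau> K :: real and F :: "real \<Rightarrow> real"
  assumes w: "0 < w" and F[measurable]: "F \<in> borel_measurable lebesgue"
    and K: "\<And>r. r \<in> {0..T} \<Longrightarrow> \<bar>F r\<bar> \<le> K" and \<tau>: "0 < \<tau>" "real n * \<tau> \<le> T"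
  shows "ennreal ((integral {0..real n * \<tau>} (\<lambda>r. sin (w * (real n * \<tau> - r)) / w * F r)
      - (\<Sum>j<n. \<tau> * (sin (w * (real n * \<tau> - real j * \<tau>)) / w) * Fd j))\<^sup>2)
    \<le> ennreal (3 * T) * (\<Sum>j<n. ennreal (\<tau>\<^sup>2) * (\<integral>\<^sup>+r\<in>cell \<tau> j. ennreal ((F r)\<^sup>2) \<partial>lebesgue)
        + ennreal (T\<^sup>2) * (\<integral>\<^sup>+r\<in>cell \<tau> j. ennreal ((F r - F (real j * \<tau>))\<^sup>2) \<partial>lebesgue)
        + ennreal (T\<^sup>2 * \<tau>) * ennreal ((F (real j * \<tau>) - Fd j)\<^sup>2))"
proof -
  define t where "t = real n * \<tau>"
  define s where "s x = sin (w * x) / w" for x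
  have s: "\<bar>s x - s y\<bar> \<le> \<bar>x - y\<bar>" for x y
  proof -
    have "\<bar>s x - s y\<bar> = \<bar>sin (w * x) - sin (w * y)\<bar> / w" using w by (simp add: s_def diff_divide_distrib[symmetric])
    also have "\<dots> \<le> \<bar>w * x - w * y\<bar> / w" using w by (intro divide_right_mono abs_sin_diff_le) auto
    also have "\<dots> = \<bar>x - y\<bar>" using w by (simp add: right_diff_distrib[symmetric] abs_mult)
    finally show ?thesis .
  qed
  have s': "\<bar>s x\<bar> \<le> \<bar>x\<bar>" for x using s[of x 0] by (simp add: s_def)
  have sm[measurable]: "s \<in> borel_measurable borel" unfolding s_def by measurable
  have cs: "continuous_on UNIV s" unfolding s_def using w by (intro continuous_intros) auto
  have stm[measurable]: "(\<lambda>r. s (t - r)) \<in> borel_measurable lebesgue" by measurable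
  have T: "0 \<le> T" using \<tau> by (meson mult_nonneg_nonneg of_nat_0_le_iff less_imp_le order_trans)
  have grid: "real j * \<tau> \<in> {0..t}" "real (Suc j) * \<tau> \<in> {0..t}" "real j * \<tau> \<le> real (Suc j) * \<tau>" if "j < n" for j
  proof -
    have "real (Suc j) \<le> real n" using that by simp
    then show "real j * \<tau> \<in> {0..t}" "real (Suc j) * \<tau> \<in> {0..t}" "real j * \<tau> \<le> real (Suc j) * \<tau>"
      using \<tau> that by (auto simp: t_def intro!: mult_right_mono simp del: of_nat_Suc)
  qed
  have tT: "t \<le> T" "0 \<le> t" using \<tau> by (auto simp: t_def)
  define g where "g j r = s (t - r) * F r - s (t - real j * \<tau>) * Fd j" for j r
  have gm[measurable]: "g j \<in> borel_measurable lebesgue" for j unfolding g_def by measurable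
  have sF: "\<bar>s (t - r) * F r\<bar> \<le> T * K" if "r \<in> {0..t}" for r
    unfolding abs_mult using that tT K[of r] s'[of "t - r"] T by (intro mult_mono) auto
  have gi: "integrable (lebesgue_on (cell \<tau> j)) (g j)" if "j < n" for j
  proof (rule integrable_lebesgue_on_bounded[OF gm])
    fix r assume "r \<in> (cell \<tau> j)"
    then have "r \<in> {0..t}" using grid[OF that] by auto
    then show "\<bar>g j r\<bar> \<le> T * K + \<bar>s (t - real j * \<tau>) * Fd j\<bar>"
      unfolding g_def using sF[of r] by linarith
  qed
  have split: "integral {0..real m * \<tau>} (\<lambda>r. s (t - r) * F r)
      = (\<Sum>j<m. integral (cell \<tau> j) (\<lambda>r. s (t - r) * F r))" if "m \<le> n" for m
    using that
  proof (induction m)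
    case (Suc m)
    have m: "m < n" using Suc by simp
    have "(\<lambda>r. s (t - r) * F r) integrable_on {0..real (Suc m) * \<tau>}"
      using grid[OF m] by (intro integrable_on_bounded[where K="T * K"] sF) auto
    from Henstock_Kurzweil_Integration.integral_combine[OF _ _ this, of "real m * \<tau>"]
    show ?case using Suc grid[OF m] by simp
  qed simp
  have cell: "integral (cell \<tau> j) (\<lambda>r. s (t - r) * F r) - \<tau> * s (t - real j * \<tau>) * Fd j
      = integral (cell \<tau> j) (g j)" if j: "j < n" for j
  proof -
    have "(\<lambda>r. s (t - r) * F r) integrable_on (cell \<tau> j)"
      using grid[OF j] by (intro integrable_on_bounded[where K="T * K"] sF) auto
    then have "integral (cell \<tau> j) (g j)
        = integral (cell \<tau> j) (\<lambda>r. s (t - r) * F r)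
          - integral (cell \<tau> j) (\<lambda>r. s (t - real j * \<tau>) * Fd j)"
      unfolding g_def by (intro Henstock_Kurzweil_Integration.integral_diff) auto
    then show ?thesis using grid[OF j] by (simp add: algebra_simps)
  qed
  have "integral {0..t} (\<lambda>r. s (t - r) * F r) - (\<Sum>j<n. \<tau> * s (t - real j * \<tau>) * Fd j)
      = (\<Sum>j<n. integral (cell \<tau> j) (g j))" (is "?E = _")
    using split[of n] cell by (simp add: t_def[symmetric] sum_subtractf[symmetric])
  \<comment> \<open>Cauchy-Schwarz over the cells costs a factor \<open>n\<close> and inside each
    cell contributes \<open>\<tau>\<close>; together they stay below \<open>T\<close>.\<close>
  then have "?E\<^sup>2 \<le> (\<Sum>j<n. (integral (cell \<tau> j) (g j))\<^sup>2) * real n"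
    using sum_squared_le_sum_of_squares[of "\<lambda>j. integral (cell \<tau> j) (g j)" "{..<n}"] by simp
  then have "ennreal (?E\<^sup>2) \<le> ennreal (real n * (\<Sum>j<n. (integral (cell \<tau> j) (g j))\<^sup>2))"
    by (intro ennreal_leI) (simp add: mult.commute)
  also have "\<dots> = ennreal (real n) * (\<Sum>j<n. ennreal ((integral (cell \<tau> j) (g j))\<^sup>2))"
    by (simp add: ennreal_mult sum_nonneg sum_ennreal)
  also have "\<dots> \<le> ennreal (real n) * (\<Sum>j<n. ennreal \<tau> * (\<integral>\<^sup>+r\<in>cell \<tau> j. ennreal ((g j r)\<^sup>2) \<partial>lebesgue))"
  proof (intro mult_left_mono sum_mono)
    fix j assume "j \<in> {..<n}"
    then have j: "j < n" by simp
    have "real (Suc j) * \<tau> - real j * \<tau> = \<tau>" by (simp add: algebra_simps)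
    then show "ennreal ((integral (cell \<tau> j) (g j))\<^sup>2)
        \<le> ennreal \<tau> * (\<integral>\<^sup>+r\<in>cell \<tau> j. ennreal ((g j r)\<^sup>2) \<partial>lebesgue)"
      using integral_square_le[OF gi[OF j]] grid[OF j] by (simp add: nn_integral_completion)
  qed simp
  also have "\<dots> = ennreal (real n * \<tau>) * (\<Sum>j<n. \<integral>\<^sup>+r\<in>cell \<tau> j. ennreal ((g j r)\<^sup>2) \<partial>lebesgue)"
    using \<tau> by (simp add: sum_distrib_left[symmetric] ennreal_mult mult.assoc)
  also have "\<dots> \<le> ennreal T * (\<Sum>j<n. 3 * (ennreal (\<tau>\<^sup>2) * (\<integral>\<^sup>+r\<in>cell \<tau> j. ennreal ((F r)\<^sup>2) \<partial>lebesgue)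
        + ennreal (T\<^sup>2) * (\<integral>\<^sup>+r\<in>cell \<tau> j. ennreal ((F r - F (real j * \<tau>))\<^sup>2) \<partial>lebesgue)
        + ennreal (T\<^sup>2 * \<tau>) * ennreal ((F (real j * \<tau>) - Fd j)\<^sup>2)))"
  proof (intro mult_mono sum_mono ennreal_leI)
    fix j assume "j \<in> {..<n}"
    then have j: "j < n" by simp
    let ?a = "real j * \<tau>" and ?b = "real (Suc j) * \<tau>"
    let ?I = "indicator (cell \<tau> j) :: real \<Rightarrow> ennreal"
    have gle: "(g j r)\<^sup>2 \<le> 3 * (\<tau>\<^sup>2 * (F r)\<^sup>2 + T\<^sup>2 * (F r - F ?a)\<^sup>2 + T\<^sup>2 * (F ?a - Fd j)\<^sup>2)"
      if r: "r \<in> {?a..?b}" for r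
    proof -
      have "?b = ?a + \<tau>" by (simp add: algebra_simps)
      then have "\<bar>s (t - r) - s (t - ?a)\<bar> \<le> \<tau>" using s[of "t - r" "t - ?a"] r by auto
      then have 1: "(s (t - r) - s (t - ?a))\<^sup>2 \<le> \<tau>\<^sup>2" using \<tau> by (simp add: abs_le_square_iff[symmetric])
      have "\<bar>s (t - ?a)\<bar> \<le> T" using s'[of "t - ?a"] grid(1)[OF j] tT by auto
      then have 2: "(s (t - ?a))\<^sup>2 \<le> T\<^sup>2" using T by (simp add: abs_le_square_iff[symmetric])
      have three: "(x + y + z)\<^sup>2 \<le> 3 * (x\<^sup>2 + y\<^sup>2 + z\<^sup>2)" for x y z :: real
      proof -
        have "3 * (x\<^sup>2 + y\<^sup>2 + z\<^sup>2) - (x + y + z)\<^sup>2 = (x - y)\<^sup>2 + (y - z)\<^sup>2 + (x - z)\<^sup>2"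
          by (simp add: power2_eq_square algebra_simps)
        moreover have "0 \<le> (x - y)\<^sup>2 + (y - z)\<^sup>2 + (x - z)\<^sup>2" by simp
        ultimately show ?thesis by linarith
      qed
      have "g j r = (s (t - r) - s (t - ?a)) * F r + s (t - ?a) * (F r - F ?a) + s (t - ?a) * (F ?a - Fd j)"
        by (simp add: g_def algebra_simps)
      then have "(g j r)\<^sup>2 \<le> 3 * ((s (t - r) - s (t - ?a))\<^sup>2 * (F r)\<^sup>2 + (s (t - ?a))\<^sup>2 * (F r - F ?a)\<^sup>2 + (s (t - ?a))\<^sup>2 * (F ?a - Fd j)\<^sup>2)"
        using three[of "(s (t - r) - s (t - ?a)) * F r" "s (t - ?a) * (F r - F ?a)" "s (t - ?a) * (F ?a - Fd j)"]
        by (simp only: power_mult_distrib)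
      also have "\<dots> \<le> 3 * (\<tau>\<^sup>2 * (F r)\<^sup>2 + T\<^sup>2 * (F r - F ?a)\<^sup>2 + T\<^sup>2 * (F ?a - Fd j)\<^sup>2)"
        using 1 2 by (intro mult_left_mono add_mono mult_right_mono) auto
      finally show ?thesis .
    qed
    have "(\<integral>\<^sup>+r\<in>{?a..?b}. ennreal ((g j r)\<^sup>2) \<partial>lebesgue)
      \<le> (\<integral>\<^sup>+r. 3 * (ennreal (\<tau>\<^sup>2) * (ennreal ((F r)\<^sup>2) * ?I r) + ennreal (T\<^sup>2) * (ennreal ((F r - F ?a)\<^sup>2) * ?I r)
          + ennreal (T\<^sup>2 * (F ?a - Fd j)\<^sup>2) * ?I r) \<partial>lebesgue)"
    proof (rule nn_integral_mono)
      fix r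
      show "ennreal ((g j r)\<^sup>2) * ?I r \<le> 3 * (ennreal (\<tau>\<^sup>2) * (ennreal ((F r)\<^sup>2) * ?I r) + ennreal (T\<^sup>2) * (ennreal ((F r - F ?a)\<^sup>2) * ?I r)
          + ennreal (T\<^sup>2 * (F ?a - Fd j)\<^sup>2) * ?I r)"
      proof (cases "r \<in> {?a..?b}")
        case True
        have "ennreal ((g j r)\<^sup>2) \<le> ennreal (3 * (\<tau>\<^sup>2 * (F r)\<^sup>2 + T\<^sup>2 * (F r - F ?a)\<^sup>2 + T\<^sup>2 * (F ?a - Fd j)\<^sup>2))"
          by (rule ennreal_leI[OF gle[OF True]])
        then show ?thesis using True by (simp add: ennreal_mult ennreal_plus)
      qed simp
    qed
    also have "\<dots> = 3 * (ennreal (\<tau>\<^sup>2) * (\<integral>\<^sup>+r\<in>{?a..?b}. ennreal ((F r)\<^sup>2) \<partial>lebesgue)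
        + ennreal (T\<^sup>2) * (\<integral>\<^sup>+r\<in>{?a..?b}. ennreal ((F r - F ?a)\<^sup>2) \<partial>lebesgue)
        + ennreal (T\<^sup>2 * (F ?a - Fd j)\<^sup>2) * emeasure lebesgue {?a..?b})"
      by (simp add: nn_integral_add nn_integral_cmult)
    also have "emeasure lebesgue {?a..?b} = ennreal \<tau>"
      using grid(3)[OF j] by (simp add: algebra_simps)
    also have "ennreal (T\<^sup>2 * (F ?a - Fd j)\<^sup>2) * ennreal \<tau> = ennreal (T\<^sup>2 * \<tau>) * ennreal ((F ?a - Fd j)\<^sup>2)"
      using \<tau> by (simp add: ennreal_mult mult_ac)
    finally show "(\<integral>\<^sup>+r\<in>{?a..?b}. ennreal ((g j r)\<^sup>2) \<partial>lebesgue)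
       \<le> 3 * (ennreal (\<tau>\<^sup>2) * (\<integral>\<^sup>+r\<in>{?a..?b}. ennreal ((F r)\<^sup>2) \<partial>lebesgue)
        + ennreal (T\<^sup>2) * (\<integral>\<^sup>+r\<in>{?a..?b}. ennreal ((F r - F ?a)\<^sup>2) \<partial>lebesgue)
        + ennreal (T\<^sup>2 * \<tau>) * ennreal ((F ?a - Fd j)\<^sup>2))" .
  qed (use \<tau> in auto)
  also have "\<dots> = ennreal (3 * T) * (\<Sum>j<n. ennreal (\<tau>\<^sup>2) * (\<integral>\<^sup>+r\<in>cell \<tau> j. ennreal ((F r)\<^sup>2) \<partial>lebesgue)
        + ennreal (T\<^sup>2) * (\<integral>\<^sup>+r\<in>cell \<tau> j. ennreal ((F r - F (real j * \<tau>))\<^sup>2) \<partial>lebesgue)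
        + ennreal (T\<^sup>2 * \<tau>) * ennreal ((F (real j * \<tau>) - Fd j)\<^sup>2))"
  proof -
    have "ennreal (3 * T) = ennreal T * 3" using T by (simp add: ennreal_mult mult.commute)
    then show ?thesis by (simp only: sum_distrib_left[symmetric] mult.assoc)
  qed
  finally show ?thesis by (simp add: t_def s_def)
qed

text \<open>The squared norm of a coefficient sequence. Values in \<open>ennreal\<close> avoid
  summability obligations and let sums over modes be exchanged freely with integrals.\<close>

definition ssq :: "(nat \<Rightarrow> real) \<Rightarrow> ennreal" where
  "ssq g = (\<Sum>i. ennreal ((g i)\<^sup>2))"

lemma ssq_cmult_mono:
  assumes "\<And>i. (f i)\<^sup>2 \<le> c * (g i)\<^sup>2" and "0 \<le> c"
  shows "ssq f \<le> ennreal c * ssq g"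
proof -
  have "ssq f \<le> (\<Sum>i. ennreal c * ennreal ((g i)\<^sup>2))"
    unfolding ssq_def using assms by (intro suminf_le) (auto simp: ennreal_mult[symmetric] intro!: ennreal_leI)
  then show ?thesis by (simp add: ssq_def)
qed

lemma ssq_add_le: "ssq (\<lambda>i. f i + g i) \<le> 2 * ssq f + 2 * ssq g"
proof -
  have "(x + y)\<^sup>2 \<le> 2 * x\<^sup>2 + 2 * y\<^sup>2" for x y :: real
    using sum_squares_bound[of x y] by (simp add: power2_sum)
  then have "ssq (\<lambda>i. f i + g i) \<le> (\<Sum>i. 2 * ennreal ((f i)\<^sup>2) + 2 * ennreal ((g i)\<^sup>2))"
    unfolding ssq_def by (intro suminf_le) (simp_all flip: ennreal_plus ennreal_mult' ennreal_numeral)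
  also have "\<dots> = 2 * ssq f + 2 * ssq g"
    by (simp add: ssq_def suminf_add[symmetric])
  finally show ?thesis .
qed

lemma ssq_ge: "ennreal ((g i)\<^sup>2) \<le> ssq g"
proof -
  have "sum (\<lambda>i. ennreal ((g i)\<^sup>2)) {i} \<le> ssq g"
    unfolding ssq_def by (rule sum_le_suminf) auto
  then show ?thesis by simp
qed

lemma ssq_measurable[measurable]:
  assumes [measurable]: "\<And>i. f i \<in> borel_measurable M"
  shows "(\<lambda>x. ssq (\<lambda>i. f i x)) \<in> borel_measurable M"
  unfolding ssq_def by measurable

lemma ssq_nn_integral:
  fixes F :: "nat \<Rightarrow> 'a \<Rightarrow> real"
  assumes F[measurable]: "\<And>i. F i \<in> borel_measurable M" and S[measurable]: "S \<in> sets M"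
  shows "(\<Sum>i. \<integral>\<^sup>+r\<in>S. ennreal ((F i r)\<^sup>2) \<partial>M) = (\<integral>\<^sup>+r\<in>S. ssq (\<lambda>i. F i r) \<partial>M)"
proof -
  have "(\<integral>\<^sup>+r\<in>S. ssq (\<lambda>i. F i r) \<partial>M) = (\<integral>\<^sup>+r. (\<Sum>i. ennreal ((F i r)\<^sup>2) * indicator S r) \<partial>M)"
    by (simp add: ssq_def)
  also have "\<dots> = (\<Sum>i. \<integral>\<^sup>+r\<in>S. ennreal ((F i r)\<^sup>2) \<partial>M)"
    by (rule nn_integral_suminf) measurable
  finally show ?thesis ..
qed

text \<open>\<open>K\<close> secures integrability; the estimate itself sees \<open>F\<close> only
  through its L2 norm, which is what can be summed over modes.\<close>

lemma convolution_square_le: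
  fixes k F :: "real \<Rightarrow> real"
  assumes [measurable]: "F \<in> borel_measurable lebesgue" and km: "k \<in> borel_measurable borel"
    and K: "\<And>r. r \<in> {s..t} \<Longrightarrow> \<bar>F r\<bar> \<le> K" and st: "s \<le> t"
    and \<kappa>: "\<And>r. r \<in> {s..t} \<Longrightarrow> \<bar>k r\<bar> \<le> \<kappa>"
  shows "ennreal ((integral {s..t} (\<lambda>r. k r * F r))\<^sup>2)
      \<le> ennreal ((t - s) * \<kappa>\<^sup>2) * (\<integral>\<^sup>+r\<in>{s..t}. ennreal ((F r)\<^sup>2) \<partial>lebesgue)"
proof -
  have [measurable]: "k \<in> borel_measurable lebesgue" using km by (intro measurable_completion) simp
  have i: "integrable (lebesgue_on {s..t}) (\<lambda>r. k r * F r)"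
  proof (rule integrable_lebesgue_on_bounded[where K="\<kappa> * K"])
    fix r assume r: "r \<in> {s..t}"
    then show "\<bar>k r * F r\<bar> \<le> \<kappa> * K"
      unfolding abs_mult using K[OF r] \<kappa>[OF r] by (intro mult_mono) auto
  qed measurable
  have "ennreal ((integral {s..t} (\<lambda>r. k r * F r))\<^sup>2) \<le> ennreal (t - s) * (\<integral>\<^sup>+r\<in>{s..t}. ennreal ((k r * F r)\<^sup>2) \<partial>lebesgue)"
    using integral_square_le[OF i st] by (simp add: nn_integral_completion)
  also have "\<dots> \<le> ennreal (t - s) * (\<integral>\<^sup>+r. ennreal (\<kappa>\<^sup>2) * (ennreal ((F r)\<^sup>2) * indicator {s..t} r) \<partial>lebesgue)"
  proof (intro mult_left_mono nn_integral_mono)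
    fix r
    show "ennreal ((k r * F r)\<^sup>2) * indicator {s..t} r \<le> ennreal (\<kappa>\<^sup>2) * (ennreal ((F r)\<^sup>2) * indicator {s..t} r)"
    proof (cases "r \<in> {s..t}")
      case True
      have "(k r)\<^sup>2 \<le> \<kappa>\<^sup>2" using \<kappa>[OF True] by (intro abs_le_square_iff[THEN iffD1]) auto
      then have "(k r * F r)\<^sup>2 \<le> \<kappa>\<^sup>2 * (F r)\<^sup>2" by (simp add: power_mult_distrib mult_right_mono)
      then show ?thesis using True by (simp add: ennreal_mult[symmetric] ennreal_leI)
    qed simp
  qed simp
  also have "\<dots> = ennreal ((t - s) * \<kappa>\<^sup>2) * (\<integral>\<^sup>+r\<in>{s..t}. ennreal ((F r)\<^sup>2) \<partial>lebesgue)"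
    using st by (simp add: nn_integral_cmult ennreal_mult mult.assoc)
  finally show ?thesis .
qed

text \<open>One sample path in spectral coordinates: \<open>U\<close> for the solution,
  \<open>F\<close> for the coefficients of \<open>f(u)\<close>, \<open>Z\<close> for the stochastic
  convolution, \<open>a\<close> and \<open>b\<close> for the data. \<open>K\<close> depends on the
  path and only expresses finiteness, so it must not enter the final estimates; \<open>L\<close>,
  \<open>G0\<close> and \<open>G1\<close> are the same for all paths.\<close>

locale trig_mild =
  fixes w a b :: "nat \<Rightarrow> real" and Z F U :: "nat \<Rightarrow> real \<Rightarrow> real" and T K L G0 G1 p :: real
  assumes w: "\<And>i. 0 < w i" and T: "0 < T" and p: "0 \<le> p" "p \<le> 1"
    and const: "0 \<le> K" "0 \<le> L" "0 \<le> G0" "0 \<le> G1"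
    and F_meas[measurable]: "\<And>i. F i \<in> borel_measurable lebesgue"
    and Z_meas: "\<And>i. Z i \<in> borel_measurable borel"
    and F_bdd: "\<And>r. r \<in> {0..T} \<Longrightarrow> ssq (\<lambda>i. F i r) \<le> ennreal K"
    and mild: "\<And>i t. t \<in> {0..T} \<Longrightarrow> U i t = cos (w i * t) * a i + sin (w i * t) / w i * b i
        + integral {0..t} (\<lambda>r. sin (w i * (t - r)) / w i * F i r) + Z i t"
    and F_lip: "\<And>r s. r \<in> {0..T} \<Longrightarrow> s \<in> {0..T} \<Longrightarrow>
        ssq (\<lambda>i. F i r - F i s) \<le> ennreal L * ssq (\<lambda>i. U i r - U i s)"
    and F_growth: "\<And>r. r \<in> {0..T} \<Longrightarrow> ssq (\<lambda>i. F i r) \<le> ennreal G1 * ssq (\<lambda>i. U i r) + ennreal G0"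
begin

definition energy :: ennreal where
  "energy = (\<integral>\<^sup>+r\<in>{0..T}. ssq (\<lambda>i. F i r) \<partial>lebesgue)"

definition conv :: "nat \<Rightarrow> real \<Rightarrow> real" where
  "conv i t = integral {0..t} (\<lambda>r. sin (w i * (t - r)) / w i * F i r)"

lemma Z_meas'[measurable]: "Z i \<in> borel_measurable lebesgue"
  using Z_meas by (intro measurable_completion) simp

lemma F_le: "r \<in> {0..T} \<Longrightarrow> \<bar>F i r\<bar> \<le> sqrt K"
proof -
  assume r: "r \<in> {0..T}"
  have "ennreal ((F i r)\<^sup>2) \<le> ennreal K" using ssq_ge[of "\<lambda>i. F i r" i] F_bdd[OF r] by (rule order_trans)
  then show "\<bar>F i r\<bar> \<le> sqrt K" using const by (intro real_le_rsqrt) simp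
qed

lemma sin_diff_le: "\<bar>sin (w i * x) / w i - sin (w i * y) / w i\<bar> \<le> \<bar>x - y\<bar>"
proof -
  have "\<bar>sin (w i * x) - sin (w i * y)\<bar> \<le> w i * \<bar>x - y\<bar>"
    using abs_sin_diff_le[of "w i * x" "w i * y"] w[of i] by (simp add: abs_mult flip: right_diff_distrib)
  then show ?thesis using w[of i] by (simp add: pos_divide_le_eq mult.commute flip: diff_divide_distrib)
qed

lemma sin_le: "\<bar>sin (w i * x) / w i\<bar> \<le> \<bar>x\<bar>"
  using sin_diff_le[of i x 0] by simp

lemma conv_ssq:
  assumes t: "t \<in> {0..T}"
  shows "ssq (\<lambda>i. conv i t) \<le> ennreal (T ^ 3) * (\<integral>\<^sup>+r\<in>{0..t}. ssq (\<lambda>i. F i r) \<partial>lebesgue)"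
proof -
  have "ssq (\<lambda>i. conv i t) \<le> (\<Sum>i. ennreal (T ^ 3) * (\<integral>\<^sup>+r\<in>{0..t}. ennreal ((F i r)\<^sup>2) \<partial>lebesgue))"
    unfolding ssq_def
  proof (intro suminf_le)
    fix i
    have "ennreal ((conv i t)\<^sup>2) \<le> ennreal ((t - 0) * T\<^sup>2) * (\<integral>\<^sup>+r\<in>{0..t}. ennreal ((F i r)\<^sup>2) \<partial>lebesgue)"
      unfolding conv_def
    proof (rule convolution_square_le)
      fix r assume r: "r \<in> {0..t}"
      show "\<bar>F i r\<bar> \<le> sqrt K" using r t by (intro F_le) auto
      show "\<bar>sin (w i * (t - r)) / w i\<bar> \<le> T" using sin_le[of i "t - r"] r t by auto
    qed (use t in auto)
    also have "\<dots> \<le> ennreal (T ^ 3) * (\<integral>\<^sup>+r\<in>{0..t}. ennreal ((F i r)\<^sup>2) \<partial>lebesgue)"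
      using t T by (intro mult_right_mono ennreal_leI) (auto simp: power3_eq_cube power2_eq_square mult_right_mono)
    finally show "ennreal ((conv i t)\<^sup>2) \<le> ennreal (T ^ 3) * (\<integral>\<^sup>+r\<in>{0..t}. ennreal ((F i r)\<^sup>2) \<partial>lebesgue)" .
  qed auto
  also have "\<dots> = ennreal (T ^ 3) * (\<integral>\<^sup>+r\<in>{0..t}. ssq (\<lambda>i. F i r) \<partial>lebesgue)"
    using ssq_nn_integral[of F lebesgue "{0..t}"] by simp
  finally show ?thesis .
qed

lemma U_ssq:
  assumes t: "t \<in> {0..T}"
  shows "ssq (\<lambda>i. U i t) \<le> 4 * (ssq a + ssq (\<lambda>i. b i / w i) + ssq (\<lambda>i. Z i t))
     + 4 * (ennreal (T ^ 3) * (\<integral>\<^sup>+r\<in>{0..t}. ssq (\<lambda>i. F i r) \<partial>lebesgue))"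
proof -
  have "ssq (\<lambda>i. U i t) = ssq (\<lambda>i. (cos (w i * t) * a i + sin (w i * t) / w i * b i) + (conv i t + Z i t))"
    using mild[OF t] by (simp add: conv_def add.assoc)
  also have "\<dots> \<le> 2 * (2 * ssq (\<lambda>i. cos (w i * t) * a i) + 2 * ssq (\<lambda>i. sin (w i * t) / w i * b i))
      + 2 * (2 * ssq (\<lambda>i. conv i t) + 2 * ssq (\<lambda>i. Z i t))"
    by (intro order_trans[OF ssq_add_le] add_mono mult_left_mono ssq_add_le) auto
  also have "\<dots> \<le> 2 * (2 * (ennreal 1 * ssq a) + 2 * (ennreal 1 * ssq (\<lambda>i. b i / w i)))
      + 2 * (2 * (ennreal (T ^ 3) * (\<integral>\<^sup>+r\<in>{0..t}. ssq (\<lambda>i. F i r) \<partial>lebesgue)) + 2 * ssq (\<lambda>i. Z i t))"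
  proof (intro add_mono mult_left_mono ssq_cmult_mono conv_ssq t)
    fix i
    show "(cos (w i * t) * a i)\<^sup>2 \<le> 1 * (a i)\<^sup>2"
      unfolding power_mult_distrib by (intro mult_right_mono) (auto simp: abs_square_le_1)
    have "(sin (w i * t) / w i * b i)\<^sup>2 = (sin (w i * t))\<^sup>2 * (b i / w i)\<^sup>2" by (simp add: power_mult_distrib power_divide)
    also have "\<dots> \<le> 1 * (b i / w i)\<^sup>2" by (intro mult_right_mono) (auto simp: abs_square_le_1)
    finally show "(sin (w i * t) / w i * b i)\<^sup>2 \<le> 1 * (b i / w i)\<^sup>2" .
  qed auto
  also have "\<dots> = 4 * (ssq a + ssq (\<lambda>i. b i / w i) + ssq (\<lambda>i. Z i t))
     + 4 * (ennreal (T ^ 3) * (\<integral>\<^sup>+r\<in>{0..t}. ssq (\<lambda>i. F i r) \<partial>lebesgue))"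
    by (simp add: distrib_left mult.assoc[symmetric] add_ac)
  finally show ?thesis .
qed

text \<open>Linear growth of \<open>f\<close> and the mild formula give an integral inequality for
  \<open>F\<close> alone. After Gronwall's lemma the bound involves only the data and
  \<open>Z\<close>, which are measurable in the sample point, and \<open>K\<close> has
  disappeared.\<close>

lemma energy_le:
  "energy \<le> ennreal (exp (4 * G1 * T ^ 3 * T)) * (\<integral>\<^sup>+r\<in>{0..T}. (ennreal G0
      + ennreal (4 * G1) * (ssq a + ssq (\<lambda>i. b i / w i) + ssq (\<lambda>i. Z i r))) \<partial>lebesgue)"
  unfolding energy_def
proof (rule gronwall_nn_integral)
  fix r assume r: "r \<in> {0..T}"
  show "ssq (\<lambda>i. F i r) \<le> ennreal K" by (rule F_bdd[OF r])
  let ?A = "ssq a + ssq (\<lambda>i. b i / w i) + ssq (\<lambda>i. Z i r)" and ?I = "\<integral>\<^sup>+r\<in>{0..r}. ssq (\<lambda>i. F i r) \<partial>lebesgue"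
  have "ssq (\<lambda>i. F i r) \<le> ennreal G1 * (4 * ?A + 4 * (ennreal (T ^ 3) * ?I)) + ennreal G0"
    by (intro order_trans[OF F_growth[OF r]] add_right_mono mult_left_mono U_ssq r) simp
  also have "\<dots> = ennreal G0 + ennreal (4 * G1) * ?A + ennreal (4 * G1 * T ^ 3) * ?I"
  proof -
    have "ennreal (4 * G1) = ennreal G1 * 4" "ennreal (4 * G1 * T ^ 3) = ennreal G1 * 4 * ennreal (T ^ 3)"
      using const T by (simp_all add: ennreal_mult mult.commute)
    then show ?thesis by (simp only: distrib_left mult.assoc add_ac)
  qed
  finally show "ssq (\<lambda>i. F i r) \<le> ennreal G0 + ennreal (4 * G1) * ?A + ennreal (4 * G1 * T ^ 3) * ?I" .
next
  show "(\<lambda>r. ssq (\<lambda>i. F i r)) \<in> borel_measurable lebesgue" by measurable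
  have [measurable]: "(\<lambda>r. ssq (\<lambda>i. Z i r)) \<in> borel_measurable lebesgue" by measurable
  show "(\<lambda>r. ennreal G0 + ennreal (4 * G1) * (ssq a + ssq (\<lambda>i. b i / w i) + ssq (\<lambda>i. Z i r))) \<in> borel_measurable lebesgue"
    by measurable
  show "0 \<le> 4 * G1 * T ^ 3" "0 \<le> T" using const T by auto
qed

lemma cell_energy: "{s..t} \<subseteq> {0..T} \<Longrightarrow> (\<integral>\<^sup>+r\<in>{s..t}. ssq (\<lambda>i. F i r) \<partial>lebesgue) \<le> energy"
  unfolding energy_def by (intro nn_integral_mono) (auto simp: indicator_def)

text \<open>Over \<open>{0..s}\<close> the kernel changes by at most \<open>t - s\<close>, and over
  \<open>{s..t}\<close> it is itself at most \<open>t - s\<close>, in both cases uniformly in the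
  modes. The deterministic convolution is therefore Lipschitz in time.\<close>

lemma conv_increment:
  assumes st: "0 \<le> s" "s \<le> t" "t \<le> T"
  shows "ssq (\<lambda>i. conv i t - conv i s) \<le> ennreal (4 * T * (t - s)\<^sup>2) * energy"
proof -
  define k where "k i r = sin (w i * (t - r)) / w i - sin (w i * (s - r)) / w i" for i r
  define k' where "k' i r = sin (w i * (t - r)) / w i" for i r
  have km: "k i \<in> borel_measurable borel" "k' i \<in> borel_measurable borel" for i
    unfolding k_def k'_def by measurable
  have eq: "conv i t - conv i s = integral {0..s} (\<lambda>r. k i r * F i r) + integral {s..t} (\<lambda>r. k' i r * F i r)" for i
  proof -
    have ti: "(\<lambda>r. sin (w i * (x - r)) / w i * F i r) integrable_on {0..y}" if "y \<le> T" "0 \<le> y" "x \<le> T" "0 \<le> x" for x y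
    proof (rule integrable_on_bounded[where K="T * sqrt K"])
      have "(\<lambda>r. sin (w i * (x - r)) / w i) \<in> borel_measurable borel" by measurable
      then have [measurable]: "(\<lambda>r. sin (w i * (x - r)) / w i) \<in> borel_measurable lebesgue"
        by (intro measurable_completion) simp
      show "(\<lambda>r. sin (w i * (x - r)) / w i * F i r) \<in> borel_measurable lebesgue" by measurable
      fix r assume "r \<in> {0..y}"
      then show "\<bar>sin (w i * (x - r)) / w i * F i r\<bar> \<le> T * sqrt K"
        unfolding abs_mult[of "sin (w i * (x - r)) / w i"] using that const T sin_le[of i "x - r"]
        by (intro mult_mono F_le) auto
    qed
    have "conv i t = integral {0..s} (\<lambda>r. k' i r * F i r) + integral {s..t} (\<lambda>r. k' i r * F i r)"
      unfolding conv_def k'_def using st T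
      by (intro Henstock_Kurzweil_Integration.integral_combine[symmetric] ti) auto
    moreover have "integral {0..s} (\<lambda>r. k' i r * F i r) - conv i s = integral {0..s} (\<lambda>r. k i r * F i r)"
      unfolding conv_def k'_def k_def left_diff_distrib using st T
      by (intro Henstock_Kurzweil_Integration.integral_diff[symmetric] ti) auto
    ultimately show ?thesis by simp
  qed
  have c: "ssq (\<lambda>i. integral {x..y} (\<lambda>r. h i r * F i r)) \<le> ennreal (T * (t - s)\<^sup>2) * energy"
    if xy: "0 \<le> x" "x \<le> y" "y \<le> T" and hm: "\<And>i. h i \<in> borel_measurable borel"
      and h: "\<And>i r. r \<in> {x..y} \<Longrightarrow> \<bar>h i r\<bar> \<le> t - s" for x y h
  proof -
    have "ssq (\<lambda>i. integral {x..y} (\<lambda>r. h i r * F i r))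
        \<le> (\<Sum>i. ennreal (T * (t - s)\<^sup>2) * (\<integral>\<^sup>+r\<in>{x..y}. ennreal ((F i r)\<^sup>2) \<partial>lebesgue))"
      unfolding ssq_def
    proof (intro suminf_le)
      fix i
      have "ennreal ((integral {x..y} (\<lambda>r. h i r * F i r))\<^sup>2)
          \<le> ennreal ((y - x) * (t - s)\<^sup>2) * (\<integral>\<^sup>+r\<in>{x..y}. ennreal ((F i r)\<^sup>2) \<partial>lebesgue)"
        using xy by (intro convolution_square_le[OF F_meas hm F_le _ h]) auto
      also have "\<dots> \<le> ennreal (T * (t - s)\<^sup>2) * (\<integral>\<^sup>+r\<in>{x..y}. ennreal ((F i r)\<^sup>2) \<partial>lebesgue)"
        using xy by (intro mult_right_mono ennreal_leI) auto
      finally show "ennreal ((integral {x..y} (\<lambda>r. h i r * F i r))\<^sup>2)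
          \<le> ennreal (T * (t - s)\<^sup>2) * (\<integral>\<^sup>+r\<in>{x..y}. ennreal ((F i r)\<^sup>2) \<partial>lebesgue)" .
    qed auto
    also have "\<dots> = ennreal (T * (t - s)\<^sup>2) * (\<integral>\<^sup>+r\<in>{x..y}. ssq (\<lambda>i. F i r) \<partial>lebesgue)"
      using ssq_nn_integral[of F lebesgue "{x..y}"] by simp
    also have "\<dots> \<le> ennreal (T * (t - s)\<^sup>2) * energy"
      using xy by (intro mult_left_mono cell_energy) auto
    finally show ?thesis .
  qed
  have "ssq (\<lambda>i. conv i t - conv i s) \<le> 2 * (ennreal (T * (t - s)\<^sup>2) * energy) + 2 * (ennreal (T * (t - s)\<^sup>2) * energy)"
    unfolding eq
  proof (intro order_trans[OF ssq_add_le] add_mono mult_left_mono c km)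
    fix i r
    show "\<bar>k i r\<bar> \<le> t - s" using sin_diff_le[of i "t - r" "s - r"] st by (simp add: k_def)
    show "r \<in> {s..t} \<Longrightarrow> \<bar>k' i r\<bar> \<le> t - s" using sin_le[of i "t - r"] by (auto simp: k'_def)
  qed (use st in simp_all)
  also have "\<dots> = ennreal (4 * T * (t - s)\<^sup>2) * energy"
  proof -
    have "ennreal (4 * T * (t - s)\<^sup>2) = 4 * ennreal (T * (t - s)\<^sup>2)"
      using T by (simp add: ennreal_mult mult.assoc)
    then show ?thesis by (simp only: mult.assoc distrib_right[symmetric]) simp
  qed
  finally show ?thesis .
qed

text \<open>Since \<open>w powr p = lam powr (\<alpha> * p / 2)\<close>, this is the squared norm of
  the initial position of order \<open>\<alpha> * p\<close> plus that of the initial velocity of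
  order \<open>\<alpha> * p - \<alpha>\<close>.\<close>

definition data :: ennreal where
  "data = ssq (\<lambda>i. w i powr p * a i) + ssq (\<lambda>i. w i powr p * (b i / w i))"

text \<open>Hoelder continuity of order \<open>p\<close> of the free evolution costs
  \<open>w powr p\<close> on the data. The four-term split gives a factor 4, and the interpolation
  and the convolution another 4 each. The bound is in terms of \<open>h\<close> so that one
  \<open>h\<close> serves a whole cell.\<close>

lemma U_increment:
  assumes st: "0 \<le> s" "s \<le> t" "t \<le> T" and h: "t - s \<le> h"
  shows "ssq (\<lambda>i. U i t - U i s) \<le> ennreal (16 * h powr (2 * p)) * data
      + 4 * ssq (\<lambda>i. Z i t - Z i s) + ennreal (16 * T * h\<^sup>2) * energy"
proof -
  have m: "s \<in> {0..T}" "t \<in> {0..T}" using st by auto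
  have trig: "(cos (w i * t) - cos (w i * s))\<^sup>2 \<le> 4 * h powr (2 * p) * (w i powr p)\<^sup>2"
    "(sin (w i * t) - sin (w i * s))\<^sup>2 \<le> 4 * h powr (2 * p) * (w i powr p)\<^sup>2" for i
  proof -
    have wh: "\<bar>w i * t - w i * s\<bar> \<le> w i * h"
      using w[of i] st h by (simp add: abs_mult flip: right_diff_distrib)
    have "(w i * h) powr (2 * p) = h powr (2 * p) * (w i powr p)\<^sup>2"
      using w[of i] st h by (simp add: powr_mult powr_powr power2_eq_square flip: powr_add)
    moreover have "\<bar>cos (w i * t) - cos (w i * s)\<bar> \<le> 2" "\<bar>sin (w i * t) - sin (w i * s)\<bar> \<le> 2"
      using abs_cos_le_one[of "w i * t"] abs_cos_le_one[of "w i * s"]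
        abs_sin_le_one[of "w i * t"] abs_sin_le_one[of "w i * s"] by linarith+
    ultimately show "(cos (w i * t) - cos (w i * s))\<^sup>2 \<le> 4 * h powr (2 * p) * (w i powr p)\<^sup>2"
      "(sin (w i * t) - sin (w i * s))\<^sup>2 \<le> 4 * h powr (2 * p) * (w i powr p)\<^sup>2"
      using square_le_4_powr[OF _ order_trans[OF abs_cos_diff_le wh] p]
        square_le_4_powr[OF _ order_trans[OF abs_sin_diff_le wh] p] by (simp_all add: mult.assoc)
  qed
  have "ssq (\<lambda>i. U i t - U i s) = ssq (\<lambda>i. ((cos (w i * t) - cos (w i * s)) * a i
      + (sin (w i * t) - sin (w i * s)) * (b i / w i)) + ((Z i t - Z i s) + (conv i t - conv i s)))"
    by (simp add: mild[OF m(1)] mild[OF m(2)] conv_def algebra_simps)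
  also have "\<dots> \<le> 2 * (2 * ssq (\<lambda>i. (cos (w i * t) - cos (w i * s)) * a i)
        + 2 * ssq (\<lambda>i. (sin (w i * t) - sin (w i * s)) * (b i / w i)))
      + 2 * (2 * ssq (\<lambda>i. Z i t - Z i s) + 2 * ssq (\<lambda>i. conv i t - conv i s))"
    by (intro order_trans[OF ssq_add_le] add_mono mult_left_mono ssq_add_le) auto
  also have "\<dots> \<le> 2 * (2 * (ennreal (4 * h powr (2 * p)) * ssq (\<lambda>i. w i powr p * a i))
        + 2 * (ennreal (4 * h powr (2 * p)) * ssq (\<lambda>i. w i powr p * (b i / w i))))
      + 2 * (2 * ssq (\<lambda>i. Z i t - Z i s) + 2 * (ennreal (4 * T * h\<^sup>2) * energy))"
  proof (intro add_mono mult_left_mono ssq_cmult_mono)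
    fix i
    show "((cos (w i * t) - cos (w i * s)) * a i)\<^sup>2 \<le> 4 * h powr (2 * p) * (w i powr p * a i)\<^sup>2"
      unfolding power_mult_distrib[of _ "a i"] using mult_right_mono[OF trig(1), of "(a i)\<^sup>2" i] by simp
    show "((sin (w i * t) - sin (w i * s)) * (b i / w i))\<^sup>2 \<le> 4 * h powr (2 * p) * (w i powr p * (b i / w i))\<^sup>2"
      unfolding power_mult_distrib[of _ "b i / w i"] using mult_right_mono[OF trig(2), of "(b i / w i)\<^sup>2" i] by simp
  next
    have "(t - s)\<^sup>2 \<le> h\<^sup>2" using st h by (intro power_mono) auto
    then show "ssq (\<lambda>i. conv i t - conv i s) \<le> ennreal (4 * T * h\<^sup>2) * energy"
      using T by (intro order_trans[OF conv_increment[OF st]] mult_right_mono ennreal_leI mult_left_mono) auto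
  qed auto
  also have "\<dots> = ennreal (16 * h powr (2 * p)) * data + 4 * ssq (\<lambda>i. Z i t - Z i s) + ennreal (16 * T * h\<^sup>2) * energy"
  proof -
    have "ennreal (4 * h powr (2 * p)) = 4 * ennreal (h powr (2 * p))"
      "ennreal (16 * h powr (2 * p)) = 16 * ennreal (h powr (2 * p))"
      "ennreal (4 * T * h\<^sup>2) = 4 * ennreal (T * h\<^sup>2)" "ennreal (16 * T * h\<^sup>2) = 16 * ennreal (T * h\<^sup>2)"
      using T by (simp_all add: ennreal_mult mult.assoc)
    then show ?thesis by (simp add: data_def distrib_left mult.assoc[symmetric])
  qed
  finally show ?thesis .
qed

end

section \<open>Oscillation over grid cells and the recursion for the error\<close>

context trig_mild
begin

text \<open>Left unevaluated on a fixed path: the Hoelder bound for the stochastic convolution is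
  available in expectation only.\<close>

definition Z_osc :: "real \<Rightarrow> nat \<Rightarrow> ennreal" where
  "Z_osc \<tau> n = (\<Sum>j<n. \<integral>\<^sup>+r\<in>cell \<tau> j. ssq (\<lambda>i. Z i r - Z i (real j * \<tau>)) \<partial>lborel)"

text \<open>The Lipschitz bound reduces the oscillation of \<open>F\<close> to that of
  \<open>U\<close> relative to the left end of the cell. The lengths of the cells add up to at most
  \<open>T\<close>.\<close>

lemma F_osc:
  assumes \<tau>: "0 < \<tau>" and n: "real n * \<tau> \<le> T"
  shows "(\<Sum>j<n. \<integral>\<^sup>+r\<in>cell \<tau> j. ssq (\<lambda>i. F i r - F i (real j * \<tau>)) \<partial>lebesgue)
     \<le> ennreal (16 * L * T * \<tau> powr (2 * p)) * data + ennreal (4 * L) * Z_osc \<tau> n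
        + ennreal (16 * L * T\<^sup>2 * \<tau>\<^sup>2) * energy"
proof -
  define c where "c = ennreal (16 * L * \<tau> powr (2 * p)) * data + ennreal (16 * L * T * \<tau>\<^sup>2) * energy"
  have cell: "(\<integral>\<^sup>+r\<in>cell \<tau> j. ssq (\<lambda>i. F i r - F i (real j * \<tau>)) \<partial>lebesgue)
      \<le> ennreal \<tau> * c + ennreal (4 * L) * (\<integral>\<^sup>+r\<in>cell \<tau> j. ssq (\<lambda>i. Z i r - Z i (real j * \<tau>)) \<partial>lborel)"
    if j: "j < n" for j
  proof -
    let ?s = "real j * \<tau>" and ?t = "real (Suc j) * \<tau>"
    have "real (Suc j) \<le> real n" using j by simp
    then have "?t \<le> real n * \<tau>" using \<tau> by (intro mult_right_mono) auto
    then have tT: "?t \<le> T" using n by linarith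
    have st: "0 \<le> ?s" "?t = ?s + \<tau>" using \<tau> by (auto simp: algebra_simps)
    have mem: "0 \<le> r" "r \<le> T" "?s \<le> T" if "r \<in> {?s..?t}" for r
    proof -
      have "?s \<le> r" "r \<le> ?t" using that by simp_all
      then show "0 \<le> r" "r \<le> T" "?s \<le> T" using st tT \<tau> by linarith+
    qed
    let ?I = "indicator {?s..?t} :: real \<Rightarrow> ennreal"
    have "(\<integral>\<^sup>+r\<in>{?s..?t}. ssq (\<lambda>i. F i r - F i ?s) \<partial>lebesgue)
        \<le> (\<integral>\<^sup>+r. c * ?I r + ennreal (4 * L) * (ssq (\<lambda>i. Z i r - Z i ?s) * ?I r) \<partial>lebesgue)"
    proof (rule nn_integral_mono)
      fix r
      show "ssq (\<lambda>i. F i r - F i ?s) * ?I r \<le> c * ?I r + ennreal (4 * L) * (ssq (\<lambda>i. Z i r - Z i ?s) * ?I r)"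
      proof (cases "r \<in> {?s..?t}")
        case True
        have "ssq (\<lambda>i. F i r - F i ?s) \<le> ennreal L * ssq (\<lambda>i. U i r - U i ?s)"
          using mem[OF True] st by (intro F_lip) auto
        also have "\<dots> \<le> ennreal L * (ennreal (16 * \<tau> powr (2 * p)) * data
            + 4 * ssq (\<lambda>i. Z i r - Z i ?s) + ennreal (16 * T * \<tau>\<^sup>2) * energy)"
          using True mem[OF True] st by (intro mult_left_mono U_increment) auto
        also have "\<dots> = c + ennreal (4 * L) * ssq (\<lambda>i. Z i r - Z i ?s)"
        proof -
          have "ennreal (16 * L * \<tau> powr (2 * p)) = ennreal L * ennreal (16 * \<tau> powr (2 * p))"
            "ennreal (4 * L) = ennreal L * 4" "ennreal (16 * L * T * \<tau>\<^sup>2) = ennreal L * ennreal (16 * T * \<tau>\<^sup>2)"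
            using const T by (simp_all add: ennreal_mult mult_ac)
          then show ?thesis by (simp only: c_def distrib_left mult.assoc add_ac)
        qed
        finally show ?thesis using True by simp
      qed simp
    qed
    also have "\<dots> = c * emeasure lebesgue {?s..?t} + ennreal (4 * L) * (\<integral>\<^sup>+r\<in>{?s..?t}. ssq (\<lambda>i. Z i r - Z i ?s) \<partial>lebesgue)"
      by (simp add: nn_integral_add nn_integral_cmult)
    also have "emeasure lebesgue {?s..?t} = ennreal \<tau>" using st \<tau> by simp
    finally show ?thesis by (simp add: nn_integral_completion mult.commute)
  qed
  have "(\<Sum>j<n. \<integral>\<^sup>+r\<in>cell \<tau> j. ssq (\<lambda>i. F i r - F i (real j * \<tau>)) \<partial>lebesgue)
      \<le> (\<Sum>j<n. ennreal \<tau> * c + ennreal (4 * L) * (\<integral>\<^sup>+r\<in>cell \<tau> j. ssq (\<lambda>i. Z i r - Z i (real j * \<tau>)) \<partial>lborel))"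
    by (intro sum_mono cell) simp
  also have "\<dots> = ennreal (real n * \<tau>) * c + ennreal (4 * L) * Z_osc \<tau> n"
    using \<tau> by (simp add: sum.distrib Z_osc_def sum_distrib_left[symmetric] ennreal_mult ennreal_of_nat_eq_real_of_nat mult.assoc)
  also have "\<dots> \<le> ennreal T * c + ennreal (4 * L) * Z_osc \<tau> n"
    using n by (intro add_right_mono mult_right_mono ennreal_leI) auto
  also have "ennreal T * c = ennreal (16 * L * T * \<tau> powr (2 * p)) * data + ennreal (16 * L * T\<^sup>2 * \<tau>\<^sup>2) * energy"
  proof -
    have "ennreal (16 * L * T * \<tau> powr (2 * p)) = ennreal T * ennreal (16 * L * \<tau> powr (2 * p))"
      "ennreal (16 * L * T\<^sup>2 * \<tau>\<^sup>2) = ennreal T * ennreal (16 * L * T * \<tau>\<^sup>2)"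
      using const T by (simp_all add: ennreal_mult[symmetric] power2_eq_square mult_ac)
    then show ?thesis by (simp only: c_def distrib_left mult.assoc)
  qed
  finally show ?thesis by (simp only: add_ac)
qed

text \<open>The difference of the two convolutions is a quadrature error in each mode. Summing over
  modes turns its three parts into \<open>energy\<close>, the oscillation of \<open>F\<close>, and
  previous errors weighted by \<open>\<tau>\<close>, which is the form required by a discrete
  Gronwall argument.\<close>

lemma error_recursion:
  fixes un Fd zd :: "nat \<Rightarrow> nat \<Rightarrow> real"
  assumes \<tau>: "0 < \<tau>" and n: "real n * \<tau> \<le> T"
    and un: "\<And>i. un n i = cos (w i * (real n * \<tau>)) * a i + sin (w i * (real n * \<tau>)) / w i * b i
        + (\<Sum>j<n. \<tau> * (sin (w i * (real n * \<tau> - real j * \<tau>)) / w i) * Fd j i) + zd n i"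
    and Fd: "\<And>j. j < n \<Longrightarrow> ssq (\<lambda>i. F i (real j * \<tau>) - Fd j i) \<le> ennreal L * ssq (\<lambda>i. U i (real j * \<tau>) - un j i)"
  shows "ssq (\<lambda>i. U i (real n * \<tau>) - un n i) \<le>
      2 * ssq (\<lambda>i. Z i (real n * \<tau>) - zd n i)
      + ennreal ((6 * T + 96 * L * T ^ 5) * \<tau>\<^sup>2) * energy
      + ennreal (96 * L * T ^ 4 * \<tau> powr (2 * p)) * data
      + ennreal (24 * L * T ^ 3) * Z_osc \<tau> n
      + ennreal (6 * L * T ^ 3 * \<tau>) * (\<Sum>j<n. ssq (\<lambda>i. U i (real j * \<tau>) - un j i))"
proof -
  define q where "q i = integral {0..real n * \<tau>} (\<lambda>r. sin (w i * (real n * \<tau> - r)) / w i * F i r)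
      - (\<Sum>j<n. \<tau> * (sin (w i * (real n * \<tau> - real j * \<tau>)) / w i) * Fd j i)" for i
  let ?C = "\<lambda>j. (cell \<tau> j)"
  have nT: "real n * \<tau> \<in> {0..T}" using \<tau> n by simp
  have "U i (real n * \<tau>) - un n i = (Z i (real n * \<tau>) - zd n i) + q i" for i
    by (simp add: mild[OF nT] un q_def)
  then have split: "ssq (\<lambda>i. U i (real n * \<tau>) - un n i) \<le> 2 * ssq (\<lambda>i. Z i (real n * \<tau>) - zd n i) + 2 * ssq q"
    using ssq_add_le[of "\<lambda>i. Z i (real n * \<tau>) - zd n i" q] by simp
  have "ssq q \<le> (\<Sum>i. ennreal (3 * T) * (\<Sum>j<n. ennreal (\<tau>\<^sup>2) * (\<integral>\<^sup>+r\<in>?C j. ennreal ((F i r)\<^sup>2) \<partial>lebesgue)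
        + ennreal (T\<^sup>2) * (\<integral>\<^sup>+r\<in>?C j. ennreal ((F i r - F i (real j * \<tau>))\<^sup>2) \<partial>lebesgue)
        + ennreal (T\<^sup>2 * \<tau>) * ennreal ((F i (real j * \<tau>) - Fd j i)\<^sup>2)))"
    unfolding ssq_def q_def
    by (intro suminf_le convolution_quadrature_error[OF w F_meas F_le \<tau> n]) auto
  also have "\<dots> = ennreal (3 * T) * (\<Sum>j<n. ennreal (\<tau>\<^sup>2) * (\<integral>\<^sup>+r\<in>?C j. ssq (\<lambda>i. F i r) \<partial>lebesgue)
        + ennreal (T\<^sup>2) * (\<integral>\<^sup>+r\<in>?C j. ssq (\<lambda>i. F i r - F i (real j * \<tau>)) \<partial>lebesgue)
        + ennreal (T\<^sup>2 * \<tau>) * ssq (\<lambda>i. F i (real j * \<tau>) - Fd j i))"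
  proof -
    have "(\<Sum>i. ennreal (\<tau>\<^sup>2) * (\<integral>\<^sup>+r\<in>?C j. ennreal ((F i r)\<^sup>2) \<partial>lebesgue)
        + ennreal (T\<^sup>2) * (\<integral>\<^sup>+r\<in>?C j. ennreal ((F i r - F i (real j * \<tau>))\<^sup>2) \<partial>lebesgue)
        + ennreal (T\<^sup>2 * \<tau>) * ennreal ((F i (real j * \<tau>) - Fd j i)\<^sup>2))
      = ennreal (\<tau>\<^sup>2) * (\<integral>\<^sup>+r\<in>?C j. ssq (\<lambda>i. F i r) \<partial>lebesgue)
        + ennreal (T\<^sup>2) * (\<integral>\<^sup>+r\<in>?C j. ssq (\<lambda>i. F i r - F i (real j * \<tau>)) \<partial>lebesgue)
        + ennreal (T\<^sup>2 * \<tau>) * ssq (\<lambda>i. F i (real j * \<tau>) - Fd j i)" for j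
    proof -
      have 1: "(\<Sum>i. \<integral>\<^sup>+r\<in>?C j. ennreal ((F i r)\<^sup>2) \<partial>lebesgue) = (\<integral>\<^sup>+r\<in>?C j. ssq (\<lambda>i. F i r) \<partial>lebesgue)"
        by (rule ssq_nn_integral) auto
      have 2: "(\<Sum>i. \<integral>\<^sup>+r\<in>?C j. ennreal ((F i r - F i (real j * \<tau>))\<^sup>2) \<partial>lebesgue)
          = (\<integral>\<^sup>+r\<in>?C j. ssq (\<lambda>i. F i r - F i (real j * \<tau>)) \<partial>lebesgue)"
        by (rule ssq_nn_integral) auto
      have 3: "(\<Sum>i. ennreal ((F i (real j * \<tau>) - Fd j i)\<^sup>2)) = ssq (\<lambda>i. F i (real j * \<tau>) - Fd j i)"
        by (simp add: ssq_def)
      have add3: "(\<Sum>i. A i + B i + C i) = suminf A + suminf B + suminf C" for A B C :: "nat \<Rightarrow> ennreal"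
        by (simp add: suminf_add[symmetric])
      show ?thesis by (simp only: add3 ennreal_suminf_cmult 1 2 3)
    qed
    then show ?thesis by (simp only: ennreal_suminf_cmult suminf_sum[OF summableI])
  qed
  also have "\<dots> = ennreal (3 * T) * (ennreal (\<tau>\<^sup>2) * (\<integral>\<^sup>+r\<in>{0..real n * \<tau>}. ssq (\<lambda>i. F i r) \<partial>lebesgue)
        + ennreal (T\<^sup>2) * (\<Sum>j<n. \<integral>\<^sup>+r\<in>?C j. ssq (\<lambda>i. F i r - F i (real j * \<tau>)) \<partial>lebesgue)
        + ennreal (T\<^sup>2 * \<tau>) * (\<Sum>j<n. ssq (\<lambda>i. F i (real j * \<tau>) - Fd j i)))"
    using nn_integral_grid_sum[of "\<lambda>r. ssq (\<lambda>i. F i r)" \<tau> n] \<tau>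
    by (simp add: sum.distrib sum_distrib_left[symmetric])
  also have "\<dots> \<le> ennreal (3 * T) * (ennreal (\<tau>\<^sup>2) * energy
        + ennreal (T\<^sup>2) * (ennreal (16 * L * T * \<tau> powr (2 * p)) * data + ennreal (4 * L) * Z_osc \<tau> n
          + ennreal (16 * L * T\<^sup>2 * \<tau>\<^sup>2) * energy)
        + ennreal (T\<^sup>2 * \<tau>) * (\<Sum>j<n. ennreal L * ssq (\<lambda>i. U i (real j * \<tau>) - un j i)))"
    using \<tau> n by (intro mult_left_mono add_mono cell_energy F_osc sum_mono Fd) auto
  finally have q_le: "ssq q \<le> ennreal (3 * T) * (ennreal (\<tau>\<^sup>2) * energy
        + ennreal (T\<^sup>2) * (ennreal (16 * L * T * \<tau> powr (2 * p)) * data + ennreal (4 * L) * Z_osc \<tau> n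
          + ennreal (16 * L * T\<^sup>2 * \<tau>\<^sup>2) * energy)
        + ennreal (T\<^sup>2 * \<tau>) * (\<Sum>j<n. ennreal L * ssq (\<lambda>i. U i (real j * \<tau>) - un j i)))" (is "_ \<le> ?R") .
  have "ssq (\<lambda>i. U i (real n * \<tau>) - un n i) \<le> 2 * ssq (\<lambda>i. Z i (real n * \<tau>) - zd n i) + 2 * ?R"
    by (rule order_trans[OF split]) (intro add_left_mono mult_left_mono q_le, simp)
  also have "\<dots> = 2 * ssq (\<lambda>i. Z i (real n * \<tau>) - zd n i)
      + ennreal ((6 * T + 96 * L * T ^ 5) * \<tau>\<^sup>2) * energy
      + ennreal (96 * L * T ^ 4 * \<tau> powr (2 * p)) * data
      + ennreal (24 * L * T ^ 3) * Z_osc \<tau> n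
      + ennreal (6 * L * T ^ 3 * \<tau>) * (\<Sum>j<n. ssq (\<lambda>i. U i (real j * \<tau>) - un j i))"
  proof -
    have e: "(6 * T + 96 * L * T ^ 5) * \<tau>\<^sup>2 = 2 * (3 * T) * \<tau>\<^sup>2 + 2 * (3 * T) * T\<^sup>2 * (16 * L * T\<^sup>2 * \<tau>\<^sup>2)"
      "96 * L * T ^ 4 * \<tau> powr (2 * p) = 2 * (3 * T) * T\<^sup>2 * (16 * L * T * \<tau> powr (2 * p))"
      "24 * L * T ^ 3 = 2 * (3 * T) * T\<^sup>2 * (4 * L)" "6 * L * T ^ 3 * \<tau> = 2 * (3 * T) * (T\<^sup>2 * \<tau>) * L"
      by (simp_all add: algebra_simps eval_nat_numeral)
    have two: "ennreal (2 * x) = 2 * ennreal x" for x by (simp add: ennreal_mult')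
    have E: "ennreal ((6 * T + 96 * L * T ^ 5) * \<tau>\<^sup>2)
          = 2 * ennreal (3 * T) * ennreal (\<tau>\<^sup>2) + 2 * ennreal (3 * T) * ennreal (T\<^sup>2) * ennreal (16 * L * T\<^sup>2 * \<tau>\<^sup>2)"
      "ennreal (96 * L * T ^ 4 * \<tau> powr (2 * p)) = 2 * ennreal (3 * T) * ennreal (T\<^sup>2) * ennreal (16 * L * T * \<tau> powr (2 * p))"
      "ennreal (24 * L * T ^ 3) = 2 * ennreal (3 * T) * ennreal (T\<^sup>2) * ennreal (4 * L)"
      "ennreal (6 * L * T ^ 3 * \<tau>) = 2 * ennreal (3 * T) * ennreal (T\<^sup>2 * \<tau>) * ennreal L"
      unfolding e using T const \<tau> by (simp_all add: two[symmetric] ennreal_mult'[symmetric] ennreal_plus[symmetric] del: ennreal_plus)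
    \<comment> \<open>All constants and norms are replaced by variables, so that regrouping uses
      distributivity only.\<close>
    have alg: "x + 2 * (c * (t * y + s * (d * D + l * Z + k * y) + u * (m * S)))
        = x + (2 * c * t + 2 * c * s * k) * y + 2 * c * s * d * D + 2 * c * s * l * Z + 2 * c * u * m * S"
      for x c t y s d D l Z k u m S :: ennreal
      by (simp add: distrib_left distrib_right mult.assoc add_ac)
    show ?thesis unfolding E sum_distrib_left[symmetric] by (rule alg)
  qed
  finally show ?thesis .
qed

end

text \<open>The partial sums of \<open>x\<close> grow by at most a factor \<open>1 + c\<close> per
  step, up to the added \<open>g\<close>. In \<open>ennreal\<close> infinite terms need no separate
  treatment.\<close>

lemma discrete_gronwall:
  fixes x g :: "nat \<Rightarrow> ennreal" and c :: ennreal
  assumes x: "\<And>n. n \<le> N \<Longrightarrow> x n \<le> g n + c * (\<Sum>j<n. x j)" and n: "n \<le> N"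
  shows "x n \<le> g n + c * ((1 + c) ^ n * (\<Sum>j<n. g j))"
proof -
  have "(\<Sum>j<m. x j) \<le> (1 + c) ^ m * (\<Sum>j<m. g j)" if "m \<le> N" for m
    using that
  proof (induction m)
    case (Suc m)
    have "(\<Sum>j<Suc m. x j) \<le> (\<Sum>j<m. x j) + (g m + c * (\<Sum>j<m. x j))"
      using x[of m] Suc.prems by (simp add: add_left_mono)
    also have "\<dots> = (1 + c) * (\<Sum>j<m. x j) + 1 * g m"
      by (simp add: distrib_right add_ac)
    also have "\<dots> \<le> (1 + c) * ((1 + c) ^ m * (\<Sum>j<m. g j)) + (1 + c) ^ Suc m * g m"
      using Suc by (intro add_mono mult_left_mono mult_right_mono one_le_power) auto
    also have "\<dots> = (1 + c) ^ Suc m * (\<Sum>j<Suc m. g j)"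
      by (simp add: distrib_left mult.assoc)
    finally show ?case .
  qed simp
  then show ?thesis
    using x[OF n] n by (meson add_left_mono mult_left_mono order_trans zero_le)
qed

section \<open>Expected noise\<close>

lemma expectation_ssq_le:
  fixes f :: "nat \<Rightarrow> 'w \<Rightarrow> real"
  assumes [measurable]: "\<And>i. f i \<in> borel_measurable M"
    and le: "\<And>i. (\<integral>\<^sup>+\<omega>. ennreal ((f i \<omega>)\<^sup>2) \<partial>M) \<le> ennreal (c * s i)"
    and s: "\<And>i. 0 \<le> s i" "summable s" and c: "0 \<le> c"
  shows "(\<integral>\<^sup>+\<omega>. ssq (\<lambda>i. f i \<omega>) \<partial>M) \<le> ennreal (c * suminf s)"
proof -
  have "(\<integral>\<^sup>+\<omega>. ssq (\<lambda>i. f i \<omega>) \<partial>M) = (\<Sum>i. \<integral>\<^sup>+\<omega>. ennreal ((f i \<omega>)\<^sup>2) \<partial>M)"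
    unfolding ssq_def by (rule nn_integral_suminf) measurable
  also have "\<dots> \<le> (\<Sum>i. ennreal (c * s i))"
    by (intro suminf_le le) auto
  also have "\<dots> = ennreal (\<Sum>i. c * s i)"
    using s c by (intro suminf_ennreal2 summable_mult) auto
  also have "(\<Sum>i. c * s i) = c * suminf s" using s by (intro suminf_mult) auto
  finally show ?thesis .
qed

text \<open>The summability condition is what the moment bound
  \<open>w powr (- 1 - 2 * H) * (w * \<tau>) powr (2 * p)\<close> leaves after
  \<open>\<tau> powr (2 * p)\<close> is split off. The bound \<open>p \<le> 1\<close> serves
  increments of the convolution, \<open>2 * p \<le> 1 + 2 * H\<close> the noise error.\<close>

locale fbm_modes = prob_space M for M :: "'w measure" +
  fixes H :: real and \<xi> :: "nat \<Rightarrow> 'w \<Rightarrow> real \<Rightarrow> real" and w q :: "nat \<Rightarrow> real" and w0 T p :: real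
  assumes fbm: "\<And>i. fbm M H (\<xi> i)" and H: "0 < H" "H < 1/2"
    and w0: "0 < w0" and w: "\<And>i. w0 \<le> w i" and q: "\<And>i. 0 \<le> q i" and T: "0 < T"
    and p: "0 \<le> p" "p \<le> 1" "2 * p \<le> 1 + 2 * H"
    and summ: "summable (\<lambda>i. q i * w i powr (2 * p - 1 - 2 * H))"
begin

definition \<sigma> :: real where "\<sigma> = (\<Sum>i. q i * w i powr (2 * p - 1 - 2 * H))"

text \<open>Frozen for negative times, so that paths are Borel functions on the whole line.\<close>

definition Z :: "nat \<Rightarrow> 'w \<Rightarrow> real \<Rightarrow> real" where
  "Z i \<omega> r = sqrt (q i) / w i * fbm_process.W (\<xi> i) (w i) 0 \<omega> (max 0 r)"

text \<open>By \<open>W_grid\<close> this is exactly the stochastic convolution at a grid time minus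
  the noise accumulated by the scheme; the \<open>1 / w\<close> of the kernel cancels the
  \<open>w\<close> in front of \<open>grid_error\<close>.\<close>

definition noise_error :: "real \<Rightarrow> nat \<Rightarrow> nat \<Rightarrow> 'w \<Rightarrow> real" where
  "noise_error \<tau> n i \<omega> = sqrt (q i) * fbm_process.grid_error (\<xi> i) (w i) 0 \<tau> n \<omega>"

lemma fbm_process: "fbm_process M H (\<xi> i)"
  by unfold_locales (use fbm H in auto)

lemma wpos: "0 < w i" using w0 w[of i] by simp

lemma \<sigma>_nonneg: "0 \<le> \<sigma>"
  unfolding \<sigma>_def using summ q by (intro suminf_nonneg) auto

lemma Z_meas[measurable]: "(\<lambda>\<omega>. Z i \<omega> r) \<in> borel_measurable M"
proof -
  have [measurable]: "(\<lambda>\<omega>. fbm_process.W (\<xi> i) (w i) 0 \<omega> (max 0 r)) \<in> borel_measurable M"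
    by (rule fbm_process.W_meas[OF fbm_process])
  show ?thesis unfolding Z_def by measurable
qed

lemma Z_joint[measurable]: "(\<lambda>x. Z i (fst x) (snd x)) \<in> borel_measurable (M \<Otimes>\<^sub>M lborel)"
proof -
  have [measurable]: "(\<lambda>x. fbm_process.W (\<xi> i) (w i) 0 (fst x) (max 0 (snd x))) \<in> borel_measurable (M \<Otimes>\<^sub>M lborel)"
    by (rule fbm_process.W_joint_meas[OF fbm_process]) auto
  show ?thesis unfolding Z_def by measurable
qed

lemma Z_path_meas: "\<omega> \<in> space M \<Longrightarrow> Z i \<omega> \<in> borel_measurable borel"
  using measurable_Pair2[OF Z_joint, of \<omega> i] by simp

lemma noise_error_meas:
  assumes "0 \<le> \<tau>" shows "noise_error \<tau> n i \<in> borel_measurable M"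
proof -
  have [measurable]: "fbm_process.grid_error (\<xi> i) (w i) 0 \<tau> n \<in> borel_measurable M"
    by (rule fbm_process.grid_error_meas[OF fbm_process assms])
  show ?thesis unfolding noise_error_def by measurable
qed

lemma Z_moment:
  assumes r: "r \<in> {0..T}"
  shows "(\<integral>\<^sup>+\<omega>. ssq (\<lambda>i. Z i \<omega> r) \<partial>M) \<le> ennreal (8 * (T + 1 / w0) * w0 powr (- 2 * p) * \<sigma>)"
  unfolding \<sigma>_def
proof (rule expectation_ssq_le[OF Z_meas _ _ summ])
  fix i
  let ?C = "8 * (T + 1 / w0)"
  have C: "0 \<le> ?C" using T w0 by simp
  have "(\<integral>\<^sup>+\<omega>. ennreal ((sqrt (q i) / w i * fbm_process.W (\<xi> i) (w i) 0 \<omega> (max 0 r))\<^sup>2) \<partial>M)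
      \<le> ennreal (q i / (w i)\<^sup>2 * (?C * w i powr (1 - 2 * H)))"
    using r w0 w q C
    by (intro nn_integral_square_scale_le fbm_process.W_meas[OF fbm_process] fbm_process.W_moment[OF fbm_process])
      (auto simp: power_divide)
  also have "\<dots> \<le> ennreal (?C * w0 powr (- 2 * p) * (q i * w i powr (2 * p - 1 - 2 * H)))"
  proof (rule ennreal_leI)
    \<comment> \<open>The size of the convolution is \<open>q * w powr (- 1 - 2 * H)\<close>. The
      excess factor \<open>w powr (- 2 * p)\<close> over the summable sequence is largest at
      \<open>w0\<close>.\<close>
    have "w i powr (1 - 2 * H) / (w i)\<^sup>2 = w i powr (- 2 * p) * w i powr (2 * p - 1 - 2 * H)"
    proof -
      have "w i powr (1 - 2 * H) / (w i)\<^sup>2 = w i powr (1 - 2 * H - 2)"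
        using wpos[of i] powr_diff[of "w i" "1 - 2 * H" 2] by (simp add: powr_numeral)
      then show ?thesis by (simp flip: powr_add)
    qed
    also have "\<dots> \<le> w0 powr (- 2 * p) * w i powr (2 * p - 1 - 2 * H)"
      using w0 w[of i] p by (intro mult_right_mono powr_mono2') auto
    finally have "?C * q i * (w i powr (1 - 2 * H) / (w i)\<^sup>2) \<le> ?C * q i * (w0 powr (- 2 * p) * w i powr (2 * p - 1 - 2 * H))"
      using C q by (intro mult_left_mono) auto
    then show "q i / (w i)\<^sup>2 * (?C * w i powr (1 - 2 * H)) \<le> ?C * w0 powr (- 2 * p) * (q i * w i powr (2 * p - 1 - 2 * H))"
      by (simp only: times_divide_eq_right times_divide_eq_left mult_ac)
  qed
  finally show "(\<integral>\<^sup>+\<omega>. ennreal ((Z i \<omega> r)\<^sup>2) \<partial>M) \<le> ennreal (?C * w0 powr (- 2 * p) * (q i * w i powr (2 * p - 1 - 2 * H)))"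
    by (simp add: Z_def)
qed (use T w0 q in auto)

text \<open>After division by the square of \<open>w i\<close>, the power
  \<open>w powr (2 * p)\<close> in the moment bound completes the summand of \<open>\<sigma>\<close>
  with no loss.\<close>

lemma Z_increment_moment:
  assumes st: "0 \<le> s" "s \<le> t" "t \<le> T"
  shows "(\<integral>\<^sup>+\<omega>. ssq (\<lambda>i. Z i \<omega> t - Z i \<omega> s) \<partial>M) \<le> ennreal (128 * (T + 1 / w0) * (t - s) powr (2 * p) * \<sigma>)"
  unfolding \<sigma>_def
proof (rule expectation_ssq_le[OF _ _ _ summ])
  fix i
  let ?C = "128 * (T + 1 / w0)"
  let ?W = "fbm_process.W (\<xi> i) (w i) 0"
  have C: "0 \<le> ?C" using T w0 by simp
  have [measurable]: "(\<lambda>\<omega>. ?W \<omega> r) \<in> borel_measurable M" for r by (rule fbm_process.W_meas[OF fbm_process])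
  have "(\<integral>\<^sup>+\<omega>. ennreal ((sqrt (q i) / w i * (?W \<omega> t - ?W \<omega> s))\<^sup>2) \<partial>M)
      \<le> ennreal (q i / (w i)\<^sup>2 * (?C * w i powr (1 - 2 * H) * (w i * (t - s)) powr (2 * p)))"
  proof (rule nn_integral_square_scale_le)
    show "(\<integral>\<^sup>+\<omega>. ennreal ((?W \<omega> t - ?W \<omega> s)\<^sup>2) \<partial>M) \<le> ennreal (?C * w i powr (1 - 2 * H) * (w i * (t - s)) powr (2 * p))"
      by (rule fbm_process.W_increment_moment[OF fbm_process w0 w st p(1,2)])
  qed (use C q in \<open>auto simp: power_divide\<close>)
  also have "q i / (w i)\<^sup>2 * (?C * w i powr (1 - 2 * H) * (w i * (t - s)) powr (2 * p))
      = ?C * (t - s) powr (2 * p) * (q i * w i powr (2 * p - 1 - 2 * H))"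
  proof -
    have 1: "w i powr (1 - 2 * H) / (w i)\<^sup>2 * w i powr (2 * p) = w i powr (2 * p - 1 - 2 * H)"
    proof -
      have "w i powr (1 - 2 * H) / (w i)\<^sup>2 = w i powr (1 - 2 * H - 2)"
        using wpos[of i] powr_diff[of "w i" "1 - 2 * H" 2] by (simp add: powr_numeral)
      moreover have "2 * p - 1 - 2 * H = (1 - 2 * H - 2) + 2 * p" by simp
      ultimately show ?thesis by (simp only: powr_add)
    qed
    have "q i / (w i)\<^sup>2 * (?C * w i powr (1 - 2 * H) * (w i * (t - s)) powr (2 * p))
        = ?C * (t - s) powr (2 * p) * (q i * (w i powr (1 - 2 * H) / (w i)\<^sup>2 * w i powr (2 * p)))"
      using st wpos[of i] by (simp add: powr_mult)
    then show ?thesis unfolding 1 .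
  qed
  finally show "(\<integral>\<^sup>+\<omega>. ennreal ((Z i \<omega> t - Z i \<omega> s)\<^sup>2) \<partial>M) \<le> ennreal (?C * (t - s) powr (2 * p) * (q i * w i powr (2 * p - 1 - 2 * H)))"
    using st by (simp add: Z_def right_diff_distrib)
qed (use T w0 q in auto)

lemma noise_error_moment:
  assumes \<tau>: "0 < \<tau>" "real n * \<tau> \<le> T"
  shows "(\<integral>\<^sup>+\<omega>. ssq (\<lambda>i. noise_error \<tau> n i \<omega>) \<partial>M) \<le> ennreal (20 * (T + 1 / w0) * \<tau> powr (2 * p) * \<sigma>)"
  unfolding \<sigma>_def
proof (rule expectation_ssq_le[OF noise_error_meas _ _ summ])
  fix i
  let ?C = "20 * (T + 1 / w0)"
  have C: "0 \<le> ?C" using T w0 by simp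
  have "(\<integral>\<^sup>+\<omega>. ennreal ((noise_error \<tau> n i \<omega>)\<^sup>2) \<partial>M)
      \<le> ennreal (q i * (?C * w i powr (- 1 - 2*H) * (w i * \<tau>) powr (2 * p)))"
    unfolding noise_error_def
    using C q \<tau> by (intro nn_integral_square_scale_le fbm_process.grid_error_meas[OF fbm_process]
        fbm_process.scheme_noise_moment[OF fbm_process w0 w \<tau> p(1,3)]) auto
  also have "q i * (?C * w i powr (- 1 - 2*H) * (w i * \<tau>) powr (2 * p))
      = ?C * \<tau> powr (2 * p) * (q i * (w i powr (- 1 - 2*H) * w i powr (2 * p)))"
    using \<tau> wpos[of i] by (simp add: powr_mult)
  also have "w i powr (- 1 - 2*H) * w i powr (2 * p) = w i powr (2 * p - 1 - 2 * H)"
  proof -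
    have "2 * p - 1 - 2 * H = (- 1 - 2 * H) + 2 * p" by simp
    then show ?thesis by (simp only: powr_add)
  qed
  finally show "(\<integral>\<^sup>+\<omega>. ennreal ((noise_error \<tau> n i \<omega>)\<^sup>2) \<partial>M) \<le> ennreal (?C * \<tau> powr (2 * p) * (q i * w i powr (2 * p - 1 - 2 * H)))" .
qed (use T w0 q \<tau> in auto)

lemma ssq_Z_joint[measurable]: "(\<lambda>x. ssq (\<lambda>i. Z i (fst x) (snd x))) \<in> borel_measurable (M \<Otimes>\<^sub>M lborel)"
  by measurable

lemma Z_joint_diff: "(\<lambda>x. ssq (\<lambda>i. Z i (fst x) (snd x) - Z i (fst x) s)) \<in> borel_measurable (M \<Otimes>\<^sub>M lborel)"
proof -
  have [measurable]: "(\<lambda>x. Z i (fst x) s) \<in> borel_measurable (M \<Otimes>\<^sub>M lborel)" for i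
    using measurable_compose[OF measurable_fst Z_meas] .
  show ?thesis by measurable
qed

lemma expectation_time_integral_le:
  fixes \<Phi> :: "'w \<Rightarrow> real \<Rightarrow> ennreal"
  assumes m[measurable]: "(\<lambda>x. \<Phi> (fst x) (snd x)) \<in> borel_measurable (M \<Otimes>\<^sub>M lborel)"
    and le: "\<And>r. r \<in> {s..t} \<Longrightarrow> (\<integral>\<^sup>+\<omega>. \<Phi> \<omega> r \<partial>M) \<le> ennreal c" and st: "s \<le> t" and c: "0 \<le> c"
  shows "(\<integral>\<^sup>+\<omega>. (\<integral>\<^sup>+r\<in>{s..t}. \<Phi> \<omega> r \<partial>lborel) \<partial>M) \<le> ennreal ((t - s) * c)"
proof -
  have "(\<integral>\<^sup>+\<omega>. \<integral>\<^sup>+r. \<Phi> \<omega> r * indicator {s..t} r \<partial>lborel \<partial>M)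
      = (\<integral>\<^sup>+r. \<integral>\<^sup>+\<omega>. \<Phi> \<omega> r * indicator {s..t} r \<partial>M \<partial>lborel)"
    by (rule pair_sigma_finite.Fubini'[symmetric])
      (auto simp: case_prod_beta pair_sigma_finite_def sigma_finite_measure_axioms lborel.sigma_finite_measure_axioms)
  also have "\<dots> \<le> (\<integral>\<^sup>+r. ennreal c * indicator {s..t} r \<partial>lborel)"
  proof (rule nn_integral_mono)
    fix r show "(\<integral>\<^sup>+\<omega>. \<Phi> \<omega> r * indicator {s..t} r \<partial>M) \<le> ennreal c * indicator {s..t} r"
      using le[of r] by (cases "r \<in> {s..t}") auto
  qed
  also have "\<dots> = ennreal ((t - s) * c)"
    using st c by (simp add: nn_integral_cmult ennreal_mult mult.commute)
  finally show ?thesis .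
qed

lemma time_integral_meas:
  fixes s t :: real
  assumes [measurable]: "(\<lambda>x. \<Phi> (fst x) (snd x)) \<in> borel_measurable (M \<Otimes>\<^sub>M lborel)"
  shows "(\<lambda>\<omega>. (\<integral>\<^sup>+r\<in>{s..t}. \<Phi> \<omega> r \<partial>lborel)) \<in> borel_measurable M"
proof -
  have "(\<lambda>x. \<Phi> (fst x) (snd x) * indicator {s..t} (snd x)) \<in> borel_measurable (M \<Otimes>\<^sub>M lborel)"
    by measurable
  then show ?thesis by (intro lborel.borel_measurable_nn_integral) (simp add: case_prod_beta)
qed

definition Z_osc :: "real \<Rightarrow> nat \<Rightarrow> 'w \<Rightarrow> ennreal" where
  "Z_osc \<tau> n \<omega> = (\<Sum>j<n. \<integral>\<^sup>+r\<in>cell \<tau> j. ssq (\<lambda>i. Z i \<omega> r - Z i \<omega> (real j * \<tau>)) \<partial>lborel)"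

lemma Z_osc_meas[measurable]: "Z_osc \<tau> n \<in> borel_measurable M"
  unfolding Z_osc_def by (intro borel_measurable_sum time_integral_meas Z_joint_diff)

lemma Z_osc_moment:
  assumes \<tau>: "0 < \<tau>" "real n * \<tau> \<le> T"
  shows "(\<integral>\<^sup>+\<omega>. Z_osc \<tau> n \<omega> \<partial>M) \<le> ennreal (128 * T * (T + 1 / w0) * \<tau> powr (2 * p) * \<sigma>)"
proof -
  define c where "c = 128 * (T + 1 / w0) * \<tau> powr (2 * p) * \<sigma>"
  have c: "0 \<le> c" using T w0 \<sigma>_nonneg by (simp add: c_def)
  have "(\<integral>\<^sup>+\<omega>. Z_osc \<tau> n \<omega> \<partial>M) = (\<Sum>j<n. \<integral>\<^sup>+\<omega>. (\<integral>\<^sup>+r\<in>cell \<tau> j.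
      ssq (\<lambda>i. Z i \<omega> r - Z i \<omega> (real j * \<tau>)) \<partial>lborel) \<partial>M)"
    unfolding Z_osc_def by (intro nn_integral_sum time_integral_meas Z_joint_diff)
  also have "\<dots> \<le> (\<Sum>j<n. ennreal ((real (Suc j) * \<tau> - real j * \<tau>) * c))"
  proof (intro sum_mono expectation_time_integral_le Z_joint_diff c)
    fix j assume "j \<in> {..<n}"
    then have "real (Suc j) \<le> real n" by simp
    then have jT: "real (Suc j) * \<tau> \<le> T" using \<tau> by (meson mult_right_mono less_imp_le order_trans)
    show "real j * \<tau> \<le> real (Suc j) * \<tau>" using \<tau> by (intro mult_right_mono) auto
    fix r assume "r \<in> (cell \<tau> j)"
    then have r: "real j * \<tau> \<le> r" "r \<le> real (Suc j) * \<tau>" by auto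
    have "r - real j * \<tau> \<le> \<tau>" using r by (simp add: algebra_simps)
    then have "(r - real j * \<tau>) powr (2 * p) \<le> \<tau> powr (2 * p)" using r p by (intro powr_mono2) auto
    then have "128 * (T + 1 / w0) * (r - real j * \<tau>) powr (2 * p) * \<sigma> \<le> c"
      unfolding c_def using T w0 \<sigma>_nonneg by (intro mult_right_mono mult_left_mono) auto
    moreover have "(\<integral>\<^sup>+\<omega>. ssq (\<lambda>i. Z i \<omega> r - Z i \<omega> (real j * \<tau>)) \<partial>M)
        \<le> ennreal (128 * (T + 1 / w0) * (r - real j * \<tau>) powr (2 * p) * \<sigma>)"
      using r jT \<tau> by (intro Z_increment_moment) auto
    ultimately show "(\<integral>\<^sup>+\<omega>. ssq (\<lambda>i. Z i \<omega> r - Z i \<omega> (real j * \<tau>)) \<partial>M) \<le> ennreal c"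
      by (meson ennreal_leI order_trans)
  qed
  also have "\<dots> = (\<Sum>j<n. ennreal (\<tau> * c))" by (simp add: algebra_simps)
  also have "\<dots> = ennreal (real n * (\<tau> * c))"
    using \<tau> c by (simp add: ennreal_mult ennreal_of_nat_eq_real_of_nat)
  also have "\<dots> \<le> ennreal (T * c)"
    using mult_right_mono[OF \<tau>(2) c] by (intro ennreal_leI) (simp add: mult.assoc)
  finally show ?thesis by (simp add: c_def mult_ac)
qed

end

section \<open>The scheme in spectral coordinates\<close>

text \<open>Discrete variation of constants: in the coordinates \<open>x\<close> and
  \<open>y / w\<close> a step is a rotation by \<open>w * \<tau>\<close>. Both components have to be
  carried through the induction although only \<open>x\<close> is needed. A source in step
  \<open>j\<close> enters at its end, so it is propagated over \<open>n - Suc j\<close>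
  steps.\<close>

lemma trig_recursion:
  fixes x y g h :: "nat \<Rightarrow> real" and w \<tau> :: real
  assumes w: "w \<noteq> 0"
    and x: "\<And>n. n < N \<Longrightarrow> x (Suc n) = cos (w * \<tau>) * x n + sin (w * \<tau>) / w * y n + g n"
    and y: "\<And>n. n < N \<Longrightarrow> y (Suc n) = - (w * sin (w * \<tau>) * x n) + cos (w * \<tau>) * y n + h n"
    and n: "n \<le> N"
  shows "x n = cos (w * (real n * \<tau>)) * x 0 + sin (w * (real n * \<tau>)) / w * y 0
      + (\<Sum>j<n. cos (w * (real n * \<tau> - real (Suc j) * \<tau>)) * g j + sin (w * (real n * \<tau> - real (Suc j) * \<tau>)) / w * h j)"
proof -
  define C where "C s = cos (w * s)" for s
  define S where "S s = sin (w * s)" for s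
  have C: "C (s + \<tau>) = C s * C \<tau> - S s * S \<tau>" and S: "S (s + \<tau>) = S s * C \<tau> + C s * S \<tau>" for s
    by (simp_all add: C_def S_def distrib_left cos_add sin_add)
  have sh: "real (Suc m) * \<tau> = real m * \<tau> + \<tau>" "real m * \<tau> + \<tau> - s = (real m * \<tau> - s) + \<tau>" for m s
    by (simp_all add: algebra_simps)
  define d where "d m j = real m * \<tau> - real (Suc j) * \<tau>" for m j
  have d: "d (Suc m) j = d m j + \<tau>" "d (Suc m) m = 0" for m j by (simp_all add: d_def algebra_simps)
  have "x n = C (real n * \<tau>) * x 0 + S (real n * \<tau>) / w * y 0 + (\<Sum>j<n. C (d n j) * g j + S (d n j) / w * h j)
    \<and> y n = - (w * S (real n * \<tau>) * x 0) + C (real n * \<tau>) * y 0 + (\<Sum>j<n. - (w * S (d n j) * g j) + C (d n j) * h j)"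
    using n
  proof (induction n)
    case 0
    then show ?case by (simp add: C_def S_def)
  next
    case (Suc m)
    define A where "A = (\<Sum>j<m. C (d m j) * g j + S (d m j) / w * h j)"
    define B where "B = (\<Sum>j<m. - (w * S (d m j) * g j) + C (d m j) * h j)"
    have IH: "x m = C (real m * \<tau>) * x 0 + S (real m * \<tau>) / w * y 0 + A"
      "y m = - (w * S (real m * \<tau>) * x 0) + C (real m * \<tau>) * y 0 + B" using Suc by (auto simp: A_def B_def)
    have X: "(\<Sum>j<m. C (d m j + \<tau>) * g j + S (d m j + \<tau>) / w * h j) = C \<tau> * A + S \<tau> / w * B"
      unfolding A_def B_def sum_distrib_left sum.distrib[symmetric] C S using w
      by (intro sum.cong) (auto simp: field_simps)
    have Y: "(\<Sum>j<m. - (w * S (d m j + \<tau>) * g j) + C (d m j + \<tau>) * h j) = - (w * S \<tau>) * A + C \<tau> * B"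
      unfolding A_def B_def sum_distrib_left sum.distrib[symmetric] C S using w
      by (intro sum.cong) (auto simp: field_simps)
    have 0: "C 0 = 1" "S 0 = 0" by (simp_all add: C_def S_def)
    have SX: "(\<Sum>j<Suc m. C (d (Suc m) j) * g j + S (d (Suc m) j) / w * h j) = C \<tau> * A + S \<tau> / w * B + g m"
      unfolding sum.lessThan_Suc d(2) 0 unfolding d(1) X by simp
    have SY: "(\<Sum>j<Suc m. - (w * S (d (Suc m) j) * g j) + C (d (Suc m) j) * h j) = - (w * S \<tau>) * A + C \<tau> * B + h m"
      unfolding sum.lessThan_Suc d(2) 0 unfolding d(1) Y by simp
    have "x (Suc m) = C \<tau> * x m + S \<tau> / w * y m + g m" using x[of m] Suc by (simp add: C_def S_def)
    also have "\<dots> = C (real (Suc m) * \<tau>) * x 0 + S (real (Suc m) * \<tau>) / w * y 0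
        + (\<Sum>j<Suc m. C (d (Suc m) j) * g j + S (d (Suc m) j) / w * h j)"
      unfolding IH SX sh C S using w by (simp add: field_simps)
    finally have 1: "x (Suc m) = \<dots>" .
    have "y (Suc m) = - (w * S \<tau> * x m) + C \<tau> * y m + h m" using y[of m] Suc by (simp add: C_def S_def)
    also have "\<dots> = - (w * S (real (Suc m) * \<tau>) * x 0) + C (real (Suc m) * \<tau>) * y 0
        + (\<Sum>j<Suc m. - (w * S (d (Suc m) j) * g j) + C (d (Suc m) j) * h j)"
      unfolding IH SY sh C S using w by (simp add: field_simps)
    finally show ?case using 1 by simp
  qed
  then show ?thesis by (simp only: C_def S_def d_def)
qed

lemma integral_cos_cell:
  fixes w :: real
  assumes "w \<noteq> 0" "0 \<le> \<tau>"
  shows "integral (cell \<tau> j) (\<lambda>r. cos (w * (real (Suc j) * \<tau> - r)) * c) = sin (w * \<tau>) / w * c"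
proof -
  have "real j * \<tau> \<le> real (Suc j) * \<tau>" using assms by (intro mult_right_mono) auto
  from integral_cos_phase[OF this assms(1), of "real (Suc j) * \<tau>" 0]
  have "integral (cell \<tau> j) (\<lambda>r. cos (w * (real (Suc j) * \<tau> - r))) = sin (w * \<tau>) / w"
    by (simp add: algebra_simps)
  then show ?thesis by simp
qed

lemma integral_sin_cell:
  fixes w :: real
  assumes "w \<noteq> 0" "0 \<le> \<tau>"
  shows "integral (cell \<tau> j) (\<lambda>r. w * sin (w * (real (Suc j) * \<tau> - r)) * c) = (1 - cos (w * \<tau>)) * c"
proof -
  have "real j * \<tau> \<le> real (Suc j) * \<tau>" using assms by (intro mult_right_mono) auto
  \<comment> \<open>The phase \<open>- (pi/2)\<close> turns the cosine integral into the sine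
    integral.\<close>
  moreover have "cos (y + - (pi/2)) = sin y" "sin (y + - (pi/2)) = - cos y" for y :: real
    by (simp_all add: cos_diff sin_diff)
  ultimately have "integral (cell \<tau> j) (\<lambda>r. sin (w * (real (Suc j) * \<tau> - r)))
      = (- cos (w * (real (Suc j) * \<tau> - real j * \<tau>)) - - cos (w * (real (Suc j) * \<tau> - real (Suc j) * \<tau>))) / w"
    using integral_cos_phase[of "real j * \<tau>" "real (Suc j) * \<tau>" w "real (Suc j) * \<tau>" "- (pi/2)"] assms(1)
    by (simp only: simp_thms)
  moreover have "real (Suc j) * \<tau> - real j * \<tau> = \<tau>" by (simp add: algebra_simps)
  ultimately have "integral (cell \<tau> j) (\<lambda>r. sin (w * (real (Suc j) * \<tau> - r))) = (1 - cos (w * \<tau>)) / w"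
    by simp
  then show ?thesis using assms(1) by (simp add: mult.assoc)
qed

text \<open>One mode of one step of the scheme, with \<open>c\<close> the square root of
  \<open>q\<close> and \<open>x\<close> the path. It is kept in the literal form of the
  scheme.\<close>

definition scheme_step :: "real \<Rightarrow> real \<Rightarrow> real \<Rightarrow> (real \<Rightarrow> real) \<Rightarrow> nat \<Rightarrow> real \<Rightarrow> real \<Rightarrow> real \<Rightarrow> real \<Rightarrow> real \<Rightarrow> bool" where
  "scheme_step w c \<tau> x j X Y F X' Y' \<longleftrightarrow>
      X' = cos (w * \<tau>) * X + sin (w * \<tau>) / w * Y + \<tau> * sin (w * \<tau>) / w * F
        - sin (w * \<tau>) / w * (c * x (real j * \<tau>))
        + integral (cell \<tau> j) (\<lambda>r. cos (w * (real (Suc j) * \<tau> - r)) * (c * x (real j * \<tau>)))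
    \<and> Y' = - (w * sin (w * \<tau>) * X) + cos (w * \<tau>) * Y + \<tau> * cos (w * \<tau>) * F
        + c * x (real (Suc j) * \<tau>) - cos (w * \<tau>) * (c * x (real j * \<tau>))
        - integral (cell \<tau> j) (\<lambda>r. w * sin (w * (real (Suc j) * \<tau> - r)) * (c * x (real j * \<tau>)))"

text \<open>Since \<open>\<integral> cos (w (t\<^sub>j\<^sub>+\<^sub>1 - r)) dr = sin (w \<tau>) / w\<close> over a cell, the noise cancels in the
  position update and enters the velocity update through the increment of \<open>x\<close> only.\<close>

lemma scheme_solution:
  fixes X Y F :: "nat \<Rightarrow> real" and x :: "real \<Rightarrow> real" and w \<tau> c :: real
  assumes w: "w \<noteq> 0" and \<tau>: "0 \<le> \<tau>"
    and step: "\<And>n. n < N \<Longrightarrow> scheme_step w c \<tau> x n (X n) (Y n) (F n) (X (Suc n)) (Y (Suc n))"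
    and n: "n \<le> N"
  shows "X n = cos (w * (real n * \<tau>)) * X 0 + sin (w * (real n * \<tau>)) / w * Y 0
      + (\<Sum>j<n. \<tau> * (sin (w * (real n * \<tau> - real j * \<tau>)) / w) * F j)
      + c / w * (\<Sum>j<n. sin (w * (real n * \<tau> - real (Suc j) * \<tau>)) * (x (real (Suc j) * \<tau>) - x (real j * \<tau>)))"
proof -
  have "X n = cos (w * (real n * \<tau>)) * X 0 + sin (w * (real n * \<tau>)) / w * Y 0
      + (\<Sum>j<n. cos (w * (real n * \<tau> - real (Suc j) * \<tau>)) * (\<tau> * sin (w * \<tau>) / w * F j)
          + sin (w * (real n * \<tau> - real (Suc j) * \<tau>)) / w * (\<tau> * cos (w * \<tau>) * F j + c * (x (real (Suc j) * \<tau>) - x (real j * \<tau>))))"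
  proof (rule trig_recursion[OF w _ _ n, where y=Y and \<tau>=\<tau>])
    fix m assume m: "m < N"
    show "X (Suc m) = cos (w * \<tau>) * X m + sin (w * \<tau>) / w * Y m + \<tau> * sin (w * \<tau>) / w * F m"
      using step[OF m, unfolded scheme_step_def integral_cos_cell[OF w \<tau>], THEN conjunct1] by simp
    show "Y (Suc m) = - (w * sin (w * \<tau>) * X m) + cos (w * \<tau>) * Y m + (\<tau> * cos (w * \<tau>) * F m + c * (x (real (Suc m) * \<tau>) - x (real m * \<tau>)))"
      using step[OF m, unfolded scheme_step_def integral_sin_cell[OF w \<tau>], THEN conjunct2] by (simp add: algebra_simps)
  qed
  also have "(\<Sum>j<n. cos (w * (real n * \<tau> - real (Suc j) * \<tau>)) * (\<tau> * sin (w * \<tau>) / w * F j)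
          + sin (w * (real n * \<tau> - real (Suc j) * \<tau>)) / w * (\<tau> * cos (w * \<tau>) * F j + c * (x (real (Suc j) * \<tau>) - x (real j * \<tau>))))
      = (\<Sum>j<n. \<tau> * (sin (w * (real n * \<tau> - real j * \<tau>)) / w) * F j)
      + c / w * (\<Sum>j<n. sin (w * (real n * \<tau> - real (Suc j) * \<tau>)) * (x (real (Suc j) * \<tau>) - x (real j * \<tau>)))"
    unfolding sum_distrib_left sum.distrib[symmetric]
  proof (rule sum.cong[OF refl])
    fix j
    define s where "s = w * (real n * \<tau> - real (Suc j) * \<tau>)"
    \<comment> \<open>The shares of \<open>F j\<close> in the position and velocity updates merge by
      the addition formula, which moves the kernel from the right end of the cell to its left
      end.\<close>
    have "w * (real n * \<tau> - real j * \<tau>) = s + w * \<tau>" by (simp add: s_def algebra_simps)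
    then have "sin (w * (real n * \<tau> - real j * \<tau>)) = sin s * cos (w * \<tau>) + cos s * sin (w * \<tau>)"
      by (simp add: sin_add)
    then show "cos (w * (real n * \<tau> - real (Suc j) * \<tau>)) * (\<tau> * sin (w * \<tau>) / w * F j)
          + sin (w * (real n * \<tau> - real (Suc j) * \<tau>)) / w * (\<tau> * cos (w * \<tau>) * F j + c * (x (real (Suc j) * \<tau>) - x (real j * \<tau>)))
      = \<tau> * (sin (w * (real n * \<tau> - real j * \<tau>)) / w) * F j
        + c / w * (sin (w * (real n * \<tau> - real (Suc j) * \<tau>)) * (x (real (Suc j) * \<tau>) - x (real j * \<tau>)))"
      unfolding s_def[symmetric] using w by (simp add: field_simps)
  qed
  finally show ?thesis by simp
qed

text \<open>The kernel vanishes at \<open>r = t\<close>, so only the boundary term at 0 survives;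
  the bracket is \<open>W\<close> at phase 0.\<close>

lemma stoch_int_sin:
  fixes w :: real
  assumes "w \<noteq> 0"
  shows "stoch_int (\<lambda>r. sin (w * (t - r)) / w) 0 t x
    = (1 / w) * (- (sin (w * t) * x 0) + w * integral {0..t} (\<lambda>r. cos (w * (t - r)) * x r))"
proof -
  have "deriv (\<lambda>r. sin (w * (t - r)) / w) r = - cos (w * (t - r))" for r
    using assms by (intro DERIV_imp_deriv) (auto intro!: derivative_eq_intros)
  then show ?thesis using assms by (simp add: stoch_int_def field_simps)
qed

section \<open>The nonlinearity in spectral coordinates\<close>

context
  fixes D :: "(real^'d::finite) set" and lam :: "nat \<Rightarrow> real" and \<phi> :: "nat \<Rightarrow> real^'d \<Rightarrow> real"
  assumes D: "open D" "bounded D" and eig: "dirichlet_eigenbasis D lam \<phi>"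
begin

lemma finite_measure_D: "finite_measure (lebesgue_on D)"
  using D by (intro finite_measure_lebesgue_on lmeasurable_open) auto

lemma sq_int_iff: "sq_int D u \<longleftrightarrow> sq_integrable (lebesgue_on D) u"
  by (simp add: sq_int_def sq_integrable_def)

lemma sq_int_basis: "sq_integrable (lebesgue_on D) (\<phi> i)"
  using eig by (simp add: dirichlet_eigenbasis_def sq_int_iff)

text \<open>Translates between integrals over \<open>D\<close>, where \<open>f\<close> acts
  pointwise, and coefficients, where the equation is diagonal.\<close>

lemma coef_Parseval:
  assumes "sq_int D u"
  shows "ssq (coef D \<phi> u) = ennreal (LINT x|lebesgue_on D. (u x)\<^sup>2)"
proof -
  have S: "(\<lambda>i. (LINT x|lebesgue_on D. u x * \<phi> i x)\<^sup>2) sums (LINT x|lebesgue_on D. (u x)\<^sup>2)"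
  proof (rule Parseval_orthonormal_basis[OF finite_measure_D sq_int_basis])
    show "(LINT x|lebesgue_on D. \<phi> j x * \<phi> i x) = (if i = j then 1 else 0)" for i j
      using eig by (simp add: dirichlet_eigenbasis_def coef_def)
    show "AE x in lebesgue_on D. v x = 0"
      if "sq_integrable (lebesgue_on D) v" "\<And>i. (LINT x|lebesgue_on D. v x * \<phi> i x) = 0" for v
      using eig that by (simp add: dirichlet_eigenbasis_def coef_def sq_int_iff)
  qed (use assms in \<open>simp add: sq_int_iff\<close>)
  have "(\<Sum>i. ennreal ((LINT x|lebesgue_on D. u x * \<phi> i x)\<^sup>2)) = ennreal (\<Sum>i. (LINT x|lebesgue_on D. u x * \<phi> i x)\<^sup>2)"
    by (rule suminf_ennreal2[OF _ sums_summable[OF S]]) (rule zero_le_power2)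
  also have "(\<Sum>i. (LINT x|lebesgue_on D. u x * \<phi> i x)\<^sup>2) = (LINT x|lebesgue_on D. (u x)\<^sup>2)"
    by (rule sums_unique[OF S, symmetric])
  finally show ?thesis by (simp only: ssq_def coef_def)
qed

lemma coef_diff:
  assumes "sq_int D u" "sq_int D v"
  shows "coef D \<phi> (\<lambda>x. u x - v x) i = coef D \<phi> u i - coef D \<phi> v i"
  using sq_integrable_mult[OF _ sq_int_basis, of u i] sq_integrable_mult[OF _ sq_int_basis, of v i] assms
  by (simp add: coef_def sq_int_iff left_diff_distrib)

lemma ssq_coef_diff:
  assumes "sq_int D u" "sq_int D v"
  shows "ssq (\<lambda>i. coef D \<phi> u i - coef D \<phi> v i) = ennreal (LINT x|lebesgue_on D. (u x - v x)\<^sup>2)"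
proof -
  have "sq_int D (\<lambda>x. u x - v x)" using assms sq_integrable_diff by (auto simp: sq_int_iff)
  from coef_Parseval[OF this] show ?thesis using coef_diff[OF assms] by (simp add: fun_eq_iff ssq_def)
qed

context
  fixes f :: "real \<Rightarrow> real" and L :: real
  assumes lip: "\<And>x y. \<bar>f x - f y\<bar> \<le> L * \<bar>x - y\<bar>"
begin

text \<open>Squaring lets \<open>L\<close> enter only as \<open>L\<^sup>2\<close>, so its sign needs
  no discussion.\<close>

lemma lip_sq: "(f x - f y)\<^sup>2 \<le> L\<^sup>2 * (x - y)\<^sup>2"
proof -
  have "\<bar>f x - f y\<bar> \<le> \<bar>L * (x - y)\<bar>"
    using order_trans[OF lip[of x y] mult_right_mono[OF abs_ge_self[of L] abs_ge_zero[of "x - y"]]]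
    by (simp only: abs_mult)
  then show ?thesis by (simp add: abs_le_square_iff power_mult_distrib)
qed

lemma growth_sq: "(f x)\<^sup>2 \<le> 2 * L\<^sup>2 * x\<^sup>2 + 2 * (f 0)\<^sup>2"
proof -
  have "(f x)\<^sup>2 \<le> 2 * (f x - f 0)\<^sup>2 + 2 * (f 0)\<^sup>2"
    using sum_squares_bound[of "f x - f 0" "f 0"] power2_sum[of "f x - f 0" "f 0"] by simp
  then show ?thesis using lip_sq[of x 0] by simp
qed

lemma sq_int_compose:
  assumes "sq_int D u"
  shows "sq_int D (\<lambda>x. f (u x))"
proof -
  interpret finite_measure "lebesgue_on D" by (rule finite_measure_D)
  have "isCont f x" for x
  proof -
    have "((\<lambda>y. f y - f x) \<longlongrightarrow> 0) (at x)"
    proof (rule tendsto_0_le[where K=1])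
      show "((\<lambda>y. L * \<bar>y - x\<bar>) \<longlongrightarrow> 0) (at x)" by (auto intro!: tendsto_eq_intros)
      show "\<forall>\<^sub>F y in at x. norm (f y - f x) \<le> norm (L * \<bar>y - x\<bar>) * 1"
        using order_trans[OF lip abs_ge_self] by (intro always_eventually allI) simp
    qed
    then show ?thesis by (simp add: isCont_def Lim_null[of f])
  qed
  then have [measurable]: "f \<in> borel_measurable borel"
    by (intro borel_measurable_continuous_onI continuous_at_imp_continuous_on) auto
  have [measurable]: "u \<in> borel_measurable (lebesgue_on D)" using assms by (simp add: sq_int_def)
  have "integrable (lebesgue_on D) (\<lambda>x. (f (u x))\<^sup>2)"
  proof (rule Bochner_Integration.integrable_bound)
    show "integrable (lebesgue_on D) (\<lambda>x. 2 * L\<^sup>2 * (u x)\<^sup>2 + 2 * (f 0)\<^sup>2)"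
      using assms by (auto simp: sq_int_def)
    show "AE x in lebesgue_on D. norm ((f (u x))\<^sup>2) \<le> norm (2 * L\<^sup>2 * (u x)\<^sup>2 + 2 * (f 0)\<^sup>2)"
      using growth_sq by (intro AE_I2) simp
  qed measurable
  then show ?thesis by (simp add: sq_int_def)
qed

lemma ssq_coef_lipschitz:
  assumes u: "sq_int D u" and v: "sq_int D v"
  shows "ssq (\<lambda>i. coef D \<phi> (\<lambda>x. f (u x)) i - coef D \<phi> (\<lambda>x. f (v x)) i)
      \<le> ennreal (L\<^sup>2) * ssq (\<lambda>i. coef D \<phi> u i - coef D \<phi> v i)"
proof -
  have i: "sq_integrable (lebesgue_on D) (\<lambda>x. u x - v x)"
    "sq_integrable (lebesgue_on D) (\<lambda>x. f (u x) - f (v x))"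
    using u v sq_int_compose by (auto simp: sq_int_iff intro!: sq_integrable_diff)
  have "(LINT x|lebesgue_on D. (f (u x) - f (v x))\<^sup>2) \<le> (LINT x|lebesgue_on D. L\<^sup>2 * (u x - v x)\<^sup>2)"
    using i lip_sq by (intro integral_mono) (auto simp: sq_integrable_def)
  then show ?thesis
    by (simp add: ssq_coef_diff u v sq_int_compose ennreal_mult[symmetric] ennreal_leI)
qed

text \<open>The constant part of the growth bound has a finite integral because \<open>D\<close> is
  bounded, which produces the measure of \<open>D\<close>.\<close>

lemma ssq_coef_growth:
  assumes u: "sq_int D u"
  shows "ssq (coef D \<phi> (\<lambda>x. f (u x))) \<le> ennreal (2 * L\<^sup>2) * ssq (coef D \<phi> u) + ennreal (2 * (f 0)\<^sup>2 * measure lebesgue D)"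
proof -
  interpret finite_measure "lebesgue_on D" by (rule finite_measure_D)
  have Dm: "D \<in> sets lebesgue" using D by simp
  have i: "integrable (lebesgue_on D) (\<lambda>x. (u x)\<^sup>2)" "integrable (lebesgue_on D) (\<lambda>x. (f (u x))\<^sup>2)"
    using u sq_int_compose[OF u] by (auto simp: sq_int_def)
  have "(LINT x|lebesgue_on D. (f (u x))\<^sup>2) \<le> (LINT x|lebesgue_on D. 2 * L\<^sup>2 * (u x)\<^sup>2 + 2 * (f 0)\<^sup>2)"
    using i growth_sq by (intro integral_mono) auto
  also have "\<dots> = 2 * L\<^sup>2 * (LINT x|lebesgue_on D. (u x)\<^sup>2) + 2 * (f 0)\<^sup>2 * measure lebesgue D"
    using i Dm by (simp add: measure_restrict_space space_restrict_space)
  finally show ?thesis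
    by (simp add: coef_Parseval u sq_int_compose ennreal_mult[symmetric] ennreal_plus[symmetric] ennreal_leI del: ennreal_plus)
qed

end

end

section \<open>Error of the scheme\<close>

lemma power_le_exp:
  fixes c :: real
  assumes "0 \<le> c"
  shows "(1 + c) ^ n \<le> exp (c * n)"
proof -
  have "(1 + c) ^ n \<le> exp c ^ n" using assms exp_ge_add_one_self[of c] by (intro power_mono) auto
  then show ?thesis by (simp add: exp_of_nat_mult[symmetric] mult.commute)
qed

context fbm_modes
begin

text \<open>The inhomogeneity of \<open>error_recursion\<close>, with the energy already replaced by
  its Gronwall bound. It depends on the sample point only through the data and the noise, hence is
  measurable for measurable data.\<close>

definition majorant :: "real \<Rightarrow> real \<Rightarrow> real \<Rightarrow> (nat \<Rightarrow> real) \<Rightarrow> (nat \<Rightarrow> real) \<Rightarrow> real \<Rightarrow> nat \<Rightarrow> 'w \<Rightarrow> ennreal" where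
  "majorant L G0 G1 a b \<tau> n \<omega> = 2 * ssq (\<lambda>i. noise_error \<tau> n i \<omega>)
        + ennreal ((6 * T + 96 * L * T ^ 5) * \<tau>\<^sup>2) * (ennreal (exp (4 * G1 * T ^ 3 * T))
            * (\<integral>\<^sup>+r\<in>{0..T}. (ennreal G0 + ennreal (4 * G1) * (ssq a + ssq (\<lambda>i. b i / w i)
                + ssq (\<lambda>i. Z i \<omega> r))) \<partial>lborel))
        + ennreal (96 * L * T ^ 4 * \<tau> powr (2 * p)) * (ssq (\<lambda>i. w i powr p * a i) + ssq (\<lambda>i. w i powr p * (b i / w i)))
        + ennreal (24 * L * T ^ 3) * Z_osc \<tau> n \<omega>"

text \<open>The constant is fixed before the mesh, the data and the error sequence. The family
  \<open>x\<close> is merely assumed to satisfy the recursion almost surely: Gronwall's argument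
  runs for fixed sample points, and expectations are taken of the resulting bound. A single
  \<open>R\<close> controls the data both with and without the weight
  \<open>w powr p\<close>.\<close>

lemma expected_error:
  fixes L G0 G1 :: real
  assumes const: "0 \<le> L" "0 \<le> G0" "0 \<le> G1"
  obtains C where "0 \<le> C" and "\<And>N \<tau> R n x a b. 0 < \<tau> \<Longrightarrow> real N * \<tau> \<le> T \<Longrightarrow> 0 < N \<Longrightarrow> 0 \<le> R \<Longrightarrow> n \<le> N \<Longrightarrow>
     (\<And>i. a i \<in> borel_measurable M) \<Longrightarrow> (\<And>i. b i \<in> borel_measurable M) \<Longrightarrow>
     (\<integral>\<^sup>+\<omega>. ssq (\<lambda>i. a i \<omega>) + ssq (\<lambda>i. b i \<omega> / w i) \<partial>M) \<le> ennreal R \<Longrightarrow>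
     (\<integral>\<^sup>+\<omega>. ssq (\<lambda>i. w i powr p * a i \<omega>) + ssq (\<lambda>i. w i powr p * (b i \<omega> / w i)) \<partial>M) \<le> ennreal R \<Longrightarrow>
     (AE \<omega> in M. \<forall>n\<le>N. x n \<omega> \<le> majorant L G0 G1 (\<lambda>i. a i \<omega>) (\<lambda>i. b i \<omega>) \<tau> n \<omega>
        + ennreal (6 * L * T ^ 3 * \<tau>) * (\<Sum>j<n. x j \<omega>)) \<Longrightarrow>
     (\<integral>\<^sup>+\<omega>. x n \<omega> \<partial>M) \<le> ennreal (C * \<tau> powr (2 * p) * (1 + R))"
proof -
  define V where "V = 8 * (T + 1 / w0) * w0 powr (- 2 * p) * \<sigma>"
  define K1 where "K1 = exp (4 * G1 * T ^ 3 * T)"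
  define CT where "CT = (T + 1 / w0) * \<sigma>"
  define e1 where "e1 = 6 * T + 96 * L * T ^ 5"
  \<comment> \<open>The four summands are the four terms of \<open>majorant\<close> after the factor
    \<open>\<tau> powr (2 * p) * (1 + R)\<close> is taken out.\<close>
  define C0 where "C0 = 40 * CT + e1 * T powr (2 - 2 * p) * (K1 * (T * (G0 + 4 * G1 * (1 + V)))) + 96 * L * T ^ 4
      + 24 * L * T ^ 3 * (128 * T * CT)"
  define C where "C = C0 * (1 + 6 * L * T ^ 4 * exp (6 * L * T ^ 4))"
  have V: "0 \<le> V" using T w0 \<sigma>_nonneg by (simp add: V_def)
  have K1: "0 \<le> K1" by (simp add: K1_def)
  have CT: "0 \<le> CT" using T w0 \<sigma>_nonneg by (simp add: CT_def)
  have e1: "0 \<le> e1" using T const by (simp add: e1_def)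
  have C0: "0 \<le> C0" unfolding C0_def
    by (intro add_nonneg_nonneg mult_nonneg_nonneg) (use T const CT e1 K1 V in auto)
  have C: "0 \<le> C" using C0 const T by (simp add: C_def)
  show thesis
  proof (rule that[OF C])
    fix N n :: nat and \<tau> R :: real and x :: "nat \<Rightarrow> 'w \<Rightarrow> ennreal" and a b :: "nat \<Rightarrow> 'w \<Rightarrow> real"
    assume \<tau>: "0 < \<tau>" "real N * \<tau> \<le> T" and N: "0 < N" and R: "0 \<le> R" and n: "n \<le> N"
      and [measurable]: "\<And>i. a i \<in> borel_measurable M" "\<And>i. b i \<in> borel_measurable M"
      and R1: "(\<integral>\<^sup>+\<omega>. ssq (\<lambda>i. a i \<omega>) + ssq (\<lambda>i. b i \<omega> / w i) \<partial>M) \<le> ennreal R"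
      and R2: "(\<integral>\<^sup>+\<omega>. ssq (\<lambda>i. w i powr p * a i \<omega>) + ssq (\<lambda>i. w i powr p * (b i \<omega> / w i)) \<partial>M) \<le> ennreal R"
    define A where "A \<omega> = ssq (\<lambda>i. a i \<omega>) + ssq (\<lambda>i. b i \<omega> / w i)" for \<omega>
    define Dt where "Dt \<omega> = ssq (\<lambda>i. w i powr p * a i \<omega>) + ssq (\<lambda>i. w i powr p * (b i \<omega> / w i))" for \<omega>
    define EE where "EE \<omega> = (\<integral>\<^sup>+r\<in>{0..T}. (ennreal G0 + ennreal (4 * G1) * (A \<omega> + ssq (\<lambda>i. Z i \<omega> r))) \<partial>lborel)" for \<omega>
    define g where "g n \<omega> = 2 * ssq (\<lambda>i. noise_error \<tau> n i \<omega>) + ennreal (e1 * \<tau>\<^sup>2) * (ennreal K1 * EE \<omega>)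
        + ennreal (96 * L * T ^ 4 * \<tau> powr (2 * p)) * Dt \<omega> + ennreal (24 * L * T ^ 3) * Z_osc \<tau> n \<omega>" for n \<omega>
    define c where "c = 6 * L * T ^ 3 * \<tau>"
    assume "AE \<omega> in M. \<forall>n\<le>N. x n \<omega> \<le> majorant L G0 G1 (\<lambda>i. a i \<omega>) (\<lambda>i. b i \<omega>) \<tau> n \<omega>
        + ennreal (6 * L * T ^ 3 * \<tau>) * (\<Sum>j<n. x j \<omega>)"
    then have rec: "AE \<omega> in M. \<forall>n\<le>N. x n \<omega> \<le> g n \<omega> + ennreal c * (\<Sum>j<n. x j \<omega>)"
      by (simp only: majorant_def g_def e1_def K1_def EE_def A_def Dt_def c_def)
    have c: "0 \<le> c" using const T \<tau> by (simp add: c_def)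
    have [measurable]: "A \<in> borel_measurable M" "Dt \<in> borel_measurable M"
      unfolding A_def Dt_def by measurable
    have AZ: "(\<lambda>x. ennreal G0 + ennreal (4 * G1) * (A (fst x) + ssq (\<lambda>i. Z i (fst x) (snd x)))) \<in> borel_measurable (M \<Otimes>\<^sub>M lborel)"
      by measurable
    have EEm[measurable]: "EE \<in> borel_measurable M"
      unfolding EE_def by (rule time_integral_meas[OF AZ])
    have nem: "noise_error \<tau> n i \<in> borel_measurable M" for n i using \<tau> by (intro noise_error_meas) simp
    have nem'[measurable]: "(\<lambda>\<omega>. ssq (\<lambda>i. noise_error \<tau> n i \<omega>)) \<in> borel_measurable M" for n
      by (rule ssq_measurable[OF nem])
    have gm[measurable]: "g n \<in> borel_measurable M" for n unfolding g_def by measurable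
    have "1 * \<tau> \<le> real N * \<tau>" using N \<tau> by (intro mult_right_mono) auto
    then have "\<tau> \<le> T" using \<tau> by linarith
    \<comment> \<open>The energy term carries \<open>\<tau>\<close> squared; as
      \<open>p \<le> 1\<close> and \<open>\<tau> \<le> T\<close>, the surplus is absorbed by a power
      of \<open>T\<close>.\<close>
    then have \<tau>2: "\<tau>\<^sup>2 \<le> T powr (2 - 2 * p) * \<tau> powr (2 * p)"
    proof -
      have "\<tau>\<^sup>2 = \<tau> powr (2 - 2 * p) * \<tau> powr (2 * p)"
        using \<tau> by (simp flip: powr_add add: powr_numeral)
      also have "\<dots> \<le> T powr (2 - 2 * p) * \<tau> powr (2 * p)"
        using \<open>\<tau> \<le> T\<close> \<tau> p by (intro mult_right_mono powr_mono2) auto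
      finally show ?thesis .
    qed
    have EE: "(\<integral>\<^sup>+\<omega>. EE \<omega> \<partial>M) \<le> ennreal (T * (G0 + 4 * G1 * (R + V)))"
    proof -
      have "(\<integral>\<^sup>+\<omega>. EE \<omega> \<partial>M) \<le> ennreal ((T - 0) * (G0 + 4 * G1 * (R + V)))"
        unfolding EE_def
      proof (rule expectation_time_integral_le[OF AZ])
        fix r assume r: "r \<in> {0..T}"
        have "(\<integral>\<^sup>+\<omega>. ennreal G0 + ennreal (4 * G1) * (A \<omega> + ssq (\<lambda>i. Z i \<omega> r)) \<partial>M)
            = ennreal G0 + ennreal (4 * G1) * ((\<integral>\<^sup>+\<omega>. A \<omega> \<partial>M) + (\<integral>\<^sup>+\<omega>. ssq (\<lambda>i. Z i \<omega> r) \<partial>M))"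
          by (simp add: nn_integral_add nn_integral_cmult emeasure_space_1)
        also have "\<dots> \<le> ennreal G0 + ennreal (4 * G1) * (ennreal R + ennreal V)"
          using R1 Z_moment[OF r] by (intro add_left_mono mult_left_mono add_mono) (auto simp: A_def V_def)
        also have "\<dots> = ennreal (G0 + 4 * G1 * (R + V))"
          using const R V by (simp add: ennreal_mult ennreal_plus)
        finally show "(\<integral>\<^sup>+\<omega>. ennreal G0 + ennreal (4 * G1) * (A \<omega> + ssq (\<lambda>i. Z i \<omega> r)) \<partial>M) \<le> ennreal (G0 + 4 * G1 * (R + V))" .
      qed (use T const R V in auto)
      then show ?thesis by simp
    qed
    define G where "G = C0 * \<tau> powr (2 * p) * (1 + R)"
    have G: "0 \<le> G" using C0 R by (simp add: G_def)
    have g: "(\<integral>\<^sup>+\<omega>. g m \<omega> \<partial>M) \<le> ennreal G" if m: "m \<le> N" for m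
    proof -
      have "real m * \<tau> \<le> real N * \<tau>" using m \<tau> by (intro mult_right_mono) auto
      then have mT: "real m * \<tau> \<le> T" using \<tau> by linarith
      have R2': "(\<integral>\<^sup>+\<omega>. Dt \<omega> \<partial>M) \<le> ennreal R" using R2 by (simp only: Dt_def)
      have "(\<integral>\<^sup>+\<omega>. g m \<omega> \<partial>M) = ennreal 2 * (\<integral>\<^sup>+\<omega>. ssq (\<lambda>i. noise_error \<tau> m i \<omega>) \<partial>M)
         + ennreal (e1 * \<tau>\<^sup>2) * (ennreal K1 * (\<integral>\<^sup>+\<omega>. EE \<omega> \<partial>M))
         + ennreal (96 * L * T ^ 4 * \<tau> powr (2 * p)) * (\<integral>\<^sup>+\<omega>. Dt \<omega> \<partial>M)
         + ennreal (24 * L * T ^ 3) * (\<integral>\<^sup>+\<omega>. Z_osc \<tau> m \<omega> \<partial>M)"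
        unfolding g_def by (simp add: nn_integral_add nn_integral_cmult)
      also have "\<dots> \<le> ennreal 2 * ennreal (20 * (T + 1 / w0) * \<tau> powr (2 * p) * \<sigma>)
         + ennreal (e1 * \<tau>\<^sup>2) * (ennreal K1 * ennreal (T * (G0 + 4 * G1 * (R + V))))
         + ennreal (96 * L * T ^ 4 * \<tau> powr (2 * p)) * ennreal R
         + ennreal (24 * L * T ^ 3) * ennreal (128 * T * (T + 1 / w0) * \<tau> powr (2 * p) * \<sigma>)"
        by (intro add_mono mult_left_mono noise_error_moment[OF \<tau>(1) mT] EE R2' Z_osc_moment[OF \<tau>(1) mT] zero_le)
      also have "\<dots> = ennreal (2 * (20 * (T + 1 / w0) * \<tau> powr (2 * p) * \<sigma>)
         + e1 * \<tau>\<^sup>2 * (K1 * (T * (G0 + 4 * G1 * (R + V))))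
         + 96 * L * T ^ 4 * \<tau> powr (2 * p) * R
         + 24 * L * T ^ 3 * (128 * T * (T + 1 / w0) * \<tau> powr (2 * p) * \<sigma>))"
      proof -
        define k1 where "k1 = 20 * (T + 1 / w0) * \<tau> powr (2 * p) * \<sigma>"
        define k2 where "k2 = T * (G0 + 4 * G1 * (R + V))"
        define k3 where "k3 = 128 * T * (T + 1 / w0) * \<tau> powr (2 * p) * \<sigma>"
        define k4 where "k4 = 96 * L * T ^ 4 * \<tau> powr (2 * p)"
        define k5 where "k5 = e1 * \<tau>\<^sup>2"
        define k6 where "k6 = 24 * L * T ^ 3"
        have k: "0 \<le> k1" "0 \<le> k2" "0 \<le> k3" "0 \<le> k4" "0 \<le> k5" "0 \<le> k6"
          using T w0 \<sigma>_nonneg const R V e1 by (simp_all add: k1_def k2_def k3_def k4_def k5_def k6_def)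
        then show ?thesis
          unfolding k1_def[symmetric] k2_def[symmetric] k3_def[symmetric] k4_def[symmetric] k5_def[symmetric] k6_def[symmetric]
          using K1 R by (simp only: ennreal_mult[symmetric] ennreal_plus[symmetric] mult_nonneg_nonneg add_nonneg_nonneg zero_le_numeral)
      qed
      also have "\<dots> \<le> ennreal G"
      proof (rule ennreal_leI)
        define t where "t = \<tau> powr (2 * p)"
        have t: "0 \<le> t" by (simp add: t_def)
        have 1: "2 * (20 * (T + 1 / w0) * t * \<sigma>) \<le> 40 * CT * (t * (1 + R))"
        proof -
          have "2 * (20 * (T + 1 / w0) * t * \<sigma>) = 40 * CT * (t * 1)" by (simp add: CT_def)
          also have "\<dots> \<le> 40 * CT * (t * (1 + R))" using CT t R by (intro mult_left_mono) auto
          finally show ?thesis .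
        qed
        have 2: "e1 * \<tau>\<^sup>2 * (K1 * (T * (G0 + 4 * G1 * (R + V)))) \<le> e1 * T powr (2 - 2 * p) * (K1 * (T * (G0 + 4 * G1 * (1 + V)))) * (t * (1 + R))"
        proof -
          have "G0 * 1 \<le> G0 * (1 + R)" "G1 * (R + V) \<le> G1 * ((1 + V) * (1 + R))"
            using const R V by (auto intro!: mult_left_mono simp: distrib_left distrib_right)
          then have "G0 + 4 * G1 * (R + V) \<le> (G0 + 4 * G1 * (1 + V)) * (1 + R)"
            by (simp add: distrib_right mult.assoc)
          then have k: "K1 * (T * (G0 + 4 * G1 * (R + V))) \<le> K1 * (T * ((G0 + 4 * G1 * (1 + V)) * (1 + R)))"
            using K1 T by (intro mult_left_mono) auto
          have e: "e1 * \<tau>\<^sup>2 \<le> e1 * (T powr (2 - 2 * p) * t)"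
            using e1 \<tau>2 by (simp add: t_def mult_left_mono)
          have "e1 * \<tau>\<^sup>2 * (K1 * (T * (G0 + 4 * G1 * (R + V))))
              \<le> e1 * (T powr (2 - 2 * p) * t) * (K1 * (T * ((G0 + 4 * G1 * (1 + V)) * (1 + R))))"
            by (rule mult_mono[OF e k]) (use e1 K1 T const R V t in auto)
          then show ?thesis by (simp only: mult_ac)
        qed
        have 3: "96 * L * T ^ 4 * t * R \<le> 96 * L * T ^ 4 * (t * (1 + R))"
          unfolding mult.assoc[of "96 * L * T ^ 4"] using const T t R by (intro mult_left_mono) auto
        have 4: "24 * L * T ^ 3 * (128 * T * (T + 1 / w0) * t * \<sigma>) \<le> 24 * L * T ^ 3 * (128 * T * CT) * (t * (1 + R))"
        proof -
          have "24 * L * T ^ 3 * (128 * T * (T + 1 / w0) * t * \<sigma>) = 24 * L * T ^ 3 * (128 * T * CT) * (t * 1)"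
            by (simp add: CT_def)
          also have "\<dots> \<le> 24 * L * T ^ 3 * (128 * T * CT) * (t * (1 + R))"
            using CT t R const T by (intro mult_left_mono) auto
          finally show ?thesis .
        qed
        have "G = 40 * CT * (t * (1 + R)) + e1 * T powr (2 - 2 * p) * (K1 * (T * (G0 + 4 * G1 * (1 + V)))) * (t * (1 + R))
            + 96 * L * T ^ 4 * (t * (1 + R)) + 24 * L * T ^ 3 * (128 * T * CT) * (t * (1 + R))"
          unfolding G_def C0_def t_def by (simp only: distrib_right mult.assoc)
        then show "2 * (20 * (T + 1 / w0) * \<tau> powr (2 * p) * \<sigma>) + e1 * \<tau>\<^sup>2 * (K1 * (T * (G0 + 4 * G1 * (R + V))))
           + 96 * L * T ^ 4 * \<tau> powr (2 * p) * R + 24 * L * T ^ 3 * (128 * T * (T + 1 / w0) * \<tau> powr (2 * p) * \<sigma>) \<le> G"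
          unfolding t_def[symmetric] using 1 2 3 4 by linarith
      qed
      finally show ?thesis .
    qed
    \<comment> \<open>The Gronwall factor. It multiplies a sum of \<open>n\<close> terms, and
      \<open>k * n\<close> stays bounded because \<open>c * n\<close> is at most
      \<open>6 * L * T ^ 4\<close>.\<close>
    define k where "k = c * (1 + c) ^ n"
    have k: "0 \<le> k" using c by (simp add: k_def)
    have nn: "real n * \<tau> \<le> real N * \<tau>" using n \<tau> by (intro mult_right_mono) auto
    have kn: "k * real n \<le> 6 * L * T ^ 4 * exp (6 * L * T ^ 4)"
    proof -
      have "c * real n = 6 * L * T ^ 3 * (real n * \<tau>)" by (simp add: c_def)
      also have "\<dots> \<le> 6 * L * T ^ 3 * T"
        using const T by (intro mult_left_mono order_trans[OF nn \<tau>(2)]) auto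
      finally have cn: "c * real n \<le> 6 * L * T ^ 4" by (simp add: power_def eval_nat_numeral mult_ac)
      have e: "(1 + c) ^ n \<le> exp (6 * L * T ^ 4)"
        using power_le_exp[OF c, of n] cn by (meson exp_le_cancel_iff order_trans)
      have "k * real n = c * real n * (1 + c) ^ n" by (simp add: k_def)
      also have "\<dots> \<le> 6 * L * T ^ 4 * exp (6 * L * T ^ 4)"
        by (rule mult_mono[OF cn e]) (use c const T in auto)
      finally show ?thesis .
    qed
    have "AE \<omega> in M. x n \<omega> \<le> g n \<omega> + ennreal k * (\<Sum>j<n. g j \<omega>)"
      using rec
    proof eventually_elim
      case (elim \<omega>)
      have "ennreal k = ennreal c * (1 + ennreal c) ^ n"
        using c by (simp add: k_def ennreal_mult ennreal_power[symmetric] ennreal_plus)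
      then show ?case
        using discrete_gronwall[of N "\<lambda>n. x n \<omega>" "\<lambda>n. g n \<omega>" "ennreal c" n] elim n by (simp add: mult.assoc)
    qed
    \<comment> \<open>Monotonicity of the nonnegative integral holds for an arbitrary function below
      a measurable bound.\<close>
    then have "(\<integral>\<^sup>+\<omega>. x n \<omega> \<partial>M) \<le> (\<integral>\<^sup>+\<omega>. g n \<omega> + ennreal k * (\<Sum>j<n. g j \<omega>) \<partial>M)"
      by (rule nn_integral_mono_AE)
    also have "\<dots> = (\<integral>\<^sup>+\<omega>. g n \<omega> \<partial>M) + ennreal k * (\<Sum>j<n. \<integral>\<^sup>+\<omega>. g j \<omega> \<partial>M)"
      by (simp add: nn_integral_add nn_integral_cmult nn_integral_sum)
    also have "\<dots> \<le> ennreal G + ennreal k * (\<Sum>j<n. ennreal G)"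
      using n by (intro add_mono mult_left_mono sum_mono g) auto
    also have "\<dots> = ennreal (G * (1 + k * real n))"
      using G k by (simp add: ennreal_mult ennreal_plus ennreal_of_nat_eq_real_of_nat distrib_left mult_ac)
    also have "\<dots> \<le> ennreal (G * (1 + 6 * L * T ^ 4 * exp (6 * L * T ^ 4)))"
      using G kn by (intro ennreal_leI mult_left_mono) auto
    also have "G * (1 + 6 * L * T ^ 4 * exp (6 * L * T ^ 4)) = C * \<tau> powr (2 * p) * (1 + R)"
      by (simp add: G_def C_def)
    finally show "(\<integral>\<^sup>+\<omega>. x n \<omega> \<partial>M) \<le> ennreal (C * \<tau> powr (2 * p) * (1 + R))" .
  qed
qed

end

text \<open>Instantiates the deterministic estimate at one sample point. Parseval supplies the
  Lipschitz and growth bounds for the coefficients, and \<open>scheme_solution\<close> the closed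
  form of the iterates.\<close>

lemma (in fbm_modes) pathwise_error_recursion:
  fixes D :: "(real^'d::finite) set" and \<phi> :: "nat \<Rightarrow> real^'d \<Rightarrow> real" and f :: "real \<Rightarrow> real"
    and u :: "real \<Rightarrow> real^'d \<Rightarrow> real" and uj :: "nat \<Rightarrow> real^'d \<Rightarrow> real" and ub :: "nat \<Rightarrow> nat \<Rightarrow> real"
    and a b :: "nat \<Rightarrow> real"
  assumes \<omega>: "\<omega> \<in> space M" and D: "open D" "bounded D" and eig: "dirichlet_eigenbasis D lam \<phi>"
    and lip: "\<And>x y. \<bar>f x - f y\<bar> \<le> L * \<bar>x - y\<bar>"
    and u_sq: "\<And>t. t \<in> {0..T} \<Longrightarrow> sq_int D (u t)"
    and u_bdd: "\<And>t. t \<in> {0..T} \<Longrightarrow> (LINT x|lebesgue_on D. (u t x)\<^sup>2) \<le> K"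
    and F_meas: "\<And>i. (\<lambda>r. coef D \<phi> (\<lambda>x. f (u r x)) i) \<in> borel_measurable (lebesgue_on {0..T})"
    and mild: "\<And>t i. t \<in> {0..T} \<Longrightarrow> coef D \<phi> (u t) i = cos (w i * t) * a i + sin (w i * t) / w i * b i
        + integral {0..t} (\<lambda>r. sin (w i * (t - r)) / w i * coef D \<phi> (\<lambda>x. f (u r x)) i)
        + sqrt (q i) * stoch_int (\<lambda>r. sin (w i * (t - r)) / w i) 0 t (\<xi> i \<omega>)"
    and uj_sq: "\<And>j. j \<le> N \<Longrightarrow> sq_int D (uj j)"
    and step: "\<And>i j. j < N \<Longrightarrow> scheme_step (w i) (sqrt (q i)) \<tau> (\<xi> i \<omega>) j (coef D \<phi> (uj j) i) (ub j i)
        (coef D \<phi> (\<lambda>x. f (uj j x)) i) (coef D \<phi> (uj (Suc j)) i) (ub (Suc j) i)"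
    and init: "\<And>i. coef D \<phi> (uj 0) i = a i" "\<And>i. ub 0 i = b i"
    and \<tau>: "0 < \<tau>" "real N * \<tau> \<le> T" and n: "n \<le> N"
  shows "ssq (\<lambda>i. coef D \<phi> (u (real n * \<tau>)) i - coef D \<phi> (uj n) i) \<le>
      majorant (L\<^sup>2) (2 * (f 0)\<^sup>2 * measure lebesgue D) (2 * L\<^sup>2) a b \<tau> n \<omega>
        + ennreal (6 * L\<^sup>2 * T ^ 3 * \<tau>) * (\<Sum>j<n. ssq (\<lambda>i. coef D \<phi> (u (real j * \<tau>)) i - coef D \<phi> (uj j) i))"
proof -
  \<comment> \<open>Measurability is given on \<open>{0..T}\<close> only; the cut-off extends it to
    the whole line and changes no integral over subintervals.\<close>
  define F where "F i r = indicator {0..T} r * coef D \<phi> (\<lambda>x. f (u r x)) i" for i and r :: real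
  define U where "U i t = coef D \<phi> (u t) i" for i t
  define G0 where "G0 = 2 * (f 0)\<^sup>2 * measure lebesgue D"
  \<comment> \<open>A path-dependent bound that only serves finiteness; the maximum with 0 makes it
    nonnegative.\<close>
  define K' where "K' = 2 * L\<^sup>2 * max 0 K + G0"
  have F: "F i r = coef D \<phi> (\<lambda>x. f (u r x)) i" if "r \<in> {0..T}" for i r using that by (simp add: F_def)
  have Zt: "sqrt (q i) * stoch_int (\<lambda>r. sin (w i * (t - r)) / w i) 0 t (\<xi> i \<omega>) = Z i \<omega> t" if "0 \<le> t" for i t
    using that wpos[of i] by (simp add: stoch_int_sin Z_def fbm_process.W_def[OF fbm_process])
  have growth: "ssq (\<lambda>i. F i r) \<le> ennreal (2 * L\<^sup>2) * ssq (\<lambda>i. U i r) + ennreal G0" if r: "r \<in> {0..T}" for r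
    unfolding F[OF r] U_def G0_def using ssq_coef_growth[OF D eig lip u_sq[OF r]] by simp
  interpret tm: trig_mild w a b "\<lambda>i. Z i \<omega>" F U T K' "L\<^sup>2" G0 "2 * L\<^sup>2" p
  proof
    show "0 \<le> G0" by (simp add: G0_def)
    then show "0 \<le> K'" by (simp add: K'_def)
    show "F i \<in> borel_measurable lebesgue" for i
      using F_meas[of i] unfolding F_def by (simp add: borel_measurable_restrict_space_iff)
    show "Z i \<omega> \<in> borel_measurable borel" for i by (rule Z_path_meas[OF \<omega>])
    show "ssq (\<lambda>i. F i r) \<le> ennreal (2 * L\<^sup>2) * ssq (\<lambda>i. U i r) + ennreal G0" if "r \<in> {0..T}" for r
      by (rule growth[OF that])
    show "ssq (\<lambda>i. F i r) \<le> ennreal K'" if r: "r \<in> {0..T}" for r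
    proof -
      have "ssq (\<lambda>i. U i r) \<le> ennreal (max 0 K)"
        unfolding U_def using coef_Parseval[OF D eig u_sq[OF r]] u_bdd[OF r] by (simp add: ennreal_leI)
      then have "ssq (\<lambda>i. F i r) \<le> ennreal (2 * L\<^sup>2) * ennreal (max 0 K) + ennreal G0"
        by (intro order_trans[OF growth[OF r]] add_right_mono mult_left_mono) auto
      also have "\<dots> = ennreal K'"
        using \<open>0 \<le> G0\<close> by (simp only: K'_def) (simp add: ennreal_mult ennreal_plus del: max_0L)
      finally show ?thesis .
    qed
    show "U i t = cos (w i * t) * a i + sin (w i * t) / w i * b i
        + integral {0..t} (\<lambda>r. sin (w i * (t - r)) / w i * F i r) + Z i \<omega> t" if t: "t \<in> {0..T}" for i t
    proof -
      have I: "integral {0..t} (\<lambda>r. sin (w i * (t - r)) / w i * F i r)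
          = integral {0..t} (\<lambda>r. sin (w i * (t - r)) / w i * coef D \<phi> (\<lambda>x. f (u r x)) i)"
        using t by (intro Henstock_Kurzweil_Integration.integral_cong) (simp add: F_def)
      have t0: "0 \<le> t" using t by simp
      show ?thesis unfolding U_def mild[OF t] I Zt[OF t0] ..
    qed
    show "ssq (\<lambda>i. F i r - F i s) \<le> ennreal (L\<^sup>2) * ssq (\<lambda>i. U i r - U i s)"
      if r: "r \<in> {0..T}" and s: "s \<in> {0..T}" for r s
      unfolding F[OF r] F[OF s] U_def by (rule ssq_coef_lipschitz[OF D eig lip u_sq[OF r] u_sq[OF s]])
  qed (use wpos T p in auto)
  define zd where "zd m i = sqrt (q i) / w i * fbm_process.grid_sum (\<xi> i) (w i) 0 \<tau> m \<omega>" for m i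
  have "real n * \<tau> \<le> real N * \<tau>" using n \<tau> by (intro mult_right_mono) auto
  then have nT: "real n * \<tau> \<le> T" using \<tau> by linarith
  have jT: "real j * \<tau> \<in> {0..T}" if "j \<le> n" for j
  proof -
    have "real j * \<tau> \<le> real n * \<tau>" using that \<tau> by (intro mult_right_mono) auto
    then have "real j * \<tau> \<le> T" using nT by linarith
    then show ?thesis using \<tau> by simp
  qed
  have un: "coef D \<phi> (uj n) i = cos (w i * (real n * \<tau>)) * a i + sin (w i * (real n * \<tau>)) / w i * b i
        + (\<Sum>j<n. \<tau> * (sin (w i * (real n * \<tau> - real j * \<tau>)) / w i) * coef D \<phi> (\<lambda>x. f (uj j x)) i) + zd n i" for i
    using scheme_solution[where X="\<lambda>j. coef D \<phi> (uj j) i" and Y="\<lambda>j. ub j i" and F="\<lambda>j. coef D \<phi> (\<lambda>x. f (uj j x)) i"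
        and x="\<xi> i \<omega>" and c="sqrt (q i)" and w="w i" and \<tau>=\<tau> and N=N and n=n, OF _ _ step n]
      wpos[of i] \<tau>(1)
    by (simp add: init zd_def fbm_process.grid_sum_def[OF fbm_process])
  \<comment> \<open>The noise in the closed form of the scheme is a grid sum, so the difference is
    exactly the grid error.\<close>
  have noise: "Z i \<omega> (real n * \<tau>) - zd n i = noise_error \<tau> n i \<omega>" for i
  proof -
    have "Z i \<omega> (real n * \<tau>) - zd n i
        = sqrt (q i) / w i * (fbm_process.W (\<xi> i) (w i) 0 \<omega> (real n * \<tau>) - fbm_process.grid_sum (\<xi> i) (w i) 0 \<tau> n \<omega>)"
      using \<tau> by (simp add: Z_def zd_def right_diff_distrib)
    also have "\<dots> = noise_error \<tau> n i \<omega>"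
      using fbm_process.W_grid[OF fbm_process \<omega>, of \<tau> "w i" i 0 n] \<tau> wpos[of i] by (simp add: noise_error_def)
    finally show ?thesis .
  qed
  have "ssq (\<lambda>i. U i (real n * \<tau>) - coef D \<phi> (uj n) i) \<le>
      2 * ssq (\<lambda>i. Z i \<omega> (real n * \<tau>) - zd n i)
      + ennreal ((6 * T + 96 * L\<^sup>2 * T ^ 5) * \<tau>\<^sup>2) * tm.energy
      + ennreal (96 * L\<^sup>2 * T ^ 4 * \<tau> powr (2 * p)) * tm.data
      + ennreal (24 * L\<^sup>2 * T ^ 3) * tm.Z_osc \<tau> n
      + ennreal (6 * L\<^sup>2 * T ^ 3 * \<tau>) * (\<Sum>j<n. ssq (\<lambda>i. U i (real j * \<tau>) - coef D \<phi> (uj j) i))"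
  proof (rule tm.error_recursion[where un="\<lambda>n. coef D \<phi> (uj n)" and Fd="\<lambda>j. coef D \<phi> (\<lambda>x. f (uj j x))" and zd=zd, OF \<tau>(1) nT un])
    fix j assume j: "j < n"
    show "ssq (\<lambda>i. F i (real j * \<tau>) - coef D \<phi> (\<lambda>x. f (uj j x)) i) \<le> ennreal (L\<^sup>2) * ssq (\<lambda>i. U i (real j * \<tau>) - coef D \<phi> (uj j) i)"
      using j n jT[of j] unfolding U_def
      by (simp add: F ssq_coef_lipschitz[OF D eig lip u_sq uj_sq])
  qed
  also have "\<dots> \<le> majorant (L\<^sup>2) G0 (2 * L\<^sup>2) a b \<tau> n \<omega>
        + ennreal (6 * L\<^sup>2 * T ^ 3 * \<tau>) * (\<Sum>j<n. ssq (\<lambda>i. U i (real j * \<tau>) - coef D \<phi> (uj j) i))"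
    unfolding noise tm.Z_osc_def majorant_def Z_osc_def tm.data_def
    by (intro add_mono mult_left_mono order_refl order_trans[OF tm.energy_le[unfolded nn_integral_completion]] zero_le)
  finally show ?thesis by (simp only: U_def G0_def)
qed

text \<open>The velocity is given by coefficients because \<open>\<kappa> - \<alpha>\<close> may be
  negative, so it need not be a function on \<open>D\<close>. Since \<open>hnorm2\<close> is a
  squared norm, the bound is squared as well, and the two cases share one formula with a conditional
  exponent. \<open>C\<close> precedes the mesh and the iterates in the quantifier order.\<close>

theorem theorem2:
  fixes \<alpha> H T \<rho> \<kappa> :: real
    and D :: "(real^'d::finite) set"
    and lam :: "nat \<Rightarrow> real" and \<phi> :: "nat \<Rightarrow> real^'d \<Rightarrow> real"
    and q :: "nat \<Rightarrow> real"
    and f :: "real \<Rightarrow> real"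
    and M :: "'w measure"
    and \<xi> :: "nat \<Rightarrow> 'w \<Rightarrow> real \<Rightarrow> real"
    and u0 :: "'w \<Rightarrow> real^'d \<Rightarrow> real"
    and v0 :: "'w \<Rightarrow> nat \<Rightarrow> real"
    and u :: "'w \<Rightarrow> real \<Rightarrow> real^'d \<Rightarrow> real"
  assumes dim: "CARD('d) \<in> {1, 2, 3}"
    and dom: "lipschitz_domain D"
    and eig: "dirichlet_eigenbasis D lam \<phi>"
    and alpha: "0 < \<alpha>" "\<alpha> < 1"
    and hurst: "0 < H" "H < 1/2"
    and T: "0 < T"
    and rho: "- \<alpha>/4 - H*\<alpha>/2 < \<rho>" "\<rho> < (\<alpha>+1)/4 - H*\<alpha>/2"
    and Q: "\<forall>i. 0 \<le> q i" "summable (\<lambda>i. lam i powr (2*\<rho>) * q i)"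
    and kappa: "\<kappa> = \<alpha>/2 + H*\<alpha> + 2*\<rho>" "0 < \<kappa>" "\<kappa> < \<alpha> + 1/2"
    and lip: "\<exists>L. \<forall>x y. \<bar>f x - f y\<bar> \<le> L * \<bar>x - y\<bar>"
    and P: "prob_space M"
    and noise: "\<forall>i. fbm M H (\<xi> i)"
      "prob_space.indep_vars M (\<lambda>_. PiM UNIV (\<lambda>_::real. borel)) \<xi> UNIV"
    and u0_rv: "\<forall>i. (\<lambda>\<omega>. coef D \<phi> (u0 \<omega>) i) \<in> borel_measurable M"
      "AE \<omega> in M. sq_int D (u0 \<omega>)"
    and v0_rv: "\<forall>i. (\<lambda>\<omega>. v0 \<omega> i) \<in> borel_measurable M"
    and u0_fin: "hnorm2 M lam \<kappa> (\<lambda>\<omega> i. coef D \<phi> (u0 \<omega>) i) < \<infinity>"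
    and v0_fin: "hnorm2 M lam (\<kappa> - \<alpha>) v0 < \<infinity>"
    and mild_reg: "AE \<omega> in M.
        (\<forall>t\<in>{0..T}. sq_int D (u \<omega> t)) \<and>
        (\<exists>K. \<forall>t\<in>{0..T}. (LINT x|lebesgue_on D. (u \<omega> t x)\<^sup>2) \<le> K) \<and>
        (\<forall>i. (\<lambda>r. coef D \<phi> (\<lambda>x. f (u \<omega> r x)) i) \<in> borel_measurable (lebesgue_on {0..T}))"
    and mild: "AE \<omega> in M. \<forall>t\<in>{0..T}. \<forall>i.
        coef D \<phi> (u \<omega> t) i =
          cos (lam i powr (\<alpha>/2) * t) * coef D \<phi> (u0 \<omega>) i
          + sin (lam i powr (\<alpha>/2) * t) / lam i powr (\<alpha>/2) * v0 \<omega> i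
          + integral {0..t} (\<lambda>r. sin (lam i powr (\<alpha>/2) * (t - r)) / lam i powr (\<alpha>/2)
                                   * coef D \<phi> (\<lambda>x. f (u \<omega> r x)) i)
          + sqrt (q i) * stoch_int (\<lambda>r. sin (lam i powr (\<alpha>/2) * (t - r)) / lam i powr (\<alpha>/2))
                                   0 t (\<xi> i \<omega>)"
  shows "\<exists>C. \<forall>(N::nat) (uj :: nat \<Rightarrow> 'w \<Rightarrow> real^'d \<Rightarrow> real) (ub :: nat \<Rightarrow> 'w \<Rightarrow> nat \<Rightarrow> real).
     0 < N \<longrightarrow> uj 0 = u0 \<longrightarrow> ub 0 = v0 \<longrightarrow>
     (\<forall>j<N. AE \<omega> in M. sq_int D (uj (Suc j) \<omega>) \<and> (\<forall>i.
        coef D \<phi> (uj (Suc j) \<omega>) i =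
          cos (lam i powr (\<alpha>/2) * (T/N)) * coef D \<phi> (uj j \<omega>) i
          + sin (lam i powr (\<alpha>/2) * (T/N)) / lam i powr (\<alpha>/2) * ub j \<omega> i
          + (T/N) * sin (lam i powr (\<alpha>/2) * (T/N)) / lam i powr (\<alpha>/2)
              * coef D \<phi> (\<lambda>x. f (uj j \<omega> x)) i
          - sin (lam i powr (\<alpha>/2) * (T/N)) / lam i powr (\<alpha>/2) * (sqrt (q i) * \<xi> i \<omega> (j * (T/N)))
          + integral {j * (T/N) .. (Suc j) * (T/N)}
              (\<lambda>r. cos (lam i powr (\<alpha>/2) * ((Suc j) * (T/N) - r)) * (sqrt (q i) * \<xi> i \<omega> (j * (T/N))))
        \<and>
        ub (Suc j) \<omega> i =
          - (lam i powr (\<alpha>/2) * sin (lam i powr (\<alpha>/2) * (T/N)) * coef D \<phi> (uj j \<omega>) i)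
          + cos (lam i powr (\<alpha>/2) * (T/N)) * ub j \<omega> i
          + (T/N) * cos (lam i powr (\<alpha>/2) * (T/N)) * coef D \<phi> (\<lambda>x. f (uj j \<omega> x)) i
          + sqrt (q i) * \<xi> i \<omega> ((Suc j) * (T/N))
          - cos (lam i powr (\<alpha>/2) * (T/N)) * (sqrt (q i) * \<xi> i \<omega> (j * (T/N)))
          - integral {j * (T/N) .. (Suc j) * (T/N)}
              (\<lambda>r. lam i powr (\<alpha>/2) * sin (lam i powr (\<alpha>/2) * ((Suc j) * (T/N) - r))
                     * (sqrt (q i) * \<xi> i \<omega> (j * (T/N)))))) \<longrightarrow>
     (\<forall>n\<le>N.
        hnorm2 M lam 0 (\<lambda>\<omega> i. coef D \<phi> (u \<omega> (n * (T/N))) i - coef D \<phi> (uj n \<omega>) i)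
        \<le> ennreal ((C * (T/N) powr (if \<kappa> \<le> \<alpha>/2 + H*\<alpha> then \<kappa>/\<alpha> else H + 1/2)
              * (sqrt (enn2real (hnorm2 M lam \<kappa> (\<lambda>\<omega> i. coef D \<phi> (u0 \<omega>) i)))
                 + sqrt (enn2real (hnorm2 M lam (\<kappa> - \<alpha>) v0)) + 1))\<^sup>2))"
proof -
  interpret prob_space M by (rule P)
  from lip obtain L where L': "\<forall>x y. \<bar>f x - f y\<bar> \<le> L * \<bar>x - y\<bar>" ..
  then have L: "\<And>x y. \<bar>f x - f y\<bar> \<le> L * \<bar>x - y\<bar>" by simp
  note dom' = dom[unfolded lipschitz_domain_def]
  have D: "open D" "bounded D"
    by (rule conjunct1[OF dom'], rule conjunct1[OF conjunct2[OF conjunct2[OF dom']]])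
  have "\<exists>l>0. \<forall>i. l \<le> lam i"
    by (rule dirichlet_eigenbasis_lower_bound[OF D eig]) auto
  then obtain l where l: "0 < l" "\<And>i. l \<le> lam i" by auto
  have lam: "0 < lam i" for i using l by (meson less_le_trans)
  define w where "w i = lam i powr (\<alpha>/2)" for i
  define w0 where "w0 = l powr (\<alpha>/2)"
  define p where "p = (if \<kappa> \<le> \<alpha>/2 + H*\<alpha> then \<kappa>/\<alpha> else H + 1/2)"
  have w0: "0 < w0" using l by (simp add: w0_def)
  have w: "w0 \<le> w i" "0 < w i" for i
  proof -
    show "w0 \<le> w i" unfolding w_def w0_def using l(1) l(2)[of i] alpha by (intro powr_mono2) auto
    show "0 < w i" using lam[of i] by (simp add: w_def)
  qed
  have p: "0 < p" "p \<le> 1" "2 * p \<le> 1 + 2 * H" "p \<le> \<kappa> / \<alpha>"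
  proof -
    have "\<kappa> \<le> \<alpha>/2 + H*\<alpha> \<longleftrightarrow> \<kappa> / \<alpha> \<le> 1/2 + H"
      using alpha by (simp add: pos_divide_le_eq distrib_right)
    moreover have "0 < \<kappa> / \<alpha>" using alpha kappa by simp
    ultimately show "0 < p" "p \<le> 1" "2 * p \<le> 1 + 2 * H" "p \<le> \<kappa> / \<alpha>"
      using hurst by (auto simp: p_def)
  qed
  \<comment> \<open>The exponent is nonpositive because \<open>p \<le> \<kappa> / \<alpha>\<close>,
    so this power of \<open>w i\<close> is largest at the smallest admissible frequency
    \<open>w0\<close>.\<close>
  define C1 where "C1 = w0 powr (2 * p - 2 * \<kappa> / \<alpha>)"
  have C1: "0 \<le> C1" "w i powr (2 * p - 2 * \<kappa> / \<alpha>) \<le> C1" for i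
  proof -
    show "0 \<le> C1" by (simp add: C1_def)
    show "w i powr (2 * p - 2 * \<kappa> / \<alpha>) \<le> C1"
      unfolding C1_def using w0 w[of i] p(4) by (intro powr_mono2') auto
  qed
  have wlam: "w i powr (2 * s / \<alpha>) = lam i powr s" for i s
    using alpha by (simp add: w_def powr_powr)
  have w2p: "w i powr (2 * p) \<le> C1 * lam i powr \<kappa>" for i
  proof -
    have "w i powr (2 * p) = w i powr (2 * p - 2 * \<kappa> / \<alpha>) * w i powr (2 * \<kappa> / \<alpha>)"
      by (simp flip: powr_add)
    also have "\<dots> \<le> C1 * lam i powr \<kappa>"
      unfolding wlam by (intro mult_right_mono C1) auto
    finally show ?thesis .
  qed
  \<comment> \<open>By the choice of \<open>\<kappa>\<close>,
    \<open>2 * \<kappa> / \<alpha> = 1 + 2 * H + 4 * \<rho> / \<alpha>\<close>, and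
    \<open>w powr (4 * \<rho> / \<alpha>)\<close> is \<open>lam powr (2 * \<rho>)\<close>. This is
    where the assumption on \<open>Q\<close> meets the moment bounds.\<close>
  have wq: "w i powr (2 * p - 1 - 2 * H) \<le> C1 * lam i powr (2 * \<rho>)" for i
  proof -
    have "2 * p - 1 - 2 * H = (2 * p - 2 * \<kappa> / \<alpha>) + 2 * (2 * \<rho>) / \<alpha>"
      using alpha kappa(1) by (simp add: field_simps)
    then have "w i powr (2 * p - 1 - 2 * H) = w i powr (2 * p - 2 * \<kappa> / \<alpha>) * lam i powr (2 * \<rho>)"
      by (simp only: powr_add wlam)
    also have "\<dots> \<le> C1 * lam i powr (2 * \<rho>)" by (intro mult_right_mono C1) auto
    finally show ?thesis .
  qed
  have summ: "summable (\<lambda>i. q i * w i powr (2 * p - 1 - 2 * H))"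
  proof (rule summable_comparison_test'[where N=0])
    show "summable (\<lambda>i. C1 * (lam i powr (2 * \<rho>) * q i))" by (rule summable_mult[OF Q(2)])
    fix i :: nat
    have "q i * w i powr (2 * p - 1 - 2 * H) \<le> q i * (C1 * lam i powr (2 * \<rho>))"
      using Q(1) by (intro mult_left_mono wq) auto
    then show "norm (q i * w i powr (2 * p - 1 - 2 * H)) \<le> C1 * (lam i powr (2 * \<rho>) * q i)"
      using Q(1) by (simp add: abs_mult mult_ac)
  qed
  interpret fm: fbm_modes M H \<xi> w q w0 T p
    by unfold_locales (use noise(1) hurst w0 w Q(1) T p summ in auto)
  define a where "a i \<omega> = coef D \<phi> (u0 \<omega>) i" for i \<omega>
  define b where "b i \<omega> = v0 \<omega> i" for i \<omega>
  define SU where "SU \<omega> = (\<Sum>i. ennreal (lam i powr \<kappa> * (a i \<omega>)\<^sup>2))" for \<omega>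
  define SV where "SV \<omega> = (\<Sum>i. ennreal (lam i powr (\<kappa> - \<alpha>) * (b i \<omega>)\<^sup>2))" for \<omega>
  have abm[measurable]: "a i \<in> borel_measurable M" "b i \<in> borel_measurable M" for i
    unfolding a_def[abs_def] b_def[abs_def] using u0_rv(1) v0_rv by simp_all
  have Sm[measurable]: "SU \<in> borel_measurable M" "SV \<in> borel_measurable M"
    unfolding SU_def[abs_def] SV_def[abs_def] by measurable
  define A where "A = sqrt (enn2real (hnorm2 M lam \<kappa> (\<lambda>\<omega> i. coef D \<phi> (u0 \<omega>) i)))"
  define B where "B = sqrt (enn2real (hnorm2 M lam (\<kappa> - \<alpha>) v0))"
  have AB: "0 \<le> A" "0 \<le> B" by (auto simp: A_def B_def enn2real_nonneg)
  have SU: "(\<integral>\<^sup>+\<omega>. SU \<omega> \<partial>M) = ennreal (A\<^sup>2)"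
    using u0_fin by (simp add: A_def enn2real_nonneg SU_def a_def hnorm2_def less_top)
  have SV: "(\<integral>\<^sup>+\<omega>. SV \<omega> \<partial>M) = ennreal (B\<^sup>2)"
    using v0_fin by (simp add: B_def enn2real_nonneg SV_def b_def hnorm2_def less_top)
  \<comment> \<open>One constant for both weights of the data: the first summand dominates 1 by a
    multiple of \<open>lam powr \<kappa>\<close>, the second dominates
    \<open>w powr (2 * p)\<close>.\<close>
  define C2 where "C2 = l powr (- \<kappa>) + C1"
  have C2: "0 \<le> C2" using C1 by (simp add: C2_def)
  have ssq_le: "ssq c \<le> ennreal C2 * (\<Sum>i. ennreal (d i))" if "\<And>i. (c i)\<^sup>2 \<le> C2 * d i" "\<And>i. 0 \<le> d i" for c d
  proof -
    have "ssq c \<le> (\<Sum>i. ennreal C2 * ennreal (d i))"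
      unfolding ssq_def using that C2 by (intro suminf_le) (auto simp flip: ennreal_mult intro!: ennreal_leI)
    then show ?thesis by simp
  qed
  have one_le: "1 \<le> C2 * lam i powr \<kappa>" for i
  proof -
    have "1 = l powr (- \<kappa>) * l powr \<kappa>" using l by (simp flip: powr_add)
    also have "\<dots> \<le> C2 * lam i powr \<kappa>"
      using l C1 kappa by (intro mult_mono powr_mono2) (auto simp: C2_def)
    finally show ?thesis .
  qed
  have w2p': "w i powr (2 * p) \<le> C2 * lam i powr \<kappa>" for i
    by (rule order_trans[OF w2p]) (auto simp: C2_def intro!: mult_right_mono)
  \<comment> \<open>Division by \<open>w\<close> accounts for the shift from \<open>\<kappa>\<close>
    to \<open>\<kappa> - \<alpha>\<close> in the norm of the velocity.\<close>
  have inv_w: "(x / w i)\<^sup>2 = lam i powr (- \<alpha>) * x\<^sup>2" for x i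
    using lam[of i] by (simp add: w_def power_divide powr_minus_divide power2_eq_square flip: powr_add)
  have lam_diff: "lam i powr (\<kappa> - \<alpha>) = lam i powr \<kappa> * lam i powr (- \<alpha>)" for i
    by (simp flip: powr_add)
  have wp2: "(w i powr p * x)\<^sup>2 = w i powr (2 * p) * x\<^sup>2" for x i
    by (simp add: power_mult_distrib power2_eq_square flip: powr_add)
  have ssq_data:
    "ssq (\<lambda>i. a i \<omega>) \<le> ennreal C2 * SU \<omega>" "ssq (\<lambda>i. b i \<omega> / w i) \<le> ennreal C2 * SV \<omega>"
    "ssq (\<lambda>i. w i powr p * a i \<omega>) \<le> ennreal C2 * SU \<omega>"
    "ssq (\<lambda>i. w i powr p * (b i \<omega> / w i)) \<le> ennreal C2 * SV \<omega>" for \<omega>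
  proof -
    show "ssq (\<lambda>i. a i \<omega>) \<le> ennreal C2 * SU \<omega>" unfolding SU_def
      using mult_right_mono[OF one_le zero_le_power2] by (intro ssq_le) (auto simp: mult.assoc)
    show "ssq (\<lambda>i. w i powr p * a i \<omega>) \<le> ennreal C2 * SU \<omega>" unfolding SU_def
      using mult_right_mono[OF w2p' zero_le_power2] by (intro ssq_le) (auto simp: mult.assoc wp2)
    have nn: "0 \<le> lam i powr (- \<alpha>) * (b i \<omega>)\<^sup>2" for i by simp
    show "ssq (\<lambda>i. b i \<omega> / w i) \<le> ennreal C2 * SV \<omega>" unfolding SV_def
      using mult_right_mono[OF one_le nn] by (intro ssq_le) (auto simp: mult.assoc inv_w lam_diff)
    show "ssq (\<lambda>i. w i powr p * (b i \<omega> / w i)) \<le> ennreal C2 * SV \<omega>" unfolding SV_def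
    proof (rule ssq_le)
      fix i
      have "(w i powr p * (b i \<omega> / w i))\<^sup>2 = w i powr (2 * p) * (lam i powr (- \<alpha>) * (b i \<omega>)\<^sup>2)"
        by (simp only: wp2 inv_w)
      also have "\<dots> \<le> C2 * lam i powr \<kappa> * (lam i powr (- \<alpha>) * (b i \<omega>)\<^sup>2)"
        by (rule mult_right_mono[OF w2p' nn])
      finally show "(w i powr p * (b i \<omega> / w i))\<^sup>2 \<le> C2 * (lam i powr (\<kappa> - \<alpha>) * (b i \<omega>)\<^sup>2)"
        by (simp only: lam_diff mult.assoc)
    qed simp
  qed
  define R where "R = C2 * (A\<^sup>2 + B\<^sup>2)"
  have R: "0 \<le> R" using C2 by (simp add: R_def)
  have C2SUV: "(\<integral>\<^sup>+\<omega>. ennreal C2 * SU \<omega> + ennreal C2 * SV \<omega> \<partial>M) = ennreal R"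
    using C2 by (simp add: nn_integral_add nn_integral_cmult SU SV R_def distrib_left ennreal_mult)
  have R1: "(\<integral>\<^sup>+\<omega>. ssq (\<lambda>i. a i \<omega>) + ssq (\<lambda>i. b i \<omega> / w i) \<partial>M) \<le> ennreal R"
    unfolding C2SUV[symmetric] by (intro nn_integral_mono add_mono ssq_data)
  have R2: "(\<integral>\<^sup>+\<omega>. ssq (\<lambda>i. w i powr p * a i \<omega>) + ssq (\<lambda>i. w i powr p * (b i \<omega> / w i)) \<partial>M) \<le> ennreal R"
    unfolding C2SUV[symmetric] by (intro nn_integral_mono add_mono ssq_data)
  define G0 where "G0 = 2 * (f 0)\<^sup>2 * measure lebesgue D"
  have G0: "0 \<le> G0" by (simp add: G0_def)
  have L2: "0 \<le> 2 * L\<^sup>2" by simp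
  obtain C where C: "0 \<le> C" and err: "\<And>N \<tau> R n x a b. 0 < \<tau> \<Longrightarrow> real N * \<tau> \<le> T \<Longrightarrow> 0 < N \<Longrightarrow> 0 \<le> R \<Longrightarrow> n \<le> N \<Longrightarrow>
     (\<And>i. a i \<in> borel_measurable M) \<Longrightarrow> (\<And>i. b i \<in> borel_measurable M) \<Longrightarrow>
     (\<integral>\<^sup>+\<omega>. ssq (\<lambda>i. a i \<omega>) + ssq (\<lambda>i. b i \<omega> / w i) \<partial>M) \<le> ennreal R \<Longrightarrow>
     (\<integral>\<^sup>+\<omega>. ssq (\<lambda>i. w i powr p * a i \<omega>) + ssq (\<lambda>i. w i powr p * (b i \<omega> / w i)) \<partial>M) \<le> ennreal R \<Longrightarrow>
     (AE \<omega> in M. \<forall>n\<le>N. x n \<omega> \<le> fm.majorant (L\<^sup>2) G0 (2 * L\<^sup>2) (\<lambda>i. a i \<omega>) (\<lambda>i. b i \<omega>) \<tau> n \<omega>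
        + ennreal (6 * L\<^sup>2 * T ^ 3 * \<tau>) * (\<Sum>j<n. x j \<omega>)) \<Longrightarrow>
     (\<integral>\<^sup>+\<omega>. x n \<omega> \<partial>M) \<le> ennreal (C * \<tau> powr (2 * p) * (1 + R))"
  proof -
    show thesis by (rule fm.expected_error[OF zero_le_power2[of L] G0 L2]) (fact that)
  qed
  show ?thesis
  \<comment> \<open>The estimate is proved for squares, whence the root; \<open>1 + C2\<close> comes
    from \<open>1 + R \<le> (1 + C2) * (A + B + 1)\<^sup>2\<close>.\<close>
  proof (rule exI[of _ "sqrt (C * (1 + C2))"], intro allI impI, goal_cases)
    case (1 N uj ub n)
    note N = 1(1) and init = 1(2,3) and n = 1(5)
    define \<tau> where "\<tau> = T / real N"
    have \<tau>: "0 < \<tau>" "real N * \<tau> \<le> T" using T N by (auto simp: \<tau>_def)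
    define x where "x m \<omega> = ssq (\<lambda>i. coef D \<phi> (u \<omega> (real m * \<tau>)) i - coef D \<phi> (uj m \<omega>) i)" for m \<omega>
    \<comment> \<open>Each step of the scheme has its own null set; finitely many of them are merged
      into one.\<close>
    have step: "AE \<omega> in M. \<forall>j\<in>{..<N}. sq_int D (uj (Suc j) \<omega>) \<and> (\<forall>i. scheme_step (w i) (sqrt (q i)) \<tau> (\<xi> i \<omega>) j
        (coef D \<phi> (uj j \<omega>) i) (ub j \<omega> i) (coef D \<phi> (\<lambda>x. f (uj j \<omega> x)) i) (coef D \<phi> (uj (Suc j) \<omega>) i) (ub (Suc j) \<omega> i))"
      unfolding scheme_step_def using 1(4)[folded w_def \<tau>_def]
      by (subst AE_ball_countable) (auto simp only: countable_finite finite_lessThan lessThan_iff)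
    have rec: "AE \<omega> in M. \<forall>n\<le>N. x n \<omega> \<le> fm.majorant (L\<^sup>2) G0 (2 * L\<^sup>2) (\<lambda>i. a i \<omega>) (\<lambda>i. b i \<omega>) \<tau> n \<omega>
        + ennreal (6 * L\<^sup>2 * T ^ 3 * \<tau>) * (\<Sum>j<n. x j \<omega>)"
      using step mild_reg mild[folded w_def] u0_rv(2) AE_space
    proof eventually_elim
      case (elim \<omega>)
      obtain K where K: "\<And>t. t \<in> {0..T} \<Longrightarrow> (LINT x|lebesgue_on D. (u \<omega> t x)\<^sup>2) \<le> K"
        using elim(2) by blast
      have sq: "sq_int D (uj j \<omega>)" if "j \<le> N" for j
        using that elim(1,4) init by (cases j) auto
      show ?case
        unfolding x_def G0_def
      proof (intro allI impI fm.pathwise_error_recursion[where u="u \<omega>" and uj="\<lambda>j. uj j \<omega>" and ub="\<lambda>j. ub j \<omega>"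
            and a="\<lambda>i. a i \<omega>" and b="\<lambda>i. b i \<omega>" and K=K and N=N, OF _ D eig L])
        show "\<omega> \<in> space M" by (rule elim(5))
        show "t \<in> {0..T} \<Longrightarrow> sq_int D (u \<omega> t)" for t using elim(2) by blast
        show "t \<in> {0..T} \<Longrightarrow> (LINT x|lebesgue_on D. (u \<omega> t x)\<^sup>2) \<le> K" for t by (rule K)
        show "(\<lambda>r. coef D \<phi> (\<lambda>x. f (u \<omega> r x)) i) \<in> borel_measurable (lebesgue_on {0..T})" for i
          using elim(2) by blast
        show "coef D \<phi> (u \<omega> t) i = cos (w i * t) * a i \<omega> + sin (w i * t) / w i * b i \<omega>
            + integral {0..t} (\<lambda>r. sin (w i * (t - r)) / w i * coef D \<phi> (\<lambda>x. f (u \<omega> r x)) i)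
            + sqrt (q i) * stoch_int (\<lambda>r. sin (w i * (t - r)) / w i) 0 t (\<xi> i \<omega>)" if "t \<in> {0..T}" for t i
          using elim(3) that unfolding a_def b_def by blast
        show "j \<le> N \<Longrightarrow> sq_int D (uj j \<omega>)" for j by (rule sq)
      next
        fix i j assume "j < N"
        then have j: "j \<in> {..<N}" by simp
        show "scheme_step (w i) (sqrt (q i)) \<tau> (\<xi> i \<omega>) j (coef D \<phi> (uj j \<omega>) i) (ub j \<omega> i)
            (coef D \<phi> (\<lambda>x. f (uj j \<omega> x)) i) (coef D \<phi> (uj (Suc j) \<omega>) i) (ub (Suc j) \<omega> i)"
          by (rule elim(1)[rule_format, OF j, THEN conjunct2, rule_format])
      next
        show "coef D \<phi> (uj 0 \<omega>) i = a i \<omega>" "ub 0 \<omega> i = b i \<omega>" for i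
          by (simp_all add: init a_def b_def)
      qed (use \<tau> in auto)
    qed
    have "hnorm2 M lam 0 (\<lambda>\<omega> i. coef D \<phi> (u \<omega> (real n * (T / real N))) i - coef D \<phi> (uj n \<omega>) i) = (\<integral>\<^sup>+\<omega>. x n \<omega> \<partial>M)"
    proof -
      have "lam i powr 0 = 1" for i using lam[of i] by simp
      then show ?thesis by (simp only: hnorm2_def x_def ssq_def \<tau>_def mult_1)
    qed
    also have "\<dots> \<le> ennreal (C * \<tau> powr (2 * p) * (1 + R))"
      by (rule err[OF \<tau> N R n abm R1 R2 rec])
    also have "\<dots> \<le> ennreal ((sqrt (C * (1 + C2)) * \<tau> powr p * (A + B + 1))\<^sup>2)"
    proof (rule ennreal_leI)
      have "A\<^sup>2 + B\<^sup>2 \<le> (A + B + 1)\<^sup>2" "1 \<le> (A + B + 1)\<^sup>2"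
        using AB by (auto simp: power2_eq_square algebra_simps add_nonneg_nonneg)
      then have "1 + R \<le> (1 + C2) * (A + B + 1)\<^sup>2"
        using mult_left_mono[of "A\<^sup>2 + B\<^sup>2" "(A + B + 1)\<^sup>2" C2] C2 by (simp add: R_def distrib_right)
      then have "C * \<tau> powr (2 * p) * (1 + R) \<le> C * \<tau> powr (2 * p) * ((1 + C2) * (A + B + 1)\<^sup>2)"
        using C by (intro mult_left_mono) auto
      also have "\<dots> = (sqrt (C * (1 + C2)) * \<tau> powr p * (A + B + 1))\<^sup>2"
      proof -
        have "(\<tau> powr p)\<^sup>2 = \<tau> powr (2 * p)" by (simp add: power2_eq_square flip: powr_add)
        moreover have "(sqrt (C * (1 + C2)))\<^sup>2 = C * (1 + C2)" using C C2 by simp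
        ultimately show ?thesis by (simp only: power_mult_distrib mult_ac)
      qed
      finally show "C * \<tau> powr (2 * p) * (1 + R) \<le> (sqrt (C * (1 + C2)) * \<tau> powr p * (A + B + 1))\<^sup>2" .
    qed
    finally show ?case
      by (simp only: \<tau>_def p_def A_def B_def)
  qed
qed

end
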